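(* Let $\mathcal X$ be a simplicial sheaf on the site of complex spaces with the strong topology, with base point $x$. Assume that $\pi^{par}_{i,j}(\mathcal X,x)\ne 0$ for some $i,j$ with $i-j>0$, or $\pi^{iper}_{n,m}(z_1,z_2)(\mathcal X,x)\neq 0$ for some $n$ and some $m>0$. Then $\mathfrak{Ip}(\mathcal X)$ is not $\mathbb C$-weakly equivalent to a hyperbolic sheaf. In particular, if $X$ is a complex space such that $\pi^{par}_{i,j}(X,x)\neq 0$ for some $i-j>0$ or $\pi^{iper}_{n,m}(z_1,z_2)(X,x)\ne 0$ for some $m>0$, then $X$ is not a Brody hyperbolic complex space.
   Context: A complex space $X$ is Brody hyperbolic if every holomorphic map $\mathbb C\to X$ is constant. $\mathcal S_T$ is the site of complex spaces and holomorphic maps with the strong topology (coverings are open coverings in the classical topology). $\mathcal F_T(\mathcal S)$ is the category of sheaves of sets on it and $\Delta^{op}\mathcal F_T(\mathcal S)$ the category of simplicial sheaves. A complex space is identified with the sheaf it represents, and a sheaf with a constant simplicial sheaf; $\mathrm{pt}$ is the final sheaf. A morphism of simplicial sheaves is a simplicial weak equivalence if it induces weak equivalences of simplicial sets on all stalks; $\mathcal H_s$ is the localization of $\Delta^{op}\mathcal F_T(\mathcal S)$ at the simplicial weak equivalences. A simplicial sheaf $\mathcal X$ (in particular a sheaf) is hyperbolic (equivalently, $\mathbb C$-local) if for every simplicial sheaf $\mathcal Y$ the projection $\mathcal Y\times\mathbb C\to\mathcal Y$ induces a bijection $\mathrm{Hom}_{\mathcal H_s}(\mathcal Y,\mathcal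 X)\to\mathrm{Hom}_{\mathcal H_s}(\mathcal Y\times\mathbb C,\mathcal X)$. A morphism $f:\mathcal X\to\mathcal Y$ is a $\mathbb C$-weak equivalence if for every $\mathbb C$-local $\mathcal Z$ composition with $f$ is a bijection between $\mathrm{Hom}_{\mathcal H_s}(\mathcal Y,\mathcal Z)$ and $\mathrm{Hom}_{\mathcal H_s}(\mathcal X,\mathcal Z)$. $\mathcal H$ is the localization of $\Delta^{op}\mathcal F_T(\mathcal S)$ at the $\mathbb C$-weak equivalences, and $\mathcal H_\bullet$ its pointed version. Two simplicial sheaves are $\mathbb C$-weakly equivalent if they are isomorphic in $\mathcal H$. $(\mathfrak{Ip},\mathfrak r)$ is a fixed hyperbolic resolution functor: a functor on simplicial sheaves with a natural transformation $\mathfrak r:\mathrm{Id}\to\mathfrak{Ip}$ such that $\mathfrak{Ip}(\mathcal X)$ is hyperbolic and fibrant for the simplicial model structure (fibrations: right lifting property against monomorphisms that are simplicial weak equivalences), and $\mathfrak r_{\mathcal X}$ is a monomorphism and a $\mathbb C$-weak equivalence (such a functor exists). For pointed simplicial sheaves, $\mathcal X\wedge\mathcal Y=(\mathcal X\times\mathcal Y)/(\mathcal X\vee\mathcal Y)$, where $\mathcal X\vee\mathcal Y$ is the colimit of $\mathcal X\leftarrow\mathrm{pt}\to\mathcal Y$; quotients are colimits taken in (simplicial) sheaves, pointed by the image of the collapsed subobject. $S^1_{par}=\mathbb C/(\{0\}\amalg\{1\})$, and $S^n_{par}$ is its $n$-fold smash power. With $D\subset\mathbb C$ the unit disc and $z_1\ne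 z_2$ in $D$, $S^1_{iper}(z_1,z_2)=D/(\{z_1\}\amalg\{z_2\})$, and $S^n_{iper}(z_1,z_2)$ is its $n$-fold smash power. (A $0$-fold smash power is $\mathrm{pt}\amalg\mathrm{pt}$; $\mathbb C\setminus 0$ is pointed by $1$.) For a pointed simplicial sheaf $(\mathcal X,x)$: $$\pi^{par}_{i,j}(\mathcal X,x)=\mathrm{Hom}_{\mathcal H_\bullet}\big((\mathbb C\setminus 0)^{\wedge j}\wedge S^{i-j}_{par},(\mathcal X,x)\big),\quad i\ge j\ge 0,$$ $$\pi^{iper}_{n,m}(z_1,z_2)(\mathcal X,x)=\mathrm{Hom}_{\mathcal H_\bullet}\big(S^n_{iper}(z_1,z_2)\wedge S^m_{par},(\mathcal X,x)\big),\quad n,m\ge 0.$$ "$\neq 0$" means that the pointed set contains an element other than the class of the constant map to the base point. *)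

theory Defs
  imports "HOL-Complex_Analysis.Complex_Analysis" "HOL-Homology.Simplices"
begin

section \<open>Complex spaces\<close>

text \<open>
  Complex spaces are reduced and Hausdorff. Such a space is given by its topology and its
  structure sheaf, a sheaf of complex-valued functions: \<open>funs X V\<close> is the set of holomorphic functions
  on the open set \<open>V\<close>, each of them extensional, i.e. \<open>undefined\<close> off \<open>V\<close>. Only the values of \<open>funs X\<close>
  at open sets matter.
\<close>

record 'p cspace =
  ctop :: "'p topology"
  funs :: "'p set \<Rightarrow> ('p \<Rightarrow> complex) set"

abbreviation points :: "'p cspace \<Rightarrow> 'p set" where
  "points X \<equiv> topspace (ctop X)"

text \<open>
  $\mathbb{C}^n$ is realised inside the product topological space of all sequences, so that the
  dimension may vary.
\<close>

definition Cn :: "nat \<Rightarrow> (nat \<Rightarrow> complex) set" where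
  "Cn n = {z. \<forall>i\<ge>n. z i = 0}"

definition Cn_open :: "nat \<Rightarrow> (nat \<Rightarrow> complex) set \<Rightarrow> bool" where
  "Cn_open n W \<longleftrightarrow> openin (top_of_set (Cn n)) W"

definition Cn_holomorphic :: "nat \<Rightarrow> (nat \<Rightarrow> complex) set \<Rightarrow> ((nat \<Rightarrow> complex) \<Rightarrow> complex) \<Rightarrow> bool" where
  "Cn_holomorphic n W f \<longleftrightarrow>
    (\<forall>a\<in>W. \<exists>c. tendsto
       (\<lambda>z. (f z - f a - (\<Sum>i<n. c i * (z i - a i))) / of_real (\<Sum>i<n. cmod (z i - a i))) 0 (at a within W))"

text \<open>
  The local model is the common zero set in an open \<open>W\<close> of $\mathbb{C}^n$ of a finite set \<open>G\<close> of
  holomorphic functions; its holomorphic functions are those which locally extend to holomorphic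
  functions of the ambient space.
\<close>

definition local_model :: "'p cspace \<Rightarrow> 'p set \<Rightarrow> nat \<Rightarrow> (nat \<Rightarrow> complex) set \<Rightarrow>
    ((nat \<Rightarrow> complex) \<Rightarrow> complex) set \<Rightarrow> ('p \<Rightarrow> nat \<Rightarrow> complex) \<Rightarrow> bool" where
  "local_model X V n W G \<phi> \<longleftrightarrow>
     openin (ctop X) V \<and> Cn_open n W \<and> finite G \<and> (\<forall>g\<in>G. Cn_holomorphic n W g) \<and>
     homeomorphic_map (subtopology (ctop X) V) (top_of_set {z\<in>W. \<forall>g\<in>G. g z = 0}) \<phi> \<and>
     (\<forall>V' f. openin (ctop X) V' \<and> V' \<subseteq> V \<longrightarrow>
        (f \<in> funs X V' \<longleftrightarrow>
           f \<in> extensional V' \<and>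
           (\<forall>p\<in>V'. \<exists>W' h. Cn_open n W' \<and> \<phi> p \<in> W' \<and> Cn_holomorphic n W' h \<and>
                           (\<forall>q\<in>V'. \<phi> q \<in> W' \<longrightarrow> f q = h (\<phi> q)))))"

definition complex_space :: "'p cspace \<Rightarrow> bool" where
  "complex_space X \<longleftrightarrow>
     Hausdorff_space (ctop X) \<and>
     (\<forall>V. openin (ctop X) V \<longrightarrow> funs X V \<subseteq> extensional V) \<and>
     (\<forall>V V' f. openin (ctop X) V \<and> openin (ctop X) V' \<and> V' \<subseteq> V \<and> f \<in> funs X V \<longrightarrow>
        restrict f V' \<in> funs X V') \<and>
     (\<forall>V f. openin (ctop X) V \<and> f \<in> extensional V \<and>
        (\<forall>p\<in>V. \<exists>V'. openin (ctop X) V' \<and> p \<in> V' \<and> V' \<subseteq> V \<and> restrict f V' \<in> funs X V') \<longrightarrow>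
        f \<in> funs X V) \<and>
     (\<forall>p\<in>points X. \<exists>V n W G \<phi>. p \<in> V \<and> local_model X V n W G \<phi>)"

definition hol_maps :: "'p cspace \<Rightarrow> 'p cspace \<Rightarrow> ('p \<Rightarrow> 'p) set" where
  "hol_maps X Y = {f \<in> extensional (points X). continuous_map (ctop X) (ctop Y) f \<and>
     (\<forall>W g. openin (ctop Y) W \<and> g \<in> funs Y W \<longrightarrow>
        (\<lambda>x\<in>{x\<in>points X. f x \<in> W}. g (f x)) \<in> funs X {x\<in>points X. f x \<in> W})}"

definition open_sub :: "'p cspace \<Rightarrow> 'p set \<Rightarrow> 'p cspace" (infixl "\<restriction>\<^sub>o" 75) where
  "X \<restriction>\<^sub>o V = \<lparr>ctop = subtopology (ctop X) V, funs = funs X\<rparr>"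

text \<open>
  The points of a complex space are taken from an arbitrary type \<open>'q\<close>, enlarged by a copy of the
  complex numbers so that the affine line and all the local models are available.
\<close>

type_synonym 'q pts = "complex + 'q"

definition cline :: "'q pts cspace" where
  "cline = \<lparr>ctop = topology (\<lambda>S. S \<subseteq> range Inl \<and> open (Inl -` S :: complex set)),
            funs = (\<lambda>V. {f \<in> extensional V. (\<lambda>z. f (Inl z)) holomorphic_on (Inl -` V)})\<rparr>"

definition disc :: "'q pts cspace" where
  "disc = cline \<restriction>\<^sub>o (Inl ` ball 0 1)"

definition punctured_line :: "'q pts cspace" where
  "punctured_line = cline \<restriction>\<^sub>o (Inl ` (- {0}))"

definition Brody_hyperbolic :: "'q pts cspace \<Rightarrow> bool" where
  "Brody_hyperbolic X \<longleftrightarrow> (\<forall>f\<in>hol_maps cline X. \<forall>p\<in>points cline. \<forall>q\<in>points cline. f p = f q)"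


section \<open>Sheaves and simplicial sheaves\<close>

text \<open>
  \<open>restr F U V f\<close> is the map from the sections over \<open>V\<close> to the sections over \<open>U\<close> induced by a
  holomorphic map \<open>f\<close> from \<open>U\<close> to \<open>V\<close>.
\<close>

record ('p, 'v) presheaf =
  sections :: "'p cspace \<Rightarrow> 'v set"
  restr :: "'p cspace \<Rightarrow> 'p cspace \<Rightarrow> ('p \<Rightarrow> 'p) \<Rightarrow> 'v \<Rightarrow> 'v"

definition incl :: "'p set \<Rightarrow> 'p \<Rightarrow> 'p" where
  "incl V = (\<lambda>x\<in>V. x)"

definition restr_open :: "('p, 'v) presheaf \<Rightarrow> 'p cspace \<Rightarrow> 'p set \<Rightarrow> 'p set \<Rightarrow> 'v \<Rightarrow> 'v" where
  "restr_open F U W V = restr F (U \<restriction>\<^sub>o W) (U \<restriction>\<^sub>o V) (incl W)"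

definition is_presheaf :: "('p, 'v) presheaf \<Rightarrow> bool" where
  "is_presheaf F \<longleftrightarrow>
     (\<forall>U V f. complex_space U \<and> complex_space V \<and> f \<in> hol_maps U V \<longrightarrow>
        restr F U V f \<in> sections F V \<rightarrow> sections F U) \<and>
     (\<forall>U s. complex_space U \<and> s \<in> sections F U \<longrightarrow> restr F U U (incl (points U)) s = s) \<and>
     (\<forall>U V W f g s. complex_space U \<and> complex_space V \<and> complex_space W \<and>
        f \<in> hol_maps U V \<and> g \<in> hol_maps V W \<and> s \<in> sections F W \<longrightarrow>
        restr F U W (compose (points U) g f) s = restr F U V f (restr F V W g s))"

definition is_sheaf :: "('p, 'v) presheaf \<Rightarrow> bool" where
  "is_sheaf F \<longleftrightarrow> is_presheaf F \<and>
     (\<forall>U \<V> s. complex_space U \<and> (\<forall>V\<in>\<V>. openin (ctop U) V) \<and> \<Union>\<V> = points U \<and>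
        (\<forall>V\<in>\<V>. s V \<in> sections F (U \<restriction>\<^sub>o V)) \<and>
        (\<forall>V\<in>\<V>. \<forall>V'\<in>\<V>. restr_open F U (V \<inter> V') V (s V) = restr_open F U (V \<inter> V') V' (s V')) \<longrightarrow>
        (\<exists>!t. t \<in> sections F U \<and> (\<forall>V\<in>\<V>. restr_open F U V (points U) t = s V)))"

definition natural :: "('p, 'v) presheaf \<Rightarrow> ('p, 'v) presheaf \<Rightarrow> ('p cspace \<Rightarrow> 'v \<Rightarrow> 'v) \<Rightarrow> bool" where
  "natural F G \<phi> \<longleftrightarrow>
     (\<forall>U. complex_space U \<longrightarrow> \<phi> U \<in> sections F U \<rightarrow> sections G U) \<and>
     (\<forall>U V f s. complex_space U \<and> complex_space V \<and> f \<in> hol_maps U V \<and> s \<in> sections F V \<longrightarrow>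
        \<phi> U (restr F U V f s) = restr G U V f (\<phi> V s))"

definition delta :: "nat \<Rightarrow> nat \<Rightarrow> (nat \<Rightarrow> nat) set" where
  "delta m n = {\<alpha> \<in> {..m} \<rightarrow>\<^sub>E {..n}. mono_on {..m} \<alpha>}"

text \<open>
  \<open>oper X m n \<alpha>\<close> is the simplicial operator from level \<open>n\<close> to level \<open>m\<close> induced by \<open>\<alpha> \<in> delta m n\<close>.
\<close>

record ('p, 'v) simplicial =
  level :: "nat \<Rightarrow> ('p, 'v) presheaf"
  oper :: "nat \<Rightarrow> nat \<Rightarrow> (nat \<Rightarrow> nat) \<Rightarrow> 'p cspace \<Rightarrow> 'v \<Rightarrow> 'v"

definition is_ssheaf :: "('p, 'v) simplicial \<Rightarrow> bool" where
  "is_ssheaf X \<longleftrightarrow>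
     (\<forall>n. is_sheaf (level X n)) \<and>
     (\<forall>m n. \<forall>\<alpha>\<in>delta m n. natural (level X n) (level X m) (oper X m n \<alpha>)) \<and>
     (\<forall>n U s. complex_space U \<and> s \<in> sections (level X n) U \<longrightarrow> oper X n n (\<lambda>i\<in>{..n}. i) U s = s) \<and>
     (\<forall>l m n U s. \<forall>\<alpha>\<in>delta l m. \<forall>\<beta>\<in>delta m n. complex_space U \<and> s \<in> sections (level X n) U \<longrightarrow>
        oper X l n (compose {..l} \<beta> \<alpha>) U s = oper X l m \<alpha> U (oper X m n \<beta> U s))"

definition const_ss :: "('p, 'v) presheaf \<Rightarrow> ('p, 'v) simplicial" where
  "const_ss F = \<lparr>level = (\<lambda>n. F), oper = (\<lambda>m n \<alpha> U s. s)\<rparr>"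

text \<open>
  Morphisms are normalised off their domain, so that equality of morphisms is equality of functions.
\<close>

definition norm_mor :: "('p, 'v) simplicial \<Rightarrow> (nat \<Rightarrow> 'p cspace \<Rightarrow> 'v \<Rightarrow> 'v) \<Rightarrow> nat \<Rightarrow> 'p cspace \<Rightarrow> 'v \<Rightarrow> 'v" where
  "norm_mor X \<phi> = (\<lambda>n U. if complex_space U then restrict (\<phi> n U) (sections (level X n) U) else (\<lambda>_. undefined))"

type_synonym ('p, 'v) mor = "nat \<Rightarrow> 'p cspace \<Rightarrow> 'v \<Rightarrow> 'v"

definition ss_hom :: "('p, 'v) simplicial \<Rightarrow> ('p, 'v) simplicial \<Rightarrow> ('p, 'v) mor set" where
  "ss_hom X Y = {\<phi>. norm_mor X \<phi> = \<phi> \<and>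
     (\<forall>n. natural (level X n) (level Y n) (\<phi> n)) \<and>
     (\<forall>m n U s. \<forall>\<alpha>\<in>delta m n. complex_space U \<and> s \<in> sections (level X n) U \<longrightarrow>
        \<phi> m U (oper X m n \<alpha> U s) = oper Y m n \<alpha> U (\<phi> n U s))}"

definition ss_id :: "('p, 'v) simplicial \<Rightarrow> ('p, 'v) mor" where
  "ss_id X = norm_mor X (\<lambda>n U s. s)"

definition ss_comp :: "('p, 'v) simplicial \<Rightarrow> ('p, 'v) mor \<Rightarrow> ('p, 'v) mor \<Rightarrow> ('p, 'v) mor" where
  "ss_comp X g f = norm_mor X (\<lambda>n U s. g n U (f n U s))"


section \<open>Categories and localization\<close>

text \<open>\<open>Cmp C X g f\<close> is the composite of \<open>g\<close> after \<open>f\<close>, where \<open>f\<close> has source \<open>X\<close>.\<close>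

record ('o, 'm) category =
  Ob :: "'o set"
  Hom :: "'o \<Rightarrow> 'o \<Rightarrow> 'm set"
  Idt :: "'o \<Rightarrow> 'm"
  Cmp :: "'o \<Rightarrow> 'm \<Rightarrow> 'm \<Rightarrow> 'm"

definition monomorphism :: "('o, 'm) category \<Rightarrow> 'o \<Rightarrow> 'o \<Rightarrow> 'm \<Rightarrow> bool" where
  "monomorphism C X Y f \<longleftrightarrow> f \<in> Hom C X Y \<and>
     (\<forall>Z\<in>Ob C. \<forall>g\<in>Hom C Z X. \<forall>h\<in>Hom C Z X. Cmp C Z f g = Cmp C Z f h \<longrightarrow> g = h)"

text \<open>
  The localization of \<open>C\<close> at the class of arrows \<open>W\<close> (given as a family of subsets of the Hom-sets):
  arrows are zigzags, in which the arrows of \<open>W\<close> may be traversed backwards, modulo the congruence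
  generated by the composition of \<open>C\<close> and by the cancellation of \<open>w\<close> against its formal inverse.
  \<open>Fwd X Y f\<close> is a step from \<open>X\<close> to \<open>Y\<close> along \<open>f : X \<rightarrow> Y\<close>, whereas \<open>Bwd X Y w\<close> is a step
  from \<open>X\<close> to \<open>Y\<close> along \<open>w : Y \<rightarrow> X\<close>. Zigzags are read from left to right.
\<close>

datatype ('o, 'm) leg = Fwd 'o 'o 'm | Bwd 'o 'o 'm

inductive zigzag :: "('o, 'm) category \<Rightarrow> ('o \<Rightarrow> 'o \<Rightarrow> 'm set) \<Rightarrow> 'o \<Rightarrow> ('o, 'm) leg list \<Rightarrow> 'o \<Rightarrow> bool"
  for C W where
  zz_nil: "X \<in> Ob C \<Longrightarrow> zigzag C W X [] X"
| zz_fwd: "X \<in> Ob C \<Longrightarrow> f \<in> Hom C X Y \<Longrightarrow> zigzag C W Y p Z \<Longrightarrow> zigzag C W X (Fwd X Y f # p) Z"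
| zz_bwd: "X \<in> Ob C \<Longrightarrow> w \<in> W Y X \<Longrightarrow> zigzag C W Y p Z \<Longrightarrow> zigzag C W X (Bwd X Y w # p) Z"

inductive elem_move :: "('o, 'm) category \<Rightarrow> ('o \<Rightarrow> 'o \<Rightarrow> 'm set) \<Rightarrow> 'o \<Rightarrow> 'o \<Rightarrow>
    ('o, 'm) leg list \<Rightarrow> ('o, 'm) leg list \<Rightarrow> bool"
  for C W where
  move_id: "X \<in> Ob C \<Longrightarrow> elem_move C W X X [Fwd X X (Idt C X)] []"
| move_comp: "X \<in> Ob C \<Longrightarrow> Y \<in> Ob C \<Longrightarrow> Z \<in> Ob C \<Longrightarrow> f \<in> Hom C X Y \<Longrightarrow> g \<in> Hom C Y Z \<Longrightarrow>
    elem_move C W X Z [Fwd X Y f, Fwd Y Z g] [Fwd X Z (Cmp C X g f)]"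
| move_fb: "X \<in> Ob C \<Longrightarrow> Y \<in> Ob C \<Longrightarrow> w \<in> W X Y \<Longrightarrow> elem_move C W X X [Fwd X Y w, Bwd Y X w] []"
| move_bf: "X \<in> Ob C \<Longrightarrow> Y \<in> Ob C \<Longrightarrow> w \<in> W X Y \<Longrightarrow> elem_move C W Y Y [Bwd Y X w, Fwd X Y w] []"

inductive zz_equiv :: "('o, 'm) category \<Rightarrow> ('o \<Rightarrow> 'o \<Rightarrow> 'm set) \<Rightarrow> 'o \<Rightarrow> 'o \<Rightarrow>
    ('o, 'm) leg list \<Rightarrow> ('o, 'm) leg list \<Rightarrow> bool"
  for C W X Y where
  zze_move: "zigzag C W X p A \<Longrightarrow> elem_move C W A B u v \<Longrightarrow> zigzag C W B q Y \<Longrightarrow>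
    zz_equiv C W X Y (p @ u @ q) (p @ v @ q)"
| zze_refl: "zigzag C W X p Y \<Longrightarrow> zz_equiv C W X Y p p"
| zze_sym: "zz_equiv C W X Y p q \<Longrightarrow> zz_equiv C W X Y q p"
| zze_trans: "zz_equiv C W X Y p q \<Longrightarrow> zz_equiv C W X Y q r \<Longrightarrow> zz_equiv C W X Y p r"

definition loc_hom :: "('o, 'm) category \<Rightarrow> ('o \<Rightarrow> 'o \<Rightarrow> 'm set) \<Rightarrow> 'o \<Rightarrow> 'o \<Rightarrow> ('o, 'm) leg list set set" where
  "loc_hom C W X Y = {p. zigzag C W X p Y} // {(p, q). zz_equiv C W X Y p q}"

definition loc_class :: "('o, 'm) category \<Rightarrow> ('o \<Rightarrow> 'o \<Rightarrow> 'm set) \<Rightarrow> 'o \<Rightarrow> 'o \<Rightarrow> 'm \<Rightarrow> ('o, 'm) leg list set" where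
  "loc_class C W X Y f = {q. zz_equiv C W X Y [Fwd X Y f] q}"

definition loc_precomp :: "('o, 'm) category \<Rightarrow> ('o \<Rightarrow> 'o \<Rightarrow> 'm set) \<Rightarrow> 'o \<Rightarrow> 'o \<Rightarrow> 'o \<Rightarrow> 'm \<Rightarrow>
    ('o, 'm) leg list set \<Rightarrow> ('o, 'm) leg list set" where
  "loc_precomp C W X Y Z f c = {q. \<exists>p\<in>c. zz_equiv C W X Z (Fwd X Y f # p) q}"

definition loc_iso :: "('o, 'm) category \<Rightarrow> ('o \<Rightarrow> 'o \<Rightarrow> 'm set) \<Rightarrow> 'o \<Rightarrow> 'o \<Rightarrow> bool" where
  "loc_iso C W X Y \<longleftrightarrow> (\<exists>p q. zigzag C W X p Y \<and> zigzag C W Y q X \<and>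
     zz_equiv C W X X (p @ q) [] \<and> zz_equiv C W Y Y (q @ p) [])"


section \<open>Weak equivalences of simplicial sets\<close>

record 'a sset =
  simplices :: "nat \<Rightarrow> 'a set"
  soper :: "nat \<Rightarrow> nat \<Rightarrow> (nat \<Rightarrow> nat) \<Rightarrow> 'a \<Rightarrow> 'a"

definition simplex_push :: "nat \<Rightarrow> (nat \<Rightarrow> nat) \<Rightarrow> (nat \<Rightarrow> real) \<Rightarrow> nat \<Rightarrow> real" where
  "simplex_push m \<alpha> t = (\<lambda>j. \<Sum>i | i \<le> m \<and> \<alpha> i = j. t i)"

definition realization_cells :: "'a sset \<Rightarrow> (nat \<times> 'a \<times> (nat \<Rightarrow> real)) set" where
  "realization_cells K = {(n, x, t). x \<in> simplices K n \<and> t \<in> standard_simplex n}"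

definition realization_glue :: "'a sset \<Rightarrow> ((nat \<times> 'a \<times> (nat \<Rightarrow> real)) \<times> (nat \<times> 'a \<times> (nat \<Rightarrow> real))) set" where
  "realization_glue K = {((m, soper K m n \<alpha> x, t), (n, x, simplex_push m \<alpha> t)) | m n \<alpha> x t.
     \<alpha> \<in> delta m n \<and> x \<in> simplices K n \<and> t \<in> standard_simplex m}"

definition realization_pt :: "'a sset \<Rightarrow> nat \<times> 'a \<times> (nat \<Rightarrow> real) \<Rightarrow> (nat \<times> 'a \<times> (nat \<Rightarrow> real)) set" where
  "realization_pt K c = ((realization_glue K \<union> (realization_glue K)\<inverse>)\<^sup>*) `` {c}"

definition realization :: "'a sset \<Rightarrow> (nat \<times> 'a \<times> (nat \<Rightarrow> real)) set topology" where
  "realization K = topology (\<lambda>S. S \<subseteq> realization_pt K ` realization_cells K \<and>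
     (\<forall>n. \<forall>x\<in>simplices K n.
        openin (subtopology (powertop_real UNIV) (standard_simplex n))
               {t \<in> standard_simplex n. realization_pt K (n, x, t) \<in> S}))"

definition realization_map :: "'b sset \<Rightarrow> (nat \<Rightarrow> 'a \<Rightarrow> 'b) \<Rightarrow>
    (nat \<times> 'a \<times> (nat \<Rightarrow> real)) set \<Rightarrow> (nat \<times> 'b \<times> (nat \<Rightarrow> real)) set" where
  "realization_map L \<phi> c = (\<Union>(n, x, t)\<in>c. realization_pt L (n, \<phi> n x, t))"

definition sphere_base :: "nat \<Rightarrow> real" where
  "sphere_base = (\<lambda>i. if i = 0 then 1 else 0)"

definition pointed_maps :: "nat \<Rightarrow> 'a topology \<Rightarrow> 'a \<Rightarrow> ((nat \<Rightarrow> real) \<Rightarrow> 'a) set" where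
  "pointed_maps n X a = {g. continuous_map (nsphere n) X g \<and> g sphere_base = a}"

definition pointed_homotopic :: "nat \<Rightarrow> 'a topology \<Rightarrow> 'a \<Rightarrow>
    ((nat \<Rightarrow> real) \<Rightarrow> 'a) \<Rightarrow> ((nat \<Rightarrow> real) \<Rightarrow> 'a) \<Rightarrow> bool" where
  "pointed_homotopic n X a = homotopic_with (\<lambda>h. h sphere_base = a) (nsphere n) X"

text \<open>Bijectivity on path components and on all homotopy groups at all base points.\<close>

definition weak_homotopy_equivalence :: "'a topology \<Rightarrow> 'b topology \<Rightarrow> ('a \<Rightarrow> 'b) \<Rightarrow> bool" where
  "weak_homotopy_equivalence X Y f \<longleftrightarrow> continuous_map X Y f \<and>
     (\<forall>a\<in>topspace X. \<forall>b\<in>topspace X.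
        path_component_of Y (f a) (f b) \<longrightarrow> path_component_of X a b) \<and>
     (\<forall>y\<in>topspace Y. \<exists>a\<in>topspace X. path_component_of Y (f a) y) \<and>
     (\<forall>n\<ge>1. \<forall>a\<in>topspace X.
        (\<forall>g\<in>pointed_maps n X a. \<forall>h\<in>pointed_maps n X a.
           pointed_homotopic n Y (f a) (f \<circ> g) (f \<circ> h) \<longrightarrow> pointed_homotopic n X a g h) \<and>
        (\<forall>k\<in>pointed_maps n Y (f a). \<exists>g\<in>pointed_maps n X a. pointed_homotopic n Y (f a) (f \<circ> g) k))"

definition sset_weak_equiv :: "'a sset \<Rightarrow> 'b sset \<Rightarrow> (nat \<Rightarrow> 'a \<Rightarrow> 'b) \<Rightarrow> bool" where
  "sset_weak_equiv K L \<phi> \<longleftrightarrow> weak_homotopy_equivalence (realization K) (realization L) (realization_map L \<phi>)"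


section \<open>Stalks\<close>

text \<open>
  The stalk at a point \<open>u\<close> of a complex space \<open>U\<close>: a germ is an equivalence class of pairs consisting
  of an open neighbourhood of \<open>u\<close> in \<open>U\<close> and a section over it.
\<close>

definition nbhds :: "'p cspace \<Rightarrow> 'p \<Rightarrow> 'p set set" where
  "nbhds U u = {V. openin (ctop U) V \<and> u \<in> V}"

definition germ :: "('p, 'v) presheaf \<Rightarrow> 'p cspace \<Rightarrow> 'p \<Rightarrow> 'p set \<Rightarrow> 'v \<Rightarrow> ('p set \<times> 'v) set" where
  "germ F U u V s = {(V', s'). V' \<in> nbhds U u \<and> s' \<in> sections F (U \<restriction>\<^sub>o V') \<and>
     (\<exists>W\<in>nbhds U u. W \<subseteq> V \<inter> V' \<and> restr_open F U W V s = restr_open F U W V' s')}"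

definition stalk :: "('p, 'v) presheaf \<Rightarrow> 'p cspace \<Rightarrow> 'p \<Rightarrow> ('p set \<times> 'v) set set" where
  "stalk F U u = {germ F U u V s | V s. V \<in> nbhds U u \<and> s \<in> sections F (U \<restriction>\<^sub>o V)}"

text \<open>The map into the stalk of \<open>G\<close> induced by a map \<open>\<phi>\<close> of presheaves with values in \<open>G\<close>.\<close>

definition stalk_map :: "('p, 'v) presheaf \<Rightarrow> 'p cspace \<Rightarrow> 'p \<Rightarrow> ('p cspace \<Rightarrow> 'v \<Rightarrow> 'v) \<Rightarrow>
    ('p set \<times> 'v) set \<Rightarrow> ('p set \<times> 'v) set" where
  "stalk_map G U u \<phi> c = (\<Union>(V, s)\<in>c. germ G U u V (\<phi> (U \<restriction>\<^sub>o V) s))"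

definition stalk_sset :: "('p, 'v) simplicial \<Rightarrow> 'p cspace \<Rightarrow> 'p \<Rightarrow> ('p set \<times> 'v) set sset" where
  "stalk_sset X U u = \<lparr>simplices = (\<lambda>n. stalk (level X n) U u),
     soper = (\<lambda>m n \<alpha>. stalk_map (level X m) U u (oper X m n \<alpha>))\<rparr>"

definition swe :: "('p, 'v) simplicial \<Rightarrow> ('p, 'v) simplicial \<Rightarrow> ('p, 'v) mor set" where
  "swe X Y = {\<phi> \<in> ss_hom X Y. \<forall>U u. complex_space U \<and> u \<in> points U \<longrightarrow>
     sset_weak_equiv (stalk_sset X U u) (stalk_sset Y U u) (\<lambda>n. stalk_map (level Y n) U u (\<phi> n))}"


section \<open>The universe of sections and constructions on simplicial sheaves\<close>

text \<open>
  All sections are taken from one type, built over an arbitrary type \<open>'b\<close> of atoms and closed under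
  the constructions that are needed: \<open>SHol\<close> serves for representable sheaves, \<open>SPair\<close> for products,
  \<open>SLeft\<close> and \<open>SRight\<close> for disjoint unions, and \<open>SGerms\<close> for families of germs indexed by points,
  which occur as sections of a sheafification.
\<close>

datatype ('p, 'b) sect =
    SAtom 'b
  | SPt
  | SHol "'p \<Rightarrow> 'p"
  | SPair (sfst: "('p, 'b) sect") (ssnd: "('p, 'b) sect")
  | SLeft "('p, 'b) sect"
  | SRight "('p, 'b) sect"
  | SGerms "'p \<Rightarrow> 'p set \<times> ('p, 'b) sect"

type_synonym ('q, 'b) ssh = "('q pts, ('q pts, 'b) sect) simplicial"
type_synonym ('q, 'b) ssh_mor = "('q pts, ('q pts, 'b) sect) mor"

definition rep :: "'p cspace \<Rightarrow> ('p, ('p, 'b) sect) presheaf" where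
  "rep X = \<lparr>sections = (\<lambda>U. SHol ` hol_maps U X),
     restr = (\<lambda>U V f s. case s of SHol g \<Rightarrow> SHol (compose (points U) g f) | _ \<Rightarrow> undefined)\<rparr>"

definition spt :: "('p, ('p, 'b) sect) simplicial" where
  "spt = const_ss \<lparr>sections = (\<lambda>U. {SPt}), restr = (\<lambda>U V f s. s)\<rparr>"

definition sprod :: "('p, ('p, 'b) sect) simplicial \<Rightarrow> ('p, ('p, 'b) sect) simplicial \<Rightarrow>
    ('p, ('p, 'b) sect) simplicial" where
  "sprod X Y = \<lparr>
     level = (\<lambda>n. \<lparr>
       sections = (\<lambda>U. {SPair a b | a b. a \<in> sections (level X n) U \<and> b \<in> sections (level Y n) U}),
       restr = (\<lambda>U V f s. SPair (restr (level X n) U V f (sfst s)) (restr (level Y n) U V f (ssnd s)))\<rparr>),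
     oper = (\<lambda>m n \<alpha> U s. SPair (oper X m n \<alpha> U (sfst s)) (oper Y m n \<alpha> U (ssnd s)))\<rparr>"

definition sproj :: "('p, ('p, 'b) sect) simplicial \<Rightarrow> ('p, ('p, 'b) sect) simplicial \<Rightarrow>
    ('p, ('p, 'b) sect) mor" where
  "sproj X Y = norm_mor (sprod X Y) (\<lambda>n U s. sfst s)"

text \<open>
  Sheafification. A germ, as an equivalence class, does not fit into the type of sections; it is
  recorded by the representative that \<open>germ_code\<close> picks from the class. A section of the
  sheafification over \<open>U\<close> is a family of germs at the points of \<open>U\<close> which locally comes from sections.
\<close>

definition germ_code :: "('p, 'v) presheaf \<Rightarrow> 'p cspace \<Rightarrow> 'p \<Rightarrow> 'p set \<Rightarrow> 'v \<Rightarrow> 'p set \<times> 'v" where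
  "germ_code F U u V s = (SOME r. r \<in> germ F U u V s)"

definition sheafify :: "('p, ('p, 'b) sect) presheaf \<Rightarrow> ('p, ('p, 'b) sect) presheaf" where
  "sheafify F = \<lparr>
     sections = (\<lambda>U. {SGerms \<sigma> | \<sigma>. \<sigma> \<in> extensional (points U) \<and>
       (\<forall>u\<in>points U. \<exists>V\<in>nbhds U u. \<exists>s\<in>sections F (U \<restriction>\<^sub>o V). \<forall>v\<in>V. \<sigma> v = germ_code F U v V s)}),
     restr = (\<lambda>U V f t. case t of SGerms \<sigma> \<Rightarrow>
         SGerms (\<lambda>u\<in>points U. case \<sigma> (f u) of (W, s) \<Rightarrow>
           (let W' = {x\<in>points U. f x \<in> W}
            in germ_code F U u W' (restr F (U \<restriction>\<^sub>o W') (V \<restriction>\<^sub>o W) (restrict f W') s)))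
       | _ \<Rightarrow> undefined)\<rparr>"

definition sheafify_map :: "('p, ('p, 'b) sect) presheaf \<Rightarrow> ('p cspace \<Rightarrow> ('p, 'b) sect \<Rightarrow> ('p, 'b) sect) \<Rightarrow>
    'p cspace \<Rightarrow> ('p, 'b) sect \<Rightarrow> ('p, 'b) sect" where
  "sheafify_map G \<phi> U t = (case t of SGerms \<sigma> \<Rightarrow>
         SGerms (\<lambda>u\<in>points U. case \<sigma> u of (W, s) \<Rightarrow> germ_code G U u W (\<phi> (U \<restriction>\<^sub>o W) s))
       | _ \<Rightarrow> undefined)"

definition sheafify_unit :: "('p, ('p, 'b) sect) presheaf \<Rightarrow> 'p cspace \<Rightarrow> ('p, 'b) sect \<Rightarrow> ('p, 'b) sect" where
  "sheafify_unit F U s = SGerms (\<lambda>u\<in>points U. germ_code F U u (points U) s)"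

definition ssheafify :: "('p, ('p, 'b) sect) simplicial \<Rightarrow> ('p, ('p, 'b) sect) simplicial" where
  "ssheafify X = \<lparr>level = (\<lambda>n. sheafify (level X n)),
     oper = (\<lambda>m n \<alpha>. sheafify_map (level X m) (oper X m n \<alpha>))\<rparr>"

text \<open>
  The quotient of \<open>X\<close> by a sub-object. A colimit of sheaves is the sheafification of the sectionwise
  colimit, and the latter does not change if the diagram is replaced by one of presheaves with the same
  sheafification; therefore it suffices to specify a simplicial subpresheaf \<open>A\<close> of \<open>X\<close> which generates
  the sub-object. Sectionwise, the colimit of \<open>pt \<leftarrow> A \<rightarrow> X\<close> consists of one point \<open>SLeft SPt\<close>,
  which is the image of \<open>A\<close>, and of the sections of \<open>X\<close> outside \<open>A\<close>. In particular the quotient by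
  the empty sub-object is the disjoint union of \<open>X\<close> and a base point.
\<close>

definition collapse_sec :: "('p, 'b) sect set \<Rightarrow> ('p, 'b) sect \<Rightarrow> ('p, 'b) sect" where
  "collapse_sec A s = (if s \<in> A then SLeft SPt else SRight s)"

definition collapse_map :: "('p, 'b) sect set \<Rightarrow> (('p, 'b) sect \<Rightarrow> ('p, 'b) sect) \<Rightarrow>
    ('p, 'b) sect \<Rightarrow> ('p, 'b) sect" where
  "collapse_map A \<phi> t = (case t of SRight s \<Rightarrow> collapse_sec A (\<phi> s) | _ \<Rightarrow> SLeft SPt)"

definition collapse :: "('p, ('p, 'b) sect) simplicial \<Rightarrow> (nat \<Rightarrow> 'p cspace \<Rightarrow> ('p, 'b) sect set) \<Rightarrow>
    ('p, ('p, 'b) sect) simplicial" where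
  "collapse X A = \<lparr>
     level = (\<lambda>n. \<lparr>
       sections = (\<lambda>U. insert (SLeft SPt) (SRight ` (sections (level X n) U - A n U))),
       restr = (\<lambda>U V f. collapse_map (A n U) (restr (level X n) U V f))\<rparr>),
     oper = (\<lambda>m n \<alpha> U. collapse_map (A m U) (oper X m n \<alpha> U))\<rparr>"

text \<open>
  A pointed simplicial sheaf is a pair \<open>(X, x)\<close> of a simplicial sheaf and a morphism \<open>x\<close> from the
  final sheaf to \<open>X\<close>.
\<close>

type_synonym ('q, 'b) pssh = "('q, 'b) ssh \<times> ('q, 'b) ssh_mor"

definition pquot :: "('q, 'b) ssh \<Rightarrow> (nat \<Rightarrow> 'q pts cspace \<Rightarrow> ('q pts, 'b) sect set) \<Rightarrow> ('q, 'b) pssh" where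
  "pquot X A = (ssheafify (collapse X A),
     norm_mor spt (\<lambda>n U _. sheafify_unit (level (collapse X A) n) U (SLeft SPt)))"

text \<open>
  The wedge of \<open>X\<close> and \<open>Y\<close> is embedded in the product; sectionwise it consists of the pairs in which
  one of the components is the base point.
\<close>

definition smash :: "('q, 'b) pssh \<Rightarrow> ('q, 'b) pssh \<Rightarrow> ('q, 'b) pssh" where
  "smash P Q = (case (P, Q) of ((X, x), (Y, y)) \<Rightarrow>
     pquot (sprod X Y)
       (\<lambda>n U. {SPair a b | a b. a \<in> sections (level X n) U \<and> b \<in> sections (level Y n) U \<and>
                                (a = x n U SPt \<or> b = y n U SPt)}))"

text \<open>The disjoint union of two points, pointed by the added one.\<close>

definition S0 :: "('q, 'b) pssh" where
  "S0 = pquot spt (\<lambda>n U. {})"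

fun smash_power :: "('q, 'b) pssh \<Rightarrow> nat \<Rightarrow> ('q, 'b) pssh" where
  "smash_power P 0 = S0"
| "smash_power P (Suc n) = smash (smash_power P n) P"

definition srep :: "'q pts cspace \<Rightarrow> ('q, 'b) ssh" where
  "srep X = const_ss (rep X)"

definition const_sec :: "'q pts cspace \<Rightarrow> 'q pts \<Rightarrow> ('q pts, 'b) sect" where
  "const_sec U p = SHol (\<lambda>u\<in>points U. p)"

definition srep_pt :: "'q pts cspace \<Rightarrow> 'q pts \<Rightarrow> ('q, 'b) pssh" where
  "srep_pt X p = (srep X, norm_mor spt (\<lambda>n U _. const_sec U p))"

text \<open>The quotient of \<open>X\<close> by the disjoint union of the points \<open>p\<close> and \<open>q\<close>.\<close>

definition two_point_quot :: "'q pts cspace \<Rightarrow> 'q pts \<Rightarrow> 'q pts \<Rightarrow> ('q, 'b) pssh" where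
  "two_point_quot X p q = pquot (srep X) (\<lambda>n U. {const_sec U p, const_sec U q})"

definition S1_par :: "('q, 'b) pssh" where
  "S1_par = two_point_quot cline (Inl 0) (Inl 1)"

definition S1_iper :: "complex \<Rightarrow> complex \<Rightarrow> ('q, 'b) pssh" where
  "S1_iper z1 z2 = two_point_quot disc (Inl z1) (Inl z2)"

definition Gm :: "('q, 'b) pssh" where
  "Gm = srep_pt punctured_line (Inl 1)"


section \<open>Homotopy categories and hyperbolicity\<close>

definition SSh :: "(('q, 'b) ssh, ('q, 'b) ssh_mor) category" where
  "SSh = \<lparr>Ob = {X. is_ssheaf X}, Hom = ss_hom, Idt = ss_id, Cmp = ss_comp\<rparr>"

definition hyperbolic :: "('q, 'b) ssh \<Rightarrow> bool" where
  "hyperbolic X \<longleftrightarrow> is_ssheaf X \<and>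
     (\<forall>Y. is_ssheaf Y \<longrightarrow>
        bij_betw (loc_precomp SSh swe (sprod Y (srep cline)) Y X (sproj Y (srep cline)))
          (loc_hom SSh swe Y X) (loc_hom SSh swe (sprod Y (srep cline)) X))"

definition C_weq :: "('q, 'b) ssh \<Rightarrow> ('q, 'b) ssh \<Rightarrow> ('q, 'b) ssh_mor set" where
  "C_weq X Y = {f \<in> ss_hom X Y. \<forall>Z. hyperbolic Z \<longrightarrow>
     bij_betw (loc_precomp SSh swe X Y Z f) (loc_hom SSh swe Y Z) (loc_hom SSh swe X Z)}"

definition C_weakly_equivalent :: "('q, 'b) ssh \<Rightarrow> ('q, 'b) ssh \<Rightarrow> bool" where
  "C_weakly_equivalent = loc_iso SSh C_weq"

definition PSSh :: "(('q, 'b) pssh, ('q, 'b) ssh_mor) category" where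
  "PSSh = \<lparr>Ob = {(X, x). is_ssheaf X \<and> x \<in> ss_hom spt X},
     Hom = (\<lambda>(X, x) (Y, y). {f \<in> ss_hom X Y. ss_comp spt f x = y}),
     Idt = (\<lambda>(X, x). ss_id X), Cmp = (\<lambda>(X, x). ss_comp X)\<rparr>"

definition pointed_C_weq :: "('q, 'b) pssh \<Rightarrow> ('q, 'b) pssh \<Rightarrow> ('q, 'b) ssh_mor set" where
  "pointed_C_weq P Q = Hom PSSh P Q \<inter> C_weq (fst P) (fst Q)"

definition H_hom :: "('q, 'b) pssh \<Rightarrow> ('q, 'b) pssh \<Rightarrow>
    (('q, 'b) pssh, ('q, 'b) ssh_mor) leg list set set" where
  "H_hom P Q = loc_hom PSSh pointed_C_weq P Q"

text \<open>The class of the constant map to the base point.\<close>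

definition H_null :: "('q, 'b) pssh \<Rightarrow> ('q, 'b) pssh \<Rightarrow>
    (('q, 'b) pssh, ('q, 'b) ssh_mor) leg list set" where
  "H_null P Q = loc_class PSSh pointed_C_weq P Q (norm_mor (fst P) (\<lambda>n U _. snd Q n U SPt))"

definition par_sphere :: "nat \<Rightarrow> nat \<Rightarrow> ('q, 'b) pssh" where
  "par_sphere i j = smash (smash_power Gm j) (smash_power S1_par (i - j))"

definition iper_sphere :: "complex \<Rightarrow> complex \<Rightarrow> nat \<Rightarrow> nat \<Rightarrow> ('q, 'b) pssh" where
  "iper_sphere z1 z2 n m = smash (smash_power (S1_iper z1 z2) n) (smash_power S1_par m)"

text \<open>The pointed sets are meant for \<open>i \<ge> j\<close>; their base points are given by \<open>H_null\<close>.\<close>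

definition pi_par :: "nat \<Rightarrow> nat \<Rightarrow> ('q, 'b) pssh \<Rightarrow>
    (('q, 'b) pssh, ('q, 'b) ssh_mor) leg list set set" where
  "pi_par i j P = H_hom (par_sphere i j) P"

definition pi_iper :: "complex \<Rightarrow> complex \<Rightarrow> nat \<Rightarrow> nat \<Rightarrow> ('q, 'b) pssh \<Rightarrow>
    (('q, 'b) pssh, ('q, 'b) ssh_mor) leg list set set" where
  "pi_iper z1 z2 n m P = H_hom (iper_sphere z1 z2 n m) P"

definition pi_par_nonzero :: "nat \<Rightarrow> nat \<Rightarrow> ('q, 'b) pssh \<Rightarrow> bool" where
  "pi_par_nonzero i j P \<longleftrightarrow> (\<exists>c\<in>pi_par i j P. c \<noteq> H_null (par_sphere i j) P)"

definition pi_iper_nonzero :: "complex \<Rightarrow> complex \<Rightarrow> nat \<Rightarrow> nat \<Rightarrow> ('q, 'b) pssh \<Rightarrow> bool" where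
  "pi_iper_nonzero z1 z2 n m P \<longleftrightarrow> (\<exists>c\<in>pi_iper z1 z2 n m P. c \<noteq> H_null (iper_sphere z1 z2 n m) P)"


section \<open>Hyperbolic resolutions\<close>

definition fibration :: "('q, 'b) ssh \<Rightarrow> ('q, 'b) ssh \<Rightarrow> ('q, 'b) ssh_mor \<Rightarrow> bool" where
  "fibration X Y p \<longleftrightarrow> p \<in> ss_hom X Y \<and>
     (\<forall>A B. is_ssheaf A \<and> is_ssheaf B \<longrightarrow>
        (\<forall>j f g. j \<in> swe A B \<and> monomorphism SSh A B j \<and> f \<in> ss_hom A X \<and> g \<in> ss_hom B Y \<and>
           ss_comp A p f = ss_comp A g j \<longrightarrow>
           (\<exists>h\<in>ss_hom B X. ss_comp A h j = f \<and> ss_comp B p h = g)))"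

definition fibrant :: "('q, 'b) ssh \<Rightarrow> bool" where
  "fibrant X \<longleftrightarrow> is_ssheaf X \<and> fibration X spt (norm_mor X (\<lambda>n U s. SPt))"

definition hyperbolic_resolution :: "(('q, 'b) ssh \<Rightarrow> ('q, 'b) ssh) \<Rightarrow>
    (('q, 'b) ssh \<Rightarrow> ('q, 'b) ssh \<Rightarrow> ('q, 'b) ssh_mor \<Rightarrow> ('q, 'b) ssh_mor) \<Rightarrow>
    (('q, 'b) ssh \<Rightarrow> ('q, 'b) ssh_mor) \<Rightarrow> bool" where
  "hyperbolic_resolution Ip Ipm r \<longleftrightarrow>
     (\<forall>X. is_ssheaf X \<longrightarrow> hyperbolic (Ip X) \<and> fibrant (Ip X) \<and>
        monomorphism SSh X (Ip X) (r X) \<and> r X \<in> C_weq X (Ip X) \<and>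
        Ipm X X (ss_id X) = ss_id (Ip X)) \<and>
     (\<forall>X Y f. is_ssheaf X \<and> is_ssheaf Y \<and> f \<in> ss_hom X Y \<longrightarrow>
        Ipm X Y f \<in> ss_hom (Ip X) (Ip Y) \<and> ss_comp X (Ipm X Y f) (r X) = ss_comp X (r Y) f) \<and>
     (\<forall>X Y Z f g. is_ssheaf X \<and> is_ssheaf Y \<and> is_ssheaf Z \<and> f \<in> ss_hom X Y \<and> g \<in> ss_hom Y Z \<longrightarrow>
        Ipm X Z (ss_comp X g f) = ss_comp (Ip X) (Ipm Y Z g) (Ipm X Y f))"

end

(*
  A simplicial weak equivalence is bijective on stalkwise path components, so for a sheaf F, seen as a
  constant simplicial sheaf, morphisms Y -> F in the homotopy category are just morphisms of simplicial
  sheaves Y -> F. If F is hyperbolic, these are invariant under C-weak equivalences, and every map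
  E x C -> F is constant along C. A pointed map to F from A /\ (B /\ S^1_par) lifts to A x (B x C),
  where it is constant along C and hence equal to its value at 0, the base point. So all pointed
  homotopy classes of maps from such a suspension to F are trivial. If X is isomorphic to F in the
  homotopy category, then the isomorphism is an actual map X -> F, it is a C-weak equivalence by
  saturation, and the vanishing is carried over to X, at any base point. Finally, a Brody hyperbolic
  complex space represents a hyperbolic sheaf: the pullbacks of sections along constant maps C -> U
  reduce this to maps C -> X.
*)
theory Submission
  imports Defs
begin

section \<open>Path components of the realization\<close>

text \<open>Morphisms of the homotopy categories are zigzags of arbitrary length modulo a
  congruence, so neither equality nor inequality of classes is visible directly. A discrete target
  \<open>F\<close> removes this obstacle: if every weak equivalence already acts bijectively on
  strict maps into \<open>F\<close>, backward legs can be replaced by factorizations, and evaluating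
  zigzags on strict maps separates the classes. What has to be bridged is that weak equivalences are
  defined through topological realizations of stalks, whereas strict maps live on sections. The
  bridge is an induction principle: a property of local sections that is stable under change of
  representative and under simplicial operators is constant on the path components of a stalk. It
  shows that maps to \<open>F\<close> are constant there, that being joined at a point persists
  nearby, and that it is compatible with pullback, as gluing and naturality require. The spheres are
  treated one simplicial level at a time, as pointed presheaves; in place of universal properties of
  colimits, each section of a quotient is locally the base point or the image of a section
  upstairs.\<close>

definition simplicial_map :: "'a sset \<Rightarrow> 'b sset \<Rightarrow> (nat \<Rightarrow> 'a \<Rightarrow> 'b) \<Rightarrow> bool" where
  "simplicial_map K L \<phi> \<longleftrightarrow> (\<forall>n. \<phi> n \<in> simplices K n \<rightarrow> simplices L n) \<and>
     (\<forall>m n. \<forall>\<alpha>\<in>delta m n. \<forall>x\<in>simplices K n. \<phi> m (soper K m n \<alpha> x) = soper L m n \<alpha> (\<phi> n x))"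

text \<open>\<open>sphere_base\<close> is the unit vector e_0 and serves here as vertex 0 of every
  standard simplex. As cells are path connected, this is the relation of lying in the same path
  component, for simplices of all dimensions at once.\<close>

definition joined :: "'a sset \<Rightarrow> nat \<Rightarrow> 'a \<Rightarrow> nat \<Rightarrow> 'a \<Rightarrow> bool" where
  "joined K n x m y \<longleftrightarrow> path_component_of (realization K)
     (realization_pt K (n, x, sphere_base)) (realization_pt K (m, y, sphere_base))"

abbreviation simplex_space :: "nat \<Rightarrow> (nat \<Rightarrow> real) topology" where
  "simplex_space n \<equiv> subtopology (powertop_real UNIV) (standard_simplex n)"

text \<open>Unfolding \<open>realization\<close> requires its predicate to be a topology: preimages
  under the cell maps commute with unions and binary intersections.\<close>

lemma openin_realization:
  "openin (realization K) S \<longleftrightarrow> S \<subseteq> realization_pt K ` realization_cells K \<and>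
     (\<forall>n. \<forall>x\<in>simplices K n. openin (simplex_space n) {t \<in> standard_simplex n. realization_pt K (n, x, t) \<in> S})"
proof -
  let ?P = "\<lambda>S. S \<subseteq> realization_pt K ` realization_cells K \<and>
     (\<forall>n. \<forall>x\<in>simplices K n. openin (simplex_space n) {t \<in> standard_simplex n. realization_pt K (n, x, t) \<in> S})"
  have "istopology ?P"
    unfolding istopology_def
  proof (intro conjI allI impI)
    fix S T assume "?P S" and "?P T"
    moreover have "{t \<in> standard_simplex n. realization_pt K (n, x, t) \<in> S \<inter> T} =
        {t \<in> standard_simplex n. realization_pt K (n, x, t) \<in> S} \<inter>
        {t \<in> standard_simplex n. realization_pt K (n, x, t) \<in> T}" for n x by auto
    ultimately show "S \<inter> T \<subseteq> realization_pt K ` realization_cells K"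
      and "\<And>n. \<forall>x\<in>simplices K n. openin (simplex_space n)
             {t \<in> standard_simplex n. realization_pt K (n, x, t) \<in> S \<inter> T}"
      by (auto intro: openin_Int)
  next
    fix \<S> assume P: "\<forall>S\<in>\<S>. ?P S"
    then show "\<Union>\<S> \<subseteq> realization_pt K ` realization_cells K" by blast
    have eq: "{t \<in> standard_simplex n. realization_pt K (n, x, t) \<in> \<Union>\<S>} =
        (\<Union>S\<in>\<S>. {t \<in> standard_simplex n. realization_pt K (n, x, t) \<in> S})" for n x by auto
    show "\<forall>x\<in>simplices K n. openin (simplex_space n)
             {t \<in> standard_simplex n. realization_pt K (n, x, t) \<in> \<Union>\<S>}" for n
      unfolding eq using P by (intro ballI openin_Union) auto
  qed
  then show ?thesis
    unfolding realization_def by (simp add: topology_inverse')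
qed

lemma topspace_realization: "topspace (realization K) = realization_pt K ` realization_cells K"
proof -
  have "{t \<in> standard_simplex n. realization_pt K (n, x, t) \<in> realization_pt K ` realization_cells K}
     = standard_simplex n" if "x \<in> simplices K n" for n x
    using that by (auto simp: realization_cells_def)
  moreover have "openin (simplex_space n) (standard_simplex n)" for n
    by (metis Int_absorb1 inf_commute openin_topspace subset_UNIV topspace_euclidean topspace_subtopology
        euclidean_product_topology)
  ultimately have "openin (realization K) (realization_pt K ` realization_cells K)"
    unfolding openin_realization by simp
  then have "realization_pt K ` realization_cells K \<subseteq> topspace (realization K)"
    by (rule openin_subset)
  moreover have "topspace (realization K) \<subseteq> realization_pt K ` realization_cells K"
    using openin_topspace[of "realization K", unfolded openin_realization] by (rule conjunct1)
  ultimately show ?thesis by (rule equalityI[rotated])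
qed

lemma continuous_map_cell:
  assumes "x \<in> simplices K n"
  shows "continuous_map (simplex_space n) (realization K) (\<lambda>t. realization_pt K (n, x, t))"
  unfolding continuous_map_def
proof (intro conjI allI impI funcsetI)
  fix t assume "t \<in> topspace (simplex_space n)"
  then show "realization_pt K (n, x, t) \<in> topspace (realization K)"
    using assms by (simp add: topspace_realization realization_cells_def)
next
  fix S assume "openin (realization K) S"
  then show "openin (simplex_space n) {t \<in> topspace (simplex_space n). realization_pt K (n, x, t) \<in> S}"
    using assms unfolding openin_realization by (metis (no_types) topspace_subtopology_subset
        topspace_euclidean euclidean_product_topology subset_UNIV)
qed

lemma path_component_of_cell:
  assumes "x \<in> simplices K n" "s \<in> standard_simplex n" "t \<in> standard_simplex n"
  shows "path_component_of (realization K) (realization_pt K (n, x, s)) (realization_pt K (n, x, t))"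
proof -
  have "path_connected_space (simplex_space n)"
    using path_connectedin_standard_simplex path_connectedin_def by blast
  then have "path_component_of (simplex_space n) s t"
    using assms by (simp add: path_connected_space_iff_path_component)
  then obtain g where "pathin (simplex_space n) g" "g 0 = s" "g 1 = t"
    unfolding path_component_of_def by blast
  then show ?thesis
    unfolding path_component_of_def
    by (intro exI[of _ "(\<lambda>t. realization_pt K (n, x, t)) \<circ> g"])
       (auto intro: pathin_compose continuous_map_cell[OF assms(1)])
qed

lemma sphere_base_in_simplex: "sphere_base \<in> standard_simplex n"
  by (auto simp: standard_simplex_def sphere_base_def)

lemma joined_refl: "x \<in> simplices K n \<Longrightarrow> joined K n x n x"
  unfolding joined_def by (intro path_component_of_cell sphere_base_in_simplex)

lemma joined_sym: "joined K n x m y \<Longrightarrow> joined K m y n x"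
  unfolding joined_def by (simp add: path_component_of_sym)

lemma joined_trans: "joined K n x m y \<Longrightarrow> joined K m y k z \<Longrightarrow> joined K n x k z"
  unfolding joined_def by (rule path_component_of_trans)

lemma realization_glueI:
  "\<alpha> \<in> delta m n \<Longrightarrow> x \<in> simplices K n \<Longrightarrow> t \<in> standard_simplex m \<Longrightarrow>
     ((m, soper K m n \<alpha> x, t), (n, x, simplex_push m \<alpha> t)) \<in> realization_glue K"
  unfolding realization_glue_def by blast

lemma realization_pt_glue:
  assumes "(c, d) \<in> realization_glue K"
  shows "realization_pt K c = realization_pt K d"
proof -
  let ?R = "realization_glue K \<union> (realization_glue K)\<inverse>"
  have "(c, d) \<in> ?R" "(d, c) \<in> ?R" using assms by auto
  then show ?thesis
    unfolding realization_pt_def by (auto intro: converse_rtrancl_into_rtrancl)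
qed

text \<open>The gluing identifies vertex 0 of the cell of \<open>soper K m n \<alpha> x\<close> with
  vertex \<open>\<alpha> 0\<close> of the cell of \<open>x\<close>, and within the latter it can be
  moved to vertex 0.\<close>

lemma joined_oper:
  assumes "\<alpha> \<in> delta m n" "x \<in> simplices K n"
  shows "joined K m (soper K m n \<alpha> x) n x"
proof -
  have "\<alpha> 0 \<le> n" using assms(1) by (auto simp: delta_def)
  have eq: "simplex_push m \<alpha> sphere_base = (\<lambda>j. if j = \<alpha> 0 then 1 else 0)"
  proof
    fix j
    have "simplex_push m \<alpha> sphere_base j = (\<Sum>i | i \<le> m \<and> \<alpha> i = j. if i = 0 then 1 else 0)"
      by (simp add: simplex_push_def sphere_base_def)
    also have "\<dots> = (if j = \<alpha> 0 then 1 else 0)" by (subst sum.delta) auto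
    finally show "simplex_push m \<alpha> sphere_base j = (if j = \<alpha> 0 then 1 else 0)" .
  qed
  then have "simplex_push m \<alpha> sphere_base \<in> standard_simplex n"
    using \<open>\<alpha> 0 \<le> n\<close> by (auto simp: standard_simplex_def)
  then have "path_component_of (realization K)
      (realization_pt K (n, x, simplex_push m \<alpha> sphere_base)) (realization_pt K (n, x, sphere_base))"
    using assms(2) by (intro path_component_of_cell sphere_base_in_simplex)
  moreover have "realization_pt K (m, soper K m n \<alpha> x, sphere_base) =
      realization_pt K (n, x, simplex_push m \<alpha> sphere_base)"
    using assms sphere_base_in_simplex by (intro realization_pt_glue realization_glueI)
  ultimately show ?thesis by (simp add: joined_def)
qed

lemma realization_glue_invariant:
  assumes "\<And>c d. (c, d) \<in> realization_glue K \<Longrightarrow> h c = h d" and "d \<in> realization_pt K c"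
  shows "h d = h c"
proof -
  have "(c, d) \<in> (realization_glue K \<union> (realization_glue K)\<inverse>)\<^sup>*"
    using assms(2) by (simp add: realization_pt_def)
  then show ?thesis
    by induction (use assms(1) in force)+
qed

lemma realization_pt_self: "c \<in> realization_pt K c"
  by (simp add: realization_pt_def)

text \<open>
  An operator-invariant property of simplices cuts out a subset of the realization which is open
  and closed.
\<close>

lemma joined_invariant:
  fixes K :: "'a sset"
  assumes inv: "\<And>m n \<alpha> x. \<alpha> \<in> delta m n \<Longrightarrow> x \<in> simplices K n \<Longrightarrow> Q m (soper K m n \<alpha> x) = Q n x"
    and j: "joined K n x m y" and x: "x \<in> simplices K n" and y: "y \<in> simplices K m"
    and Q: "Q n x"
  shows "Q m y"
proof -
  define h where "h = (\<lambda>(n, x, t :: nat \<Rightarrow> real). Q n x)"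
  define S where "S b = realization_pt K ` {c \<in> realization_cells K. h c = b}" for b
  \<comment> \<open>\<open>h\<close> ignores the barycentric coordinates; by \<open>inv\<close> it
    is compatible with the gluing, so it descends to the points of the realization.\<close>
  have h_eq: "h c = h d" if "realization_pt K c = realization_pt K d" for c d
  proof (rule realization_glue_invariant)
    show "c \<in> realization_pt K d" using realization_pt_self[of c K] that by metis
    show "h c = h d" if "(c, d) \<in> realization_glue K" for c d
      using that by (auto simp: h_def realization_glue_def inv)
  qed
  have mem: "realization_pt K c \<in> S b \<longleftrightarrow> h c = b" if "c \<in> realization_cells K" for b c
    unfolding S_def using that by (blast dest: h_eq)
  \<comment> \<open>In each cell the preimage of \<open>S b\<close> is the whole simplex or empty.
    As \<open>S False\<close> is the complement of \<open>S True\<close>, the latter is open and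
    closed.\<close>
  have "openin (realization K) (S b)" for b
  proof -
    have "{t \<in> standard_simplex k. realization_pt K (k, z, t) \<in> S b} =
        (if Q k z = b then standard_simplex k else {})" if "z \<in> simplices K k" for k z
      using that mem by (auto simp: realization_cells_def h_def)
    moreover have "openin (simplex_space k) (standard_simplex k)" for k
      by (metis inf_top.left_neutral openin_topspace topspace_euclidean topspace_subtopology
          euclidean_product_topology)
    ultimately show ?thesis unfolding openin_realization by (auto simp: S_def)
  qed
  moreover have "topspace (realization K) - S True = S False"
    unfolding topspace_realization S_def by (blast dest: h_eq)
  moreover have "S True \<subseteq> topspace (realization K)"
    by (auto simp: topspace_realization S_def)
  ultimately have clopen: "openin (realization K) (S True)" "closedin (realization K) (S True)"
    by (simp_all add: closedin_def)
  obtain g where g: "pathin (realization K) g" "g 0 = realization_pt K (n, x, sphere_base)"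
      "g 1 = realization_pt K (m, y, sphere_base)"
    using j unfolding joined_def path_component_of_def by blast
  then have con: "connectedin (realization K) (g ` {0..1})"
    using path_connectedin_path_image path_connectedin_imp_connectedin by blast
  have "g 0 \<in> S True"
    using g mem x Q sphere_base_in_simplex by (simp add: realization_cells_def h_def)
  moreover have "g 0 \<in> g ` {0..1}" by simp
  ultimately have "g ` {0..1} \<subseteq> S True"
    using connectedin_clopen_cases[OF con clopen(2,1)] unfolding disjnt_def by blast
  then have "g 1 \<in> S True" by auto
  then show ?thesis
    using g mem y sphere_base_in_simplex by (simp add: realization_cells_def h_def)
qed

text \<open>\<open>realization_map\<close> takes a union over all representatives of a point.
  Compatibility of \<open>\<phi>\<close> with the operators gives all of them the same image class,
  and the union collapses to it.\<close>

lemma realization_map_pt: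
  assumes "simplicial_map K L \<phi>" "x \<in> simplices K n"
  shows "realization_map L \<phi> (realization_pt K (n, x, t)) = realization_pt L (n, \<phi> n x, t)"
proof -
  define h where "h = (\<lambda>(n, x, t). realization_pt L (n, \<phi> n x, t))"
  have "h c = h d" if "(c, d) \<in> realization_glue K" for c d
  proof -
    from that obtain m n \<alpha> x t where cd: "c = (m, soper K m n \<alpha> x, t)" "d = (n, x, simplex_push m \<alpha> t)"
      "\<alpha> \<in> delta m n" "x \<in> simplices K n" "t \<in> standard_simplex m"
      unfolding realization_glue_def by blast
    have "\<phi> n x \<in> simplices L n" "\<phi> m (soper K m n \<alpha> x) = soper L m n \<alpha> (\<phi> n x)"
      using assms(1) cd unfolding simplicial_map_def by blast+
    then have "((m, \<phi> m (soper K m n \<alpha> x), t), (n, \<phi> n x, simplex_push m \<alpha> t)) \<in> realization_glue L"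
      using cd realization_glueI by metis
    then show ?thesis
      using realization_pt_glue by (simp add: h_def cd)
  qed
  then have "h d = h (n, x, t)" if "d \<in> realization_pt K (n, x, t)" for d
    using that realization_glue_invariant by metis
  then have "(\<Union>c\<in>realization_pt K (n, x, t). h c) = h (n, x, t)"
    using realization_pt_self by fastforce
  then show ?thesis by (simp add: realization_map_def h_def)
qed

lemma weak_equiv_joined_reflect:
  assumes w: "sset_weak_equiv K L \<phi>" and s: "simplicial_map K L \<phi>"
    and x: "x \<in> simplices K n" and y: "y \<in> simplices K m" and j: "joined L n (\<phi> n x) m (\<phi> m y)"
  shows "joined K n x m y"
proof -
  let ?a = "realization_pt K (n, x, sphere_base)" and ?b = "realization_pt K (m, y, sphere_base)"
  have "?a \<in> topspace (realization K)" "?b \<in> topspace (realization K)"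
    using x y sphere_base_in_simplex by (auto simp: topspace_realization realization_cells_def)
  moreover have "path_component_of (realization L) (realization_map L \<phi> ?a) (realization_map L \<phi> ?b)"
    using j by (simp add: realization_map_pt[OF s] x y joined_def)
  ultimately show ?thesis
    using w unfolding joined_def sset_weak_equiv_def weak_homotopy_equivalence_def by blast
qed

text \<open>Surjectivity on path components only gives a point in the cell of some simplex
  \<open>x\<close>, whose dimension \<open>m\<close> is unrelated to \<open>n\<close>; inside its
  cell the point is then moved to vertex 0.\<close>

lemma weak_equiv_joined_onto:
  assumes w: "sset_weak_equiv K L \<phi>" and s: "simplicial_map K L \<phi>" and y: "y \<in> simplices L n"
  obtains m x where "x \<in> simplices K m" "joined L m (\<phi> m x) n y"
proof -
  let ?b = "realization_pt L (n, y, sphere_base)"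
  have "?b \<in> topspace (realization L)"
    using y sphere_base_in_simplex by (auto simp: topspace_realization realization_cells_def)
  then obtain a where "a \<in> topspace (realization K)"
      and "path_component_of (realization L) (realization_map L \<phi> a) ?b"
    using w unfolding sset_weak_equiv_def weak_homotopy_equivalence_def by blast
  then obtain m x t where x: "x \<in> simplices K m" "t \<in> standard_simplex m"
      and p: "path_component_of (realization L) (realization_pt L (m, \<phi> m x, t)) ?b"
    by (auto simp: topspace_realization realization_cells_def realization_map_pt[OF s])
  have "path_component_of (realization L) (realization_pt L (m, \<phi> m x, sphere_base))
      (realization_pt L (m, \<phi> m x, t))"
    using s x by (intro path_component_of_cell sphere_base_in_simplex) (auto simp: simplicial_map_def)
  then have "joined L m (\<phi> m x) n y"
    unfolding joined_def using p by (rule path_component_of_trans)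
  with x(1) show ?thesis by (rule that)
qed

section \<open>Complex spaces and holomorphic maps\<close>

lemma points_open_sub: "points (U \<restriction>\<^sub>o V) = points U \<inter> V"
  by (simp add: open_sub_def)

lemma points_open_sub_openin: "openin (ctop U) V \<Longrightarrow> points (U \<restriction>\<^sub>o V) = V"
  using openin_subset by (auto simp: points_open_sub)

lemma openin_open_sub: "openin (ctop U) V \<Longrightarrow> openin (ctop (U \<restriction>\<^sub>o V)) W \<longleftrightarrow> openin (ctop U) W \<and> W \<subseteq> V"
  by (simp add: open_sub_def openin_open_subtopology)

lemma funs_open_sub [simp]: "funs (U \<restriction>\<^sub>o V) = funs U"
  by (simp add: open_sub_def)

lemma open_sub_open_sub: "W \<subseteq> V \<Longrightarrow> U \<restriction>\<^sub>o V \<restriction>\<^sub>o W = U \<restriction>\<^sub>o W"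
  by (simp add: open_sub_def subtopology_subtopology inf.absorb2)

lemma open_sub_points [simp]: "U \<restriction>\<^sub>o points U = U"
  by (simp add: open_sub_def)

lemma nbhds_open_sub: "openin (ctop U) V \<Longrightarrow> nbhds (U \<restriction>\<^sub>o V) u = {W \<in> nbhds U u. W \<subseteq> V}"
  by (auto simp: nbhds_def openin_open_sub)

lemma nbhds_Int: "V \<in> nbhds U u \<Longrightarrow> W \<in> nbhds U u \<Longrightarrow> V \<inter> W \<in> nbhds U u"
  by (auto simp: nbhds_def)

lemma nbhds_points: "u \<in> points U \<Longrightarrow> points U \<in> nbhds U u"
  by (auto simp: nbhds_def)

lemma nbhdsD:
  assumes "V \<in> nbhds U u"
  shows "openin (ctop U) V" "u \<in> V" "V \<subseteq> points U" "u \<in> points U"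
  using assms openin_subset by (auto simp: nbhds_def)

lemma nbhds_other: "V \<in> nbhds U u \<Longrightarrow> v \<in> V \<Longrightarrow> V \<in> nbhds U v"
  by (auto simp: nbhds_def)

section \<open>Axioms of complex spaces and shrinking of local models\<close>

lemma complex_space_Hausdorff: "complex_space X \<Longrightarrow> Hausdorff_space (ctop X)"
  unfolding complex_space_def by (rule conjunct1)

lemma complex_space_local_model:
  "complex_space X \<Longrightarrow> p \<in> points X \<Longrightarrow> \<exists>V n W G \<phi>. p \<in> V \<and> local_model X V n W G \<phi>"
  unfolding complex_space_def by (drule conjunct2)+ (rule bspec)

lemma funs_extensional: "complex_space X \<Longrightarrow> openin (ctop X) V \<Longrightarrow> f \<in> funs X V \<Longrightarrow> f \<in> extensional V"
  unfolding complex_space_def by (drule conjunct2, drule conjunct1) (simp add: subset_iff)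

lemma funs_restrict:
  "complex_space X \<Longrightarrow> openin (ctop X) V \<Longrightarrow> f \<in> funs X V \<Longrightarrow> openin (ctop X) V' \<Longrightarrow> V' \<subseteq> V \<Longrightarrow>
    restrict f V' \<in> funs X V'"
  unfolding complex_space_def by (drule conjunct2, drule conjunct2, drule conjunct1) simp

lemma funs_glue:
  "complex_space X \<Longrightarrow> openin (ctop X) V \<Longrightarrow> f \<in> extensional V \<Longrightarrow>
    (\<And>p. p \<in> V \<Longrightarrow> \<exists>V'. openin (ctop X) V' \<and> p \<in> V' \<and> V' \<subseteq> V \<and> restrict f V' \<in> funs X V') \<Longrightarrow> f \<in> funs X V"
  unfolding complex_space_def by (drule conjunct2, drule conjunct2, drule conjunct2, drule conjunct1) simp

lemma complex_spaceI:
  assumes "Hausdorff_space (ctop X)"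
    and "\<And>V f. openin (ctop X) V \<Longrightarrow> f \<in> funs X V \<Longrightarrow> f \<in> extensional V"
    and "\<And>V V' f. openin (ctop X) V \<Longrightarrow> openin (ctop X) V' \<Longrightarrow> V' \<subseteq> V \<Longrightarrow> f \<in> funs X V \<Longrightarrow>
      restrict f V' \<in> funs X V'"
    and "\<And>V f. openin (ctop X) V \<Longrightarrow> f \<in> extensional V \<Longrightarrow>
      \<forall>p\<in>V. \<exists>V'. openin (ctop X) V' \<and> p \<in> V' \<and> V' \<subseteq> V \<and> restrict f V' \<in> funs X V' \<Longrightarrow> f \<in> funs X V"
    and "\<And>p. p \<in> points X \<Longrightarrow> \<exists>V n W G \<phi>. p \<in> V \<and> local_model X V n W G \<phi>"
  shows "complex_space X"
  unfolding complex_space_def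
  by (intro conjI allI impI ballI subsetI; (elim conjE)?; rule assms; assumption)

lemma Cn_holomorphic_subset: "Cn_holomorphic n W g \<Longrightarrow> W' \<subseteq> W \<Longrightarrow> Cn_holomorphic n W' g"
  unfolding Cn_holomorphic_def by (meson subsetD tendsto_within_subset)

lemma Cn_holomorphic_const: "Cn_holomorphic n W (\<lambda>_. c)"
  unfolding Cn_holomorphic_def by (auto intro!: exI[of _ "\<lambda>_. 0"])

text \<open>The chart carries \<open>V'\<close> to a relatively open part of the zero set. Cutting
  the ambient open set down accordingly and keeping the same equations gives a chart of
  \<open>V'\<close>.\<close>

lemma local_model_shrink:
  assumes m: "local_model X V n W G \<phi>" and V': "openin (ctop X) V'" "V' \<subseteq> V"
  shows "\<exists>W'. local_model X V' n W' G \<phi>"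
proof -
  let ?Z = "{z \<in> W. \<forall>g\<in>G. g z = 0}"
  have V: "openin (ctop X) V" and W: "Cn_open n W" and hom: "homeomorphic_map (subtopology (ctop X) V) (top_of_set ?Z) \<phi>"
    using m unfolding local_model_def by blast+
  have sub: "V \<subseteq> topspace (ctop X)" using V openin_subset by blast
  have "openin (subtopology (ctop X) V) V'" using V V' by (simp add: openin_open_subtopology)
  then have "openin (top_of_set ?Z) (\<phi> ` V')"
    using homeomorphic_map_openness[OF hom, of V'] V' sub by auto
  \<comment> \<open>\<open>T\<close> is an open set of the ambient space that cuts out the image of
    \<open>V'\<close>; the new ambient domain is \<open>W \<inter> T\<close>.\<close>
  then obtain T where T: "open T" "\<phi> ` V' = ?Z \<inter> T" by (auto simp: openin_open)
  have C: "Cn_open n (W \<inter> T)" using W T(1) unfolding Cn_open_def by (simp add: openin_Int_open)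
  have Z': "{z \<in> W \<inter> T. \<forall>g\<in>G. g z = 0} = ?Z \<inter> T" by auto
  have "homeomorphic_map (subtopology (subtopology (ctop X) V) V') (subtopology (top_of_set ?Z) (?Z \<inter> T)) \<phi>"
    using T V' sub by (intro homeomorphic_map_subtopologies[OF hom]) (auto simp: Int_absorb1)
  with C have "Cn_open n (W \<inter> T)" and "homeomorphic_map (subtopology (ctop X) V') (top_of_set (?Z \<inter> T)) \<phi>"
    using V' by (simp_all add: subtopology_subtopology inf.absorb2)
  moreover have "\<forall>g\<in>G. Cn_holomorphic n (W \<inter> T) g"
    using m unfolding local_model_def by (blast intro: Cn_holomorphic_subset)
  moreover have "f \<in> funs X V'' \<longleftrightarrow> f \<in> extensional V'' \<and>
           (\<forall>p\<in>V''. \<exists>W' h. Cn_open n W' \<and> \<phi> p \<in> W' \<and> Cn_holomorphic n W' h \<and>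
              (\<forall>q\<in>V''. \<phi> q \<in> W' \<longrightarrow> f q = h (\<phi> q)))"
    if "openin (ctop X) V'' \<and> V'' \<subseteq> V'" for V'' f
    using m that subset_trans[OF conjunct2[OF that] V'(2)] unfolding local_model_def by simp
  moreover have "finite G" using m unfolding local_model_def by simp
  ultimately have "local_model X V' n (W \<inter> T) G \<phi>"
    using V'(1) unfolding local_model_def Z' by simp
  then show ?thesis ..
qed

lemma local_model_open_sub:
  assumes "local_model X V n W G \<phi>" "openin (ctop X) V'" "V \<subseteq> V'"
  shows "local_model (X \<restriction>\<^sub>o V') V n W G \<phi>"
proof -
  have "subtopology (ctop (X \<restriction>\<^sub>o V')) V = subtopology (ctop X) V"
    using assms(3) by (simp add: open_sub_def subtopology_subtopology inf.absorb2)
  then show ?thesis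
    using assms unfolding local_model_def by (simp add: openin_open_sub)
qed

lemma complex_space_open_sub:
  assumes X: "complex_space X" and V: "openin (ctop X) V"
  shows "complex_space (X \<restriction>\<^sub>o V)"
proof (rule complex_spaceI)
  show "Hausdorff_space (ctop (X \<restriction>\<^sub>o V))"
    using complex_space_Hausdorff[OF X] by (simp add: open_sub_def Hausdorff_space_subtopology)
next
  fix p assume "p \<in> points (X \<restriction>\<^sub>o V)"
  then have p: "p \<in> points X" "p \<in> V" by (auto simp: points_open_sub)
  then obtain V0 n W G \<phi> where m: "p \<in> V0" "local_model X V0 n W G \<phi>"
    using complex_space_local_model[OF X] by blast
  then have V0: "openin (ctop X) (V0 \<inter> V)" using V unfolding local_model_def by blast
  then obtain W' where "local_model X (V0 \<inter> V) n W' G \<phi>" using local_model_shrink[OF m(2) V0] by blast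
  then have "local_model (X \<restriction>\<^sub>o V) (V0 \<inter> V) n W' G \<phi>" using V by (rule local_model_open_sub) simp
  then show "\<exists>V' n W G \<phi>. p \<in> V' \<and> local_model (X \<restriction>\<^sub>o V) V' n W G \<phi>" using p m by blast
next
  fix W f assume "openin (ctop (X \<restriction>\<^sub>o V)) W" "f \<in> extensional W"
    "\<forall>p\<in>W. \<exists>V'. openin (ctop (X \<restriction>\<^sub>o V)) V' \<and> p \<in> V' \<and> V' \<subseteq> W \<and> restrict f V' \<in> funs (X \<restriction>\<^sub>o V) V'"
  then show "f \<in> funs (X \<restriction>\<^sub>o V) W"
    using V by (simp add: openin_open_sub) (rule funs_glue[OF X], auto)
next
  fix W W' f assume "openin (ctop (X \<restriction>\<^sub>o V)) W" "openin (ctop (X \<restriction>\<^sub>o V)) W'" "W' \<subseteq> W" "f \<in> funs (X \<restriction>\<^sub>o V) W"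
  then show "restrict f W' \<in> funs (X \<restriction>\<^sub>o V) W'"
    using V by (simp add: openin_open_sub) (blast intro: funs_restrict[OF X])
next
  fix W f assume "openin (ctop (X \<restriction>\<^sub>o V)) W" "f \<in> funs (X \<restriction>\<^sub>o V) W"
  then show "f \<in> extensional W"
    using V by (simp add: openin_open_sub) (blast intro: funs_extensional[OF X])
qed

text \<open>The sheaf axioms alone do not provide constants. They come from the local models, where
  a constant function extends to the whole ambient domain.\<close>

lemma funs_const:
  assumes X: "complex_space X" and V: "openin (ctop X) V"
  shows "(\<lambda>x\<in>V. c) \<in> funs X V"
proof (rule funs_glue[OF X V])
  fix p assume "p \<in> V"
  then have "p \<in> points X" using V openin_subset by blast
  then obtain V0 n W G \<phi> where p: "p \<in> V0" and m: "local_model X V0 n W G \<phi>"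
    using complex_space_local_model[OF X] by blast
  have V0: "openin (ctop X) (V \<inter> V0)" using V m unfolding local_model_def by blast
  have hom: "homeomorphic_map (subtopology (ctop X) V0) (top_of_set {z \<in> W. \<forall>g\<in>G. g z = 0}) \<phi>"
    and W: "Cn_open n W"
    using m unfolding local_model_def by simp_all
  have "\<phi> ` (points X \<inter> V0) \<subseteq> W"
    using homeomorphic_imp_surjective_map[OF hom] by auto
  then have "\<phi> q \<in> W" if "q \<in> V \<inter> V0" for q using that V openin_subset by blast
  then have *: "\<forall>q\<in>V \<inter> V0. \<exists>W' h. Cn_open n W' \<and> \<phi> q \<in> W' \<and> Cn_holomorphic n W' h \<and>
       (\<forall>r\<in>V \<inter> V0. \<phi> r \<in> W' \<longrightarrow> (\<lambda>x\<in>V \<inter> V0. c) r = h (\<phi> r))"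
    using W Cn_holomorphic_const[of n W c] by (intro ballI exI[of _ W] exI[of _ "\<lambda>_. c"]) simp
  have "(\<lambda>x\<in>V \<inter> V0. c) \<in> funs X (V \<inter> V0)"
    using m V0 * unfolding local_model_def by simp
  moreover have "restrict (\<lambda>x\<in>V. c) (V \<inter> V0) = (\<lambda>x\<in>V \<inter> V0. c)" by auto
  ultimately show "\<exists>V'. openin (ctop X) V' \<and> p \<in> V' \<and> V' \<subseteq> V \<and> restrict (\<lambda>x\<in>V. c) V' \<in> funs X V'"
    using V0 p \<open>p \<in> V\<close> by (intro exI[of _ "V \<inter> V0"]) auto
qed auto

section \<open>Holomorphic maps: restriction, composition, constants and gluing\<close>

lemma hol_mapsD:
  assumes "f \<in> hol_maps U V"
  shows "f \<in> extensional (points U)" "continuous_map (ctop U) (ctop V) f"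
    "openin (ctop V) W \<Longrightarrow> g \<in> funs V W \<Longrightarrow>
      (\<lambda>x\<in>{x\<in>points U. f x \<in> W}. g (f x)) \<in> funs U {x\<in>points U. f x \<in> W}"
    "u \<in> points U \<Longrightarrow> f u \<in> points V"
    "openin (ctop V) W \<Longrightarrow> openin (ctop U) {x\<in>points U. f x \<in> W}"
  using assms by (auto simp: hol_maps_def continuous_map_def)

lemma nbhds_vimage:
  assumes "f \<in> hol_maps U V" "u \<in> points U" "W \<in> nbhds V (f u)"
  shows "{x\<in>points U. f x \<in> W} \<in> nbhds U u"
  using assms hol_mapsD(5)[OF assms(1)] by (auto simp: nbhds_def)

lemma hol_maps_incl:
  assumes U: "complex_space U" and "openin (ctop U) V" "openin (ctop U) W" "W \<subseteq> V"
  shows "incl W \<in> hol_maps (U \<restriction>\<^sub>o W) (U \<restriction>\<^sub>o V)"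
proof -
  have pts: "points (U \<restriction>\<^sub>o W) = W" "points (U \<restriction>\<^sub>o V) = V" using assms by (auto simp: points_open_sub_openin)
  have "continuous_map (ctop (U \<restriction>\<^sub>o W)) (ctop (U \<restriction>\<^sub>o V)) (incl W)"
  proof -
    have "continuous_map (subtopology (ctop U) W) (subtopology (ctop U) V) id"
      using assms(4) by (auto simp: continuous_map_in_subtopology continuous_map_from_subtopology)
    then show ?thesis
      unfolding open_sub_def using openin_subset[OF assms(3)]
      by (auto simp: incl_def intro: continuous_map_eq)
  qed
  moreover have "(\<lambda>x\<in>{x\<in>W. incl W x \<in> W'}. g (incl W x)) \<in> funs U {x\<in>W. incl W x \<in> W'}"
    if "openin (ctop U) W'" "W' \<subseteq> V" "g \<in> funs U W'" for W' g
  proof -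
    have "{x\<in>W. incl W x \<in> W'} = W \<inter> W'" by (auto simp: incl_def)
    moreover have "(\<lambda>x\<in>W \<inter> W'. g (incl W x)) = restrict g (W \<inter> W')" by (auto simp: incl_def)
    moreover have "restrict g (W \<inter> W') \<in> funs U (W \<inter> W')"
      using that assms by (intro funs_restrict[OF U that(1,3)]) auto
    ultimately show ?thesis by simp
  qed
  ultimately show ?thesis
    using assms pts by (auto simp: hol_maps_def incl_def openin_open_sub)
qed

lemma hol_maps_incl_points:
  "complex_space U \<Longrightarrow> incl (points U) \<in> hol_maps U U"
  using hol_maps_incl[of U "points U" "points U"] by simp

lemma hol_maps_compose:
  assumes f: "f \<in> hol_maps U V" and g: "g \<in> hol_maps V W"
  shows "compose (points U) g f \<in> hol_maps U W"
proof -
  have "continuous_map (ctop U) (ctop W) (g \<circ> f)"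
    using hol_mapsD(2)[OF f] hol_mapsD(2)[OF g] continuous_map_compose by blast
  then have "continuous_map (ctop U) (ctop W) (compose (points U) g f)"
    by (rule continuous_map_eq) (simp add: compose_def)
  moreover have "(\<lambda>x\<in>{x\<in>points U. compose (points U) g f x \<in> W'}. h (compose (points U) g f x)) \<in>
      funs U {x\<in>points U. compose (points U) g f x \<in> W'}" if "openin (ctop W) W'" "h \<in> funs W W'" for W' h
  proof -
    let ?V' = "{y\<in>points V. g y \<in> W'}"
    have eq: "{x\<in>points U. compose (points U) g f x \<in> W'} = {x\<in>points U. f x \<in> ?V'}"
      using hol_mapsD(4)[OF f] by (auto simp: compose_def)
    have "(\<lambda>x\<in>{x\<in>points U. f x \<in> ?V'}. (\<lambda>y\<in>?V'. h (g y)) (f x)) \<in> funs U {x\<in>points U. f x \<in> ?V'}"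
      using hol_mapsD(3)[OF g that] hol_mapsD(5)[OF g that(1)] by (intro hol_mapsD(3)[OF f])
    also have "(\<lambda>x\<in>{x\<in>points U. f x \<in> ?V'}. (\<lambda>y\<in>?V'. h (g y)) (f x)) =
        (\<lambda>x\<in>{x\<in>points U. f x \<in> ?V'}. h (compose (points U) g f x))" by (auto simp: compose_def)
    finally show ?thesis unfolding eq .
  qed
  ultimately show ?thesis by (auto simp: hol_maps_def compose_def)
qed

lemma hol_maps_into_open:
  assumes f: "f \<in> hol_maps U V" and W: "openin (ctop V) W" and sub: "f ` points U \<subseteq> W"
  shows "f \<in> hol_maps U (V \<restriction>\<^sub>o W)"
proof -
  have "continuous_map (ctop U) (ctop (V \<restriction>\<^sub>o W)) f"
    using hol_mapsD(2)[OF f] sub by (auto simp: open_sub_def continuous_map_in_subtopology)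
  then show ?thesis
    using hol_mapsD(1,3)[OF f] W by (auto simp: hol_maps_def openin_open_sub)
qed

lemma compose_incl:
  assumes "openin (ctop U) W"
  shows "compose (points (U \<restriction>\<^sub>o W)) f (incl W) = restrict f W"
  using assms by (auto simp: points_open_sub_openin compose_def incl_def)

lemma hol_maps_restrict:
  assumes U: "complex_space U" and f: "f \<in> hol_maps U V" and W: "openin (ctop V) W"
    and W': "openin (ctop U) W'" and sub: "f ` W' \<subseteq> W"
  shows "restrict f W' \<in> hol_maps (U \<restriction>\<^sub>o W') (V \<restriction>\<^sub>o W)"
proof -
  have "compose (points (U \<restriction>\<^sub>o W')) f (incl W') \<in> hol_maps (U \<restriction>\<^sub>o W') V"
    using hol_maps_incl[OF U openin_topspace W'] openin_subset[OF W'] by (intro hol_maps_compose[OF _ f]) simp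
  then show ?thesis
    unfolding compose_incl[OF W'] using sub W
    by (intro hol_maps_into_open) (auto simp: points_open_sub_openin[OF W'])
qed

text \<open>The preimage of an open set is everything or empty, and functions pull back to constants
  on it.\<close>

lemma hol_maps_const:
  assumes U: "complex_space U" and p: "p \<in> points V"
  shows "(\<lambda>u\<in>points U. p) \<in> hol_maps U V"
proof -
  have "continuous_map (ctop U) (ctop V) (\<lambda>u\<in>points U. p)"
    by (rule continuous_map_eq[of _ _ "\<lambda>_. p"]) (use p in auto)
  moreover have "(\<lambda>x\<in>{x\<in>points U. (\<lambda>u\<in>points U. p) x \<in> W}. g ((\<lambda>u\<in>points U. p) x))
      \<in> funs U {x\<in>points U. (\<lambda>u\<in>points U. p) x \<in> W}" for W g
  proof -
    let ?W = "{x\<in>points U. (\<lambda>u\<in>points U. p) x \<in> W}"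
    have W: "?W = (if p \<in> W then points U else {})" by auto
    have "(\<lambda>x\<in>?W. g ((\<lambda>u\<in>points U. p) x)) = (\<lambda>x\<in>?W. g p)" by auto
    also have "\<dots> \<in> funs U ?W" unfolding W by (intro funs_const[OF U]) auto
    finally show ?thesis .
  qed
  ultimately show ?thesis by (auto simp: hol_maps_def)
qed

text \<open>Locality on the source is the core of the gluing axiom for representable sheaves:
  preimages are unions of open pieces, and the pulled back functions are glued by
  \<open>funs_glue\<close>.\<close>

lemma hol_maps_local:
  assumes U: "complex_space U" and ext: "f \<in> extensional (points U)"
    and loc: "\<And>u. u \<in> points U \<Longrightarrow> \<exists>V\<in>nbhds U u. restrict f V \<in> hol_maps (U \<restriction>\<^sub>o V) X"
  shows "f \<in> hol_maps U X"
proof -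
  have open_loc: "openin (ctop U) {x\<in>V. f x \<in> W}"
    and pts_loc: "\<And>v. v \<in> V \<Longrightarrow> f v \<in> points X"
    and fun_loc: "\<And>g. g \<in> funs X W \<Longrightarrow> (\<lambda>x\<in>{x\<in>V. f x \<in> W}. g (f x)) \<in> funs U {x\<in>V. f x \<in> W}"
    if V: "openin (ctop U) V" "restrict f V \<in> hol_maps (U \<restriction>\<^sub>o V) X" and W: "openin (ctop X) W" for V W
  proof -
    have P: "points (U \<restriction>\<^sub>o V) = V" using V by (simp add: points_open_sub_openin)
    have S: "{x\<in>points (U \<restriction>\<^sub>o V). restrict f V x \<in> W} = {x\<in>V. f x \<in> W}" by (auto simp: P)
    show "openin (ctop U) {x\<in>V. f x \<in> W}"
      using hol_mapsD(5)[OF V(2) W] V unfolding S by (simp add: openin_open_sub)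
    show "f v \<in> points X" if "v \<in> V" for v using hol_mapsD(4)[OF V(2), of v] that P by simp
    fix g assume "g \<in> funs X W"
    from hol_mapsD(3)[OF V(2) W this]
    have "(\<lambda>x\<in>{x\<in>V. f x \<in> W}. g (restrict f V x)) \<in> funs U {x\<in>V. f x \<in> W}" unfolding S by simp
    also have "(\<lambda>x\<in>{x\<in>V. f x \<in> W}. g (restrict f V x)) = (\<lambda>x\<in>{x\<in>V. f x \<in> W}. g (f x))" by auto
    finally show "(\<lambda>x\<in>{x\<in>V. f x \<in> W}. g (f x)) \<in> funs U {x\<in>V. f x \<in> W}" .
  qed
  have pre: "openin (ctop U) {x\<in>points U. f x \<in> W}" if W: "openin (ctop X) W" for W
  proof (subst openin_subopen, intro ballI)
    fix u assume "u \<in> {x\<in>points U. f x \<in> W}"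
    moreover then obtain V where "V \<in> nbhds U u" "restrict f V \<in> hol_maps (U \<restriction>\<^sub>o V) X" using loc by blast
    ultimately show "\<exists>T. openin (ctop U) T \<and> u \<in> T \<and> T \<subseteq> {x\<in>points U. f x \<in> W}"
      using open_loc[of V W] W nbhdsD[of V U u] by (intro exI[of _ "{x\<in>V. f x \<in> W}"]) auto
  qed
  have "f u \<in> points X" if "u \<in> points U" for u
    using loc[OF that] pts_loc[OF _ _ openin_topspace] nbhdsD by metis
  then have "continuous_map (ctop U) (ctop X) f" using pre by (auto simp: continuous_map_def)
  moreover have "(\<lambda>x\<in>{x\<in>points U. f x \<in> W}. g (f x)) \<in> funs U {x\<in>points U. f x \<in> W}"
    if W: "openin (ctop X) W" "g \<in> funs X W" for W g
  proof (rule funs_glue[OF U pre[OF W(1)]])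
    fix u assume u: "u \<in> {x\<in>points U. f x \<in> W}"
    then obtain V where V: "V \<in> nbhds U u" "restrict f V \<in> hol_maps (U \<restriction>\<^sub>o V) X" using loc by blast
    have "restrict (\<lambda>x\<in>{x\<in>points U. f x \<in> W}. g (f x)) {x\<in>V. f x \<in> W} = (\<lambda>x\<in>{x\<in>V. f x \<in> W}. g (f x))"
      using nbhdsD(3)[OF V(1)] by (fastforce simp: restrict_def)
    then show "\<exists>V'. openin (ctop U) V' \<and> u \<in> V' \<and> V' \<subseteq> {x\<in>points U. f x \<in> W} \<and>
       restrict (\<lambda>x\<in>{x\<in>points U. f x \<in> W}. g (f x)) V' \<in> funs U V'"
      using open_loc[OF nbhdsD(1)[OF V(1)] V(2) W(1)] fun_loc[OF nbhdsD(1)[OF V(1)] V(2) W(1) W(2)] u nbhdsD[OF V(1)]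
      by (intro exI[of _ "{x\<in>V. f x \<in> W}"]) auto
  qed auto
  ultimately show ?thesis using ext by (auto simp: hol_maps_def)
qed

section \<open>Localizations\<close>

text \<open>The record \<open>category\<close> carries no laws; they are supplied here, together
  with the inclusion of \<open>W\<close> in the Hom-sets.\<close>

locale localizable =
  fixes C :: "('o, 'm) category" and W :: "'o \<Rightarrow> 'o \<Rightarrow> 'm set"
  assumes idt_in: "X \<in> Ob C \<Longrightarrow> Idt C X \<in> Hom C X X"
    and cmp_in: "X \<in> Ob C \<Longrightarrow> Y \<in> Ob C \<Longrightarrow> Z \<in> Ob C \<Longrightarrow> f \<in> Hom C X Y \<Longrightarrow> g \<in> Hom C Y Z \<Longrightarrow>
      Cmp C X g f \<in> Hom C X Z"
    and cmp_assoc: "X \<in> Ob C \<Longrightarrow> Y \<in> Ob C \<Longrightarrow> Z \<in> Ob C \<Longrightarrow> V \<in> Ob C \<Longrightarrow>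
      f \<in> Hom C X Y \<Longrightarrow> g \<in> Hom C Y Z \<Longrightarrow> h \<in> Hom C Z V \<Longrightarrow>
      Cmp C X h (Cmp C X g f) = Cmp C X (Cmp C Y h g) f"
    and cmp_idt: "X \<in> Ob C \<Longrightarrow> Y \<in> Ob C \<Longrightarrow> f \<in> Hom C X Y \<Longrightarrow> Cmp C X f (Idt C X) = f"
    and idt_cmp: "X \<in> Ob C \<Longrightarrow> Y \<in> Ob C \<Longrightarrow> f \<in> Hom C X Y \<Longrightarrow> Cmp C X (Idt C Y) f = f"
    and W_hom: "w \<in> W X Y \<Longrightarrow> w \<in> Hom C X Y"
begin

lemma zigzag_Ob:
  assumes "zigzag C W X p Y"
  shows "X \<in> Ob C" "Y \<in> Ob C"
  using assms by (induction rule: zigzag.induct) auto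

lemma zigzag_append: "zigzag C W X p Y \<Longrightarrow> zigzag C W Y q Z \<Longrightarrow> zigzag C W X (p @ q) Z"
  by (induction rule: zigzag.induct) (auto intro: zigzag.intros)

lemma zigzag_Fwd: "X \<in> Ob C \<Longrightarrow> Y \<in> Ob C \<Longrightarrow> f \<in> Hom C X Y \<Longrightarrow> zigzag C W X [Fwd X Y f] Y"
  by (auto intro: zigzag.intros)

lemma zigzag_Bwd: "X \<in> Ob C \<Longrightarrow> Y \<in> Ob C \<Longrightarrow> w \<in> W Y X \<Longrightarrow> zigzag C W X [Bwd X Y w] Y"
  by (auto intro: zigzag.intros)

lemma elem_move_zigzag:
  assumes "elem_move C W A B u v"
  shows "zigzag C W A u B" "zigzag C W A v B"
  using assms idt_in cmp_in W_hom
  by (induction rule: elem_move.induct) (auto intro!: zigzag.intros)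

lemma zz_equiv_zigzag:
  assumes "zz_equiv C W X Y p q"
  shows "zigzag C W X p Y" "zigzag C W X q Y"
  using assms
  by (induction rule: zz_equiv.induct) (auto intro: zigzag_append elem_move_zigzag)

lemma zz_equiv_elem:
  assumes "elem_move C W A B u v"
  shows "zz_equiv C W A B u v"
proof -
  have "zigzag C W A [] A" "zigzag C W B [] B"
    using zigzag_Ob[OF elem_move_zigzag(1)[OF assms]] by (auto intro: zigzag.intros)
  then show ?thesis using zze_move[OF _ assms] by fastforce
qed

declare zze_trans [trans]

lemma zz_equiv_append_left:
  assumes "zz_equiv C W X Y p q" "zigzag C W A r X"
  shows "zz_equiv C W A Y (r @ p) (r @ q)"
  using assms
proof (induction rule: zz_equiv.induct)
  case (zze_move p A' B u v q)
  then show ?case using zz_equiv.zze_move[of C W A "r @ p" A' B u v q Y] zigzag_append by auto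
qed (auto intro: zze_refl zze_sym zze_trans zigzag_append)

lemma zz_equiv_append_right:
  assumes "zz_equiv C W X Y p q" "zigzag C W Y r B"
  shows "zz_equiv C W X B (p @ r) (q @ r)"
  using assms
proof (induction rule: zz_equiv.induct)
  case (zze_move p A' B' u v q)
  then show ?case using zz_equiv.zze_move[of C W X p A' B' u v "q @ r" B] zigzag_append by auto
qed (auto intro: zze_refl zze_sym zze_trans zigzag_append)

lemma zz_equiv_comp:
  assumes "X \<in> Ob C" "Y \<in> Ob C" "Z \<in> Ob C" "f \<in> Hom C X Y" "g \<in> Hom C Y Z"
  shows "zz_equiv C W X Z [Fwd X Y f, Fwd Y Z g] [Fwd X Z (Cmp C X g f)]"
  using assms by (intro zz_equiv_elem move_comp)

definition zz_class :: "'o \<Rightarrow> 'o \<Rightarrow> ('o, 'm) leg list \<Rightarrow> ('o, 'm) leg list set" where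
  "zz_class X Y p = {q. zz_equiv C W X Y p q}"

lemma loc_hom_eq: "loc_hom C W X Y = zz_class X Y ` {p. zigzag C W X p Y}"
  by (auto simp: loc_hom_def quotient_def zz_class_def)

text \<open>The congruence is reflexive on zigzags only. A list that is not a zigzag has an empty
  class, whence the assumption on \<open>q\<close>.\<close>

lemma zz_class_eq_iff:
  assumes "zigzag C W X q Y"
  shows "zz_class X Y p = zz_class X Y q \<longleftrightarrow> zz_equiv C W X Y p q"
proof
  assume "zz_class X Y p = zz_class X Y q"
  then show "zz_equiv C W X Y p q" using zze_refl[OF assms] by (auto simp: zz_class_def)
qed (auto simp: zz_class_def intro: zze_trans zze_sym)

text \<open>Prepending a leg respects the congruence, so \<open>loc_precomp\<close>, which unites
  the results over all representatives of a class, can be computed on any one of them.\<close>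

lemma loc_precomp_zz_class:
  assumes "X \<in> Ob C" "f \<in> Hom C X Y" "zigzag C W Y p Z"
  shows "loc_precomp C W X Y Z f (zz_class Y Z p) = zz_class X Z (Fwd X Y f # p)"
proof -
  have "zigzag C W X [Fwd X Y f] Y" using assms zigzag_Ob by (auto intro: zigzag_Fwd)
  then have "zz_equiv C W X Z (Fwd X Y f # p) (Fwd X Y f # p')" if "zz_equiv C W Y Z p p'" for p'
    using zz_equiv_append_left[OF that, of X "[Fwd X Y f]"] by simp
  then show ?thesis
    using zze_refl[OF assms(3)] by (auto simp: loc_precomp_def zz_class_def intro: zze_trans)
qed

lemma zz_class_Fwd: "zz_class X Y [Fwd X Y f] = loc_class C W X Y f"
  by (simp add: zz_class_def loc_class_def)

text \<open>Backward legs are replaced by forward ones, from right to left.\<close>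

lemma zigzag_straighten:
  assumes "zigzag C W X p F"
    and "\<And>X Y w g. X \<in> Ob C \<Longrightarrow> Y \<in> Ob C \<Longrightarrow> w \<in> W X Y \<Longrightarrow> g \<in> Hom C X F \<Longrightarrow>
      \<exists>h\<in>Hom C Y F. g = Cmp C X h w"
  shows "\<exists>g\<in>Hom C X F. zz_equiv C W X F p [Fwd X F g]"
  using assms
proof (induction X p F rule: zigzag.induct)
  case (zz_nil X)
  then show ?case by (auto intro!: bexI[of _ "Idt C X"] idt_in zze_sym[OF zz_equiv_elem] move_id)
next
  case (zz_fwd X f Y p F)
  then obtain g where g: "g \<in> Hom C Y F" "zz_equiv C W Y F p [Fwd Y F g]" by blast
  have Y: "Y \<in> Ob C" and F: "F \<in> Ob C" using zz_fwd zigzag_Ob by auto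
  have "zz_equiv C W X F (Fwd X Y f # p) [Fwd X Y f, Fwd Y F g]"
    using zz_equiv_append_left[OF g(2), of X "[Fwd X Y f]"] zz_fwd Y by (simp add: zigzag_Fwd)
  also have "zz_equiv C W X F \<dots> [Fwd X F (Cmp C X g f)]"
    using zz_fwd Y F g by (intro zz_equiv_comp)
  finally show ?case using cmp_in zz_fwd.hyps(1,2) Y F g by blast
next
  case (zz_bwd X w Y p F)
  then obtain g where g: "g \<in> Hom C Y F" "zz_equiv C W Y F p [Fwd Y F g]" by blast
  have Y: "Y \<in> Ob C" and F: "F \<in> Ob C" using zz_bwd zigzag_Ob by auto
  obtain h where h: "h \<in> Hom C X F" "g = Cmp C Y h w"
    using zz_bwd Y g by blast
  have B: "zigzag C W X [Bwd X Y w] Y" using zz_bwd Y by (simp add: zigzag_Bwd)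
  have "zz_equiv C W X F (Bwd X Y w # p) [Bwd X Y w, Fwd Y F g]"
    using zz_equiv_append_left[OF g(2) B] by simp
  \<comment> \<open>Factoring \<open>g\<close> as \<open>h\<close> after \<open>w\<close> places
    \<open>w\<close> next to its formal inverse, and the pair cancels by
    \<open>move_bf\<close>.\<close>
  also have "zz_equiv C W X F \<dots> [Bwd X Y w, Fwd Y X w, Fwd X F h]"
    using zz_equiv_append_left[OF zze_sym[OF zz_equiv_comp] B, of X F w h] Y F zz_bwd h W_hom by simp
  also have "zz_equiv C W X F \<dots> [Fwd X F h]"
    using zz_equiv_append_right[OF zz_equiv_elem zigzag_Fwd[OF zz_bwd.hyps(1) F h(1)]]
      move_bf[where C = C and W = W and X = Y and Y = X, OF Y zz_bwd.hyps(1,2)] by fastforce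
  finally show ?case using h by blast
qed

end

text \<open>A contravariant set-valued functor that sends \<open>W\<close> to bijections. By the
  universal property it extends to the localization; this gives an invariant that separates zigzags,
  and it makes isomorphisms of the localization act bijectively.\<close>

locale inverted_functor = localizable +
  fixes P :: "'a \<Rightarrow> 'e set" and pb :: "'a \<Rightarrow> 'a \<Rightarrow> 'b \<Rightarrow> 'e \<Rightarrow> 'e"
  assumes pb_in: "X \<in> Ob C \<Longrightarrow> Y \<in> Ob C \<Longrightarrow> f \<in> Hom C X Y \<Longrightarrow> e \<in> P Y \<Longrightarrow> pb X Y f e \<in> P X"
    and pb_idt: "X \<in> Ob C \<Longrightarrow> e \<in> P X \<Longrightarrow> pb X X (Idt C X) e = e"
    and pb_cmp: "X \<in> Ob C \<Longrightarrow> Y \<in> Ob C \<Longrightarrow> Z \<in> Ob C \<Longrightarrow> f \<in> Hom C X Y \<Longrightarrow> g \<in> Hom C Y Z \<Longrightarrow>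
      e \<in> P Z \<Longrightarrow> pb X Z (Cmp C X g f) e = pb X Y f (pb Y Z g e)"
    and pb_bij: "X \<in> Ob C \<Longrightarrow> Y \<in> Ob C \<Longrightarrow> w \<in> W X Y \<Longrightarrow> bij_betw (pb X Y w) (P Y) (P X)"
begin

text \<open>The extension to zigzags: one from \<open>X\<close> to \<open>Y\<close> acts from
  \<open>P Y\<close> to \<open>P X\<close>, a backward leg by the inverse of the bijection
  \<open>pb Y X w\<close>.\<close>

primrec act :: "('a, 'b) leg list \<Rightarrow> 'e \<Rightarrow> 'e" where
  "act [] e = e"
| "act (l # p) e = (case l of Fwd X Y f \<Rightarrow> pb X Y f (act p e)
    | Bwd X Y w \<Rightarrow> the_inv_into (P X) (pb Y X w) (act p e))"

lemma act_append: "act (p @ q) e = act p (act q e)"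
  by (induction p) (auto split: leg.splits)

lemma act_in: "zigzag C W X p Y \<Longrightarrow> e \<in> P Y \<Longrightarrow> act p e \<in> P X"
proof (induction rule: zigzag.induct)
  case (zz_fwd X f Y p Z)
  then show ?case using pb_in zigzag_Ob by auto
next
  case (zz_bwd X w Y p Z)
  then have "bij_betw (pb Y X w) (P X) (P Y)" using pb_bij zigzag_Ob by blast
  then show ?case using zz_bwd by (auto simp: bij_betw_def intro!: the_inv_into_into)
qed auto

lemma act_elem_move:
  assumes "elem_move C W X Y u v" "e \<in> P Y"
  shows "act u e = act v e"
  using assms
proof (induction rule: elem_move.induct)
  case (move_fb X Y w)
  then have "bij_betw (pb X Y w) (P Y) (P X)" using pb_bij by blast
  then show ?case using move_fb by (auto simp: bij_betw_def intro: f_the_inv_into_f)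
next
  case (move_bf X Y w)
  then have "bij_betw (pb X Y w) (P Y) (P X)" using pb_bij by blast
  then show ?case using move_bf by (auto simp: bij_betw_def intro: the_inv_into_f_f)
qed (auto simp: pb_idt pb_cmp)

lemma act_zz_equiv:
  assumes "zz_equiv C W X Y p q" "e \<in> P Y"
  shows "act p e = act q e"
  using assms
  by (induction rule: zz_equiv.induct) (auto simp: act_append act_elem_move act_in)

lemma act_bij:
  assumes "zigzag C W X p Y" "zigzag C W Y q X"
    and "zz_equiv C W X X (p @ q) []" "zz_equiv C W Y Y (q @ p) []"
  shows "bij_betw (act p) (P Y) (P X)"
proof (rule bij_betw_byWitness[of _ "act q"])
  show "\<forall>e\<in>P Y. act q (act p e) = e" "\<forall>e\<in>P X. act p (act q e) = e"
    using assms act_zz_equiv by (fastforce simp: act_append[symmetric])+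
qed (use assms act_in in auto)

end

text \<open>An object that is local for \<open>W\<close> already at the level of strict maps. Then
  the functor Hom(-, F) inverts \<open>W\<close>, and strict and localized Hom-sets into
  \<open>F\<close> coincide.\<close>

locale discrete_target = localizable +
  fixes F
  assumes F: "F \<in> Ob C"
    and W_bij: "X \<in> Ob C \<Longrightarrow> Y \<in> Ob C \<Longrightarrow> w \<in> W X Y \<Longrightarrow>
      bij_betw (\<lambda>g. Cmp C X g w) (Hom C Y F) (Hom C X F)"
begin

sublocale inverted_functor C W "\<lambda>X. Hom C X F" "\<lambda>X Y f g. Cmp C X g f"
  using F by unfold_locales (simp_all add: cmp_in cmp_idt cmp_assoc W_bij)

text \<open>The Yoneda argument: both one-leg zigzags act on the identity of \<open>F\<close>, which
  returns \<open>g\<close> and \<open>h\<close>.\<close>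

lemma zz_equiv_Fwd_eq:
  assumes "X \<in> Ob C" "g \<in> Hom C X F" "h \<in> Hom C X F" "zz_equiv C W X F [Fwd X F g] [Fwd X F h]"
  shows "g = h"
  using act_zz_equiv[OF assms(4), of "Idt C F"] assms F by (simp add: idt_in idt_cmp)

lemma loc_hom_target:
  assumes "X \<in> Ob C"
  shows "loc_hom C W X F = (\<lambda>g. zz_class X F [Fwd X F g]) ` Hom C X F"
proof -
  have "\<exists>g\<in>Hom C X F. zz_class X F p = zz_class X F [Fwd X F g]" if p: "zigzag C W X p F" for p
  proof -
    obtain g where "g \<in> Hom C X F" "zz_equiv C W X F p [Fwd X F g]"
      using zigzag_straighten[OF p] W_bij unfolding bij_betw_def by (metis (no_types, lifting) imageE)
    then show ?thesis using zz_class_eq_iff zz_equiv_zigzag by blast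
  qed
  then show ?thesis
    unfolding loc_hom_eq using assms F zigzag_Fwd by (auto simp: image_iff)
qed

lemma loc_precomp_Fwd:
  assumes "X \<in> Ob C" "Y \<in> Ob C" "f \<in> Hom C X Y" "g \<in> Hom C Y F"
  shows "loc_precomp C W X Y F f (zz_class Y F [Fwd Y F g]) = zz_class X F [Fwd X F (Cmp C X g f)]"
  using assms F by (simp add: loc_precomp_zz_class zigzag_Fwd zz_class_eq_iff cmp_in zz_equiv_comp)

text \<open>The bijection \<open>b\<close> between strict and localized Hom-sets is natural in the
  source, which is \<open>c\<close>. Conjugating with it turns conditions on zigzags, such as
  hyperbolicity, into conditions on strict maps.\<close>

lemma loc_precomp_bij_iff:
  assumes "X \<in> Ob C" "Y \<in> Ob C" "f \<in> Hom C X Y"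
  shows "bij_betw (loc_precomp C W X Y F f) (loc_hom C W Y F) (loc_hom C W X F) \<longleftrightarrow>
    bij_betw (\<lambda>g. Cmp C X g f) (Hom C Y F) (Hom C X F)"
proof -
  have b: "bij_betw (\<lambda>g. zz_class Z F [Fwd Z F g]) (Hom C Z F) (loc_hom C W Z F)" if "Z \<in> Ob C" for Z
    using that zz_equiv_Fwd_eq F
    by (auto simp: bij_betw_def loc_hom_target inj_on_def zz_class_eq_iff zigzag_Fwd)
  have c: "bij_betw (loc_precomp C W X Y F f \<circ> (\<lambda>g. zz_class Y F [Fwd Y F g])) (Hom C Y F) (loc_hom C W X F)
      \<longleftrightarrow> bij_betw ((\<lambda>g. zz_class X F [Fwd X F g]) \<circ> (\<lambda>g. Cmp C X g f)) (Hom C Y F) (loc_hom C W X F)"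
    using assms by (intro bij_betw_cong) (simp add: loc_precomp_Fwd)
  have d: "(\<lambda>g. Cmp C X g f) ` Hom C Y F \<subseteq> Hom C X F" using assms F cmp_in by auto
  have "bij_betw (loc_precomp C W X Y F f) (loc_hom C W Y F) (loc_hom C W X F) \<longleftrightarrow>
     bij_betw (loc_precomp C W X Y F f \<circ> (\<lambda>g. zz_class Y F [Fwd Y F g])) (Hom C Y F) (loc_hom C W X F)"
    by (rule bij_betw_comp_iff[OF b[OF assms(2)]])
  also note c
  also have "bij_betw ((\<lambda>g. zz_class X F [Fwd X F g]) \<circ> (\<lambda>g. Cmp C X g f)) (Hom C Y F) (loc_hom C W X F)
      \<longleftrightarrow> bij_betw (\<lambda>g. Cmp C X g f) (Hom C Y F) (Hom C X F)"
    by (rule bij_betw_comp_iff2[OF b[OF assms(1)] d, symmetric])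
  finally show ?thesis .
qed

end

text \<open>Homs into \<open>Z\<close> in the localization at \<open>W\<close> form a functor on
  \<open>C\<close> that inverts \<open>W'\<close>, hence a functor on the localization at
  \<open>W'\<close>, where isomorphisms act bijectively. The arrow \<open>f\<close> need not lie in
  \<open>W'\<close>; it is enough that its class is invertible.\<close>

lemma loc_precomp_bij_saturated:
  assumes W: "localizable C W" and W': "localizable C W'"
    and inv: "\<And>X Y w. X \<in> Ob C \<Longrightarrow> Y \<in> Ob C \<Longrightarrow> w \<in> W' X Y \<Longrightarrow>
      bij_betw (loc_precomp C W X Y Z w) (loc_hom C W Y Z) (loc_hom C W X Z)"
    and X: "X \<in> Ob C" and Y: "Y \<in> Ob C" and f: "f \<in> Hom C X Y"
    and pq: "zigzag C W' X p Y" "zigzag C W' Y q X"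
      "zz_equiv C W' X X (p @ q) []" "zz_equiv C W' Y Y (q @ p) []"
    and pf: "zz_equiv C W' X Y p [Fwd X Y f]"
  shows "bij_betw (loc_precomp C W X Y Z f) (loc_hom C W Y Z) (loc_hom C W X Z)"
proof -
  interpret L: localizable C W by (rule W)
  interpret L': localizable C W' by (rule W')
  interpret A: inverted_functor C W' "\<lambda>X. loc_hom C W X Z" "\<lambda>X Y. loc_precomp C W X Y Z"
  proof
    fix X Y f e assume a: "X \<in> Ob C" "Y \<in> Ob C" "f \<in> Hom C X Y" "e \<in> loc_hom C W Y Z"
    then obtain r where "zigzag C W Y r Z" "e = L.zz_class Y Z r" by (auto simp: L.loc_hom_eq)
    with a show "loc_precomp C W X Y Z f e \<in> loc_hom C W X Z"
      by (auto simp: L.loc_precomp_zz_class L.loc_hom_eq intro: zigzag.intros)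
  next
    fix X e assume a: "X \<in> Ob C" "e \<in> loc_hom C W X Z"
    then obtain r where r: "zigzag C W X r Z" "e = L.zz_class X Z r" by (auto simp: L.loc_hom_eq)
    have "zz_equiv C W X Z (Fwd X X (Idt C X) # r) r"
      using L.zz_equiv_append_right[OF L.zz_equiv_elem[OF move_id[OF a(1)]] r(1)] by simp
    with a r show "loc_precomp C W X X Z (Idt C X) e = e"
      by (simp add: L.loc_precomp_zz_class L.idt_in L.zz_class_eq_iff)
  next
    fix X Y V f g e
    assume a: "X \<in> Ob C" "Y \<in> Ob C" "V \<in> Ob C" "f \<in> Hom C X Y" "g \<in> Hom C Y V" "e \<in> loc_hom C W V Z"
    then obtain r where r: "zigzag C W V r Z" "e = L.zz_class V Z r" by (auto simp: L.loc_hom_eq)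
    have "zz_equiv C W X Z (Fwd X V (Cmp C X g f) # r) (Fwd X Y f # Fwd Y V g # r)"
      using zze_sym[OF L.zz_equiv_append_right[OF L.zz_equiv_comp[OF a(1-5)] r(1)]] by simp
    moreover have "zigzag C W Y (Fwd Y V g # r) Z" "zigzag C W X (Fwd X Y f # Fwd Y V g # r) Z"
      using a r by (auto intro!: zigzag.intros)
    ultimately show "loc_precomp C W X V Z (Cmp C X g f) e = loc_precomp C W X Y Z f (loc_precomp C W Y V Z g e)"
      using a r by (simp add: L.loc_precomp_zz_class L.cmp_in L.zz_class_eq_iff)
  qed (rule inv)
  have "bij_betw (A.act p) (loc_hom C W Y Z) (loc_hom C W X Z)"
    by (rule A.act_bij[OF pq])
  moreover have "A.act p e = loc_precomp C W X Y Z f e" if "e \<in> loc_hom C W Y Z" for e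
    using A.act_zz_equiv[OF pf that] by simp
  ultimately show ?thesis by (simp cong: bij_betw_cong)
qed

section \<open>Germs\<close>

lemma restr_in:
  "is_presheaf F \<Longrightarrow> complex_space U \<Longrightarrow> complex_space V \<Longrightarrow> f \<in> hol_maps U V \<Longrightarrow> s \<in> sections F V \<Longrightarrow>
    restr F U V f s \<in> sections F U"
  unfolding is_presheaf_def by blast

lemma restr_incl: "is_presheaf F \<Longrightarrow> complex_space U \<Longrightarrow> s \<in> sections F U \<Longrightarrow> restr F U U (incl (points U)) s = s"
  unfolding is_presheaf_def by blast

lemma restr_compose:
  "is_presheaf F \<Longrightarrow> complex_space U \<Longrightarrow> complex_space V \<Longrightarrow> complex_space W \<Longrightarrow>
    f \<in> hol_maps U V \<Longrightarrow> g \<in> hol_maps V W \<Longrightarrow> s \<in> sections F W \<Longrightarrow>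
    restr F U W (compose (points U) g f) s = restr F U V f (restr F V W g s)"
  unfolding is_presheaf_def by blast

lemma natural_in: "natural F G \<phi> \<Longrightarrow> complex_space U \<Longrightarrow> s \<in> sections F U \<Longrightarrow> \<phi> U s \<in> sections G U"
  unfolding natural_def by blast

lemma natural_restr:
  "natural F G \<phi> \<Longrightarrow> complex_space U \<Longrightarrow> complex_space V \<Longrightarrow> f \<in> hol_maps U V \<Longrightarrow> s \<in> sections F V \<Longrightarrow>
    \<phi> U (restr F U V f s) = restr G U V f (\<phi> V s)"
  unfolding natural_def by blast

lemma natural_restr_open:
  assumes "natural F G \<phi>" "complex_space U" "openin (ctop U) V" "openin (ctop U) W" "W \<subseteq> V" "s \<in> sections F (U \<restriction>\<^sub>o V)"
  shows "\<phi> (U \<restriction>\<^sub>o W) (restr_open F U W V s) = restr_open G U W V (\<phi> (U \<restriction>\<^sub>o V) s)"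
  unfolding restr_open_def using assms
  by (intro natural_restr[of F G]) (auto intro: complex_space_open_sub hol_maps_incl)

text \<open>Pullback along \<open>f\<close> of a section over an open part \<open>W\<close> of the
  target; the result lives over the preimage of \<open>W\<close>. On germs this is the inverse
  image, and the restriction maps of a sheafification are built from it.\<close>

definition pull :: "('p, 'v) presheaf \<Rightarrow> 'p cspace \<Rightarrow> 'p cspace \<Rightarrow> ('p \<Rightarrow> 'p) \<Rightarrow> 'p set \<Rightarrow> 'v \<Rightarrow> 'v" where
  "pull F U V f W s = restr F (U \<restriction>\<^sub>o {x\<in>points U. f x \<in> W}) (V \<restriction>\<^sub>o W) (restrict f {x\<in>points U. f x \<in> W}) s"

locale presheaf_on =
  fixes F :: "('p, 'v) presheaf" and U :: "'p cspace"
  assumes presheaf: "is_presheaf F" and space: "complex_space U"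
begin

lemma restr_open_in:
  assumes "openin (ctop U) V" "openin (ctop U) W" "W \<subseteq> V" "s \<in> sections F (U \<restriction>\<^sub>o V)"
  shows "restr_open F U W V s \<in> sections F (U \<restriction>\<^sub>o W)"
  unfolding restr_open_def using assms space presheaf
  by (intro restr_in[of F]) (auto intro: complex_space_open_sub hol_maps_incl)

lemma restr_open_self:
  assumes "openin (ctop U) V" "s \<in> sections F (U \<restriction>\<^sub>o V)"
  shows "restr_open F U V V s = s"
  using restr_incl[OF presheaf complex_space_open_sub[OF space assms(1)] assms(2)] assms(1)
  by (simp add: restr_open_def points_open_sub_openin)

lemma restr_open_trans:
  assumes "openin (ctop U) V" "openin (ctop U) W" "openin (ctop U) W'" "W \<subseteq> V" "W' \<subseteq> W"
    "s \<in> sections F (U \<restriction>\<^sub>o V)"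
  shows "restr_open F U W' W (restr_open F U W V s) = restr_open F U W' V s"
proof -
  have "compose (points (U \<restriction>\<^sub>o W')) (incl W) (incl W') = incl W'"
    unfolding compose_incl[OF assms(3)] using assms(5) by (simp add: incl_def restrict_restrict inf.absorb2)
  then show ?thesis
    unfolding restr_open_def using assms space
    by (subst restr_compose[OF presheaf, symmetric]) (auto intro: complex_space_open_sub hol_maps_incl)
qed

text \<open>The relation in \<open>germ\<close> is transitive: two agreements are compared on the
  intersection of their neighbourhoods. Hence germs are genuine equivalence classes.\<close>

lemma germ_eq_iff:
  assumes V: "V \<in> nbhds U u" "s \<in> sections F (U \<restriction>\<^sub>o V)" and V': "V' \<in> nbhds U u" "s' \<in> sections F (U \<restriction>\<^sub>o V')"
  shows "germ F U u V s = germ F U u V' s' \<longleftrightarrow>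
    (\<exists>W\<in>nbhds U u. W \<subseteq> V \<inter> V' \<and> restr_open F U W V s = restr_open F U W V' s')"
    (is "_ \<longleftrightarrow> ?A")
proof
  assume eq: "germ F U u V s = germ F U u V' s'"
  have "(V', s') \<in> germ F U u V' s'" using V' by (auto simp: germ_def)
  then have "(V', s') \<in> germ F U u V s" by (simp only: eq)
  then show ?A unfolding germ_def by blast
next
  have *: "germ F U u V s \<subseteq> germ F U u V' s'"
    if V: "V \<in> nbhds U u" "s \<in> sections F (U \<restriction>\<^sub>o V)" and V': "V' \<in> nbhds U u" "s' \<in> sections F (U \<restriction>\<^sub>o V')"
      and W: "W \<in> nbhds U u" "W \<subseteq> V \<inter> V'" "restr_open F U W V s = restr_open F U W V' s'"
    for V s V' s' W
  proof
    fix c assume "c \<in> germ F U u V s"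
    then obtain T t N where c: "c = (T, t)" "T \<in> nbhds U u" "t \<in> sections F (U \<restriction>\<^sub>o T)" and
      N: "N \<in> nbhds U u" "N \<subseteq> V \<inter> T" "restr_open F U N V s = restr_open F U N T t"
      unfolding germ_def by blast
    have M: "N \<inter> W \<in> nbhds U u" using N W by (intro nbhds_Int)
    note o = nbhdsD(1)[OF V(1)] nbhdsD(1)[OF V'(1)] nbhdsD(1)[OF c(2)] nbhdsD(1)[OF N(1)] nbhdsD(1)[OF W(1)] nbhdsD(1)[OF M]
    have "restr_open F U (N \<inter> W) V' s' = restr_open F U (N \<inter> W) W (restr_open F U W V' s')"
      using o W V' by (subst restr_open_trans) auto
    also have "\<dots> = restr_open F U (N \<inter> W) V s"
      unfolding W(3)[symmetric] using o W V by (subst restr_open_trans) auto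
    also have "\<dots> = restr_open F U (N \<inter> W) N (restr_open F U N V s)"
      using o N V by (subst restr_open_trans) auto
    also have "\<dots> = restr_open F U (N \<inter> W) T t"
      unfolding N(3) using o N c by (subst restr_open_trans) auto
    finally have "restr_open F U (N \<inter> W) V' s' = restr_open F U (N \<inter> W) T t" .
    moreover have "N \<inter> W \<subseteq> V' \<inter> T" using N W by blast
    ultimately show "c \<in> germ F U u V' s'"
      using c(2,3) M unfolding c(1) germ_def by blast
  qed
  assume ?A
  then obtain W where W: "W \<in> nbhds U u" "W \<subseteq> V \<inter> V'" "restr_open F U W V s = restr_open F U W V' s'"
    by blast
  show "germ F U u V s = germ F U u V' s'"
    using *[OF V V' W] *[OF V' V W(1)] W(2,3) by (simp add: Int_commute subset_antisym)
qed

lemma germ_restr_open: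
  assumes "V \<in> nbhds U u" "W \<in> nbhds U u" "W \<subseteq> V" "s \<in> sections F (U \<restriction>\<^sub>o V)"
  shows "germ F U u W (restr_open F U W V s) = germ F U u V s"
proof -
  note o = nbhdsD(1)[OF assms(1)] nbhdsD(1)[OF assms(2)]
  have r: "restr_open F U W V s \<in> sections F (U \<restriction>\<^sub>o W)" using o assms by (intro restr_open_in)
  have "restr_open F U W W (restr_open F U W V s) = restr_open F U W V s" by (rule restr_open_self[OF o(2) r])
  then show ?thesis
    using assms by (subst germ_eq_iff[OF assms(2) r assms(1,4)]) blast
qed

lemma germ_eq_restr_open:
  assumes V: "V \<in> nbhds U u" "s \<in> sections F (U \<restriction>\<^sub>o V)" and V': "V' \<in> nbhds U u" "s' \<in> sections F (U \<restriction>\<^sub>o V')"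
    and eq: "germ F U u V s = germ F U u V' s'"
  obtains W where "W \<in> nbhds U u" "W \<subseteq> V" "W \<subseteq> V'" "restr_open F U W V s = restr_open F U W V' s'"
  using germ_eq_iff[OF V V'] eq by blast

lemma germ_eq_near:
  assumes V: "V \<in> nbhds U u" "s \<in> sections F (U \<restriction>\<^sub>o V)" and V': "V' \<in> nbhds U u" "s' \<in> sections F (U \<restriction>\<^sub>o V')"
    and eq: "germ F U u V s = germ F U u V' s'"
  obtains W where "W \<in> nbhds U u" "W \<subseteq> V" "W \<subseteq> V'" "\<And>v. v \<in> W \<Longrightarrow> germ F U v V s = germ F U v V' s'"
proof -
  obtain W where W: "W \<in> nbhds U u" "W \<subseteq> V \<inter> V'" "restr_open F U W V s = restr_open F U W V' s'"
    using germ_eq_iff[OF V V'] eq by blast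
  moreover have "germ F U v V s = germ F U v V' s'" if "v \<in> W" for v
    using W that V V' by (subst germ_eq_iff) (auto simp: nbhds_def intro!: exI[of _ W])
  ultimately show ?thesis using that by blast
qed

lemma germ_self: "V \<in> nbhds U u \<Longrightarrow> s \<in> sections F (U \<restriction>\<^sub>o V) \<Longrightarrow> (V, s) \<in> germ F U u V s"
  by (auto simp: germ_def)

lemma germ_eq_if_mem:
  assumes "V \<in> nbhds U u" "s \<in> sections F (U \<restriction>\<^sub>o V)" "(V', s') \<in> germ F U u V s"
  shows "V' \<in> nbhds U u" "s' \<in> sections F (U \<restriction>\<^sub>o V')" "germ F U u V' s' = germ F U u V s"
proof -
  show *: "V' \<in> nbhds U u" "s' \<in> sections F (U \<restriction>\<^sub>o V')" using assms(3) by (auto simp: germ_def)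
  have "germ F U u V s = germ F U u V' s'"
    using assms(3) by (subst germ_eq_iff[OF assms(1,2) *]) (auto simp: germ_def)
  then show "germ F U u V' s' = germ F U u V s" ..
qed

text \<open>The germ formed in the open subspace is in general a smaller set, as it contains only
  neighbourhoods inside \<open>N\<close>; so it is equality of germs that is transferred, not the
  germs themselves.\<close>

lemma germ_eq_open_sub:
  assumes V: "V \<in> nbhds U u" "s \<in> sections F (U \<restriction>\<^sub>o V)" and V': "V' \<in> nbhds U u" "s' \<in> sections F (U \<restriction>\<^sub>o V')"
    and N: "openin (ctop U) N" "V \<subseteq> N" "V' \<subseteq> N"
  shows "germ F (U \<restriction>\<^sub>o N) u V s = germ F (U \<restriction>\<^sub>o N) u V' s' \<longleftrightarrow> germ F U u V s = germ F U u V' s'"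
proof -
  interpret N: presheaf_on F "U \<restriction>\<^sub>o N" using presheaf space N(1) by unfold_locales (auto intro: complex_space_open_sub)
  have "restr_open F (U \<restriction>\<^sub>o N) W V s = restr_open F U W V s" if "W \<subseteq> V" "V \<subseteq> N" for W V s
    using that by (simp add: restr_open_def open_sub_open_sub subset_trans)
  then have "(restr_open F (U \<restriction>\<^sub>o N) W V s = restr_open F (U \<restriction>\<^sub>o N) W V' s') =
      (restr_open F U W V s = restr_open F U W V' s')" if "W \<subseteq> V \<inter> V'" for W
    using that N by simp
  moreover have nb: "nbhds (U \<restriction>\<^sub>o N) u = {W \<in> nbhds U u. W \<subseteq> N}" by (rule nbhds_open_sub[OF N(1)])
  have "germ F (U \<restriction>\<^sub>o N) u V s = germ F (U \<restriction>\<^sub>o N) u V' s' \<longleftrightarrow>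
      (\<exists>W\<in>nbhds (U \<restriction>\<^sub>o N) u. W \<subseteq> V \<inter> V' \<and> restr_open F (U \<restriction>\<^sub>o N) W V s = restr_open F (U \<restriction>\<^sub>o N) W V' s')"
    using V V' N by (intro N.germ_eq_iff) (simp_all add: nb open_sub_open_sub)
  ultimately show ?thesis
    using N unfolding germ_eq_iff[OF V V'] nb by auto
qed

end

lemma restr_open_points:
  assumes "presheaf_on F U" "y \<in> sections F U" "openin (ctop U) N"
  shows "restr_open F U N (points U) y \<in> sections F (U \<restriction>\<^sub>o N)"
  using presheaf_on.restr_open_in[OF assms(1), of "points U" N y] assms openin_subset by auto

section \<open>Sections of a sheaf as families of germs\<close>

locale sheaf_on =
  fixes F :: "('p, 'v) presheaf" and U :: "'p cspace"
  assumes sheaf: "is_sheaf F" and sheaf_space: "complex_space U"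

sublocale sheaf_on \<subseteq> presheaf_on
  using sheaf sheaf_space by unfold_locales (auto simp: is_sheaf_def)

context sheaf_on
begin

lemma glue:
  assumes "\<forall>V\<in>\<V>. openin (ctop U) V" "\<Union>\<V> = points U" "\<forall>V\<in>\<V>. s V \<in> sections F (U \<restriction>\<^sub>o V)"
    "\<forall>V\<in>\<V>. \<forall>V'\<in>\<V>. restr_open F U (V \<inter> V') V (s V) = restr_open F U (V \<inter> V') V' (s V')"
  shows "\<exists>!t. t \<in> sections F U \<and> (\<forall>V\<in>\<V>. restr_open F U V (points U) t = s V)"
  using sheaf sheaf_space assms unfolding is_sheaf_def by presburger

text \<open>The restrictions of \<open>y\<close> form a compatible family, and the uniqueness half
  of gluing is applied to it.\<close>

lemma separated:
  assumes cov: "\<forall>V\<in>\<V>. openin (ctop U) V" "\<Union>\<V> = points U" and y: "y \<in> sections F U" "y' \<in> sections F U"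
    and eq: "\<forall>V\<in>\<V>. restr_open F U V (points U) y = restr_open F U V (points U) y'"
  shows "y = y'"
proof -
  have P: "presheaf_on F U" ..
  have "\<exists>!t. t \<in> sections F U \<and> (\<forall>V\<in>\<V>. restr_open F U V (points U) t = restr_open F U V (points U) y)"
  proof (intro glue cov ballI)
    show "restr_open F U V (points U) y \<in> sections F (U \<restriction>\<^sub>o V)" if "V \<in> \<V>" for V
      using cov(1) that by (intro restr_open_points[OF P y(1)]) blast
    show "restr_open F U (V \<inter> V') V (restr_open F U V (points U) y) =
        restr_open F U (V \<inter> V') V' (restr_open F U V' (points U) y)" if V: "V \<in> \<V>" "V' \<in> \<V>" for V V'
    proof -
      have "restr_open F U (V \<inter> V') T (restr_open F U T (points U) y) = restr_open F U (V \<inter> V') (points U) y"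
        if "T \<in> {V, V'}" for T
        using cov that y(1) V by (intro restr_open_trans) auto
      then show ?thesis by simp
    qed
  qed
  then show ?thesis using y eq by metis
qed

lemma section_eqI:
  assumes y: "y \<in> sections F U" "y' \<in> sections F U"
    and eq: "\<And>u. u \<in> points U \<Longrightarrow> germ F U u (points U) y = germ F U u (points U) y'"
  shows "y = y'"
proof -
  let ?V = "{N. openin (ctop U) N \<and> restr_open F U N (points U) y = restr_open F U N (points U) y'}"
  have "\<exists>N\<in>?V. u \<in> N" if u: "u \<in> points U" for u
  proof -
    have y': "y \<in> sections F (U \<restriction>\<^sub>o points U)" "y' \<in> sections F (U \<restriction>\<^sub>o points U)" using y by simp_all
    obtain N where "N \<in> nbhds U u" "restr_open F U N (points U) y = restr_open F U N (points U) y'"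
      by (rule germ_eq_restr_open[OF nbhds_points[OF u] y'(1) nbhds_points[OF u] y'(2) eq[OF u]]) (rule that)
    then show ?thesis using nbhdsD(1,2)[of N U u] by blast
  qed
  then have "\<Union>?V = points U" using openin_subset by blast
  then show ?thesis using y by (intro separated[of ?V]) auto
qed

text \<open>The cover consists of all open sets on which some section realizes
  \<open>\<sigma>\<close>. Sections chosen on two members have equal germs on the overlap, hence
  agree there. Maps into a sheaf are later constructed from prescribed germs in this way.\<close>

lemma section_of_germs:
  assumes loc: "\<And>u. u \<in> points U \<Longrightarrow> \<exists>N\<in>nbhds U u. \<exists>y\<in>sections F (U \<restriction>\<^sub>o N). \<forall>v\<in>N. germ F U v N y = \<sigma> v"
  obtains y where "y \<in> sections F U" "\<And>u. u \<in> points U \<Longrightarrow> germ F U u (points U) y = \<sigma> u"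
proof -
  let ?good = "\<lambda>N y. y \<in> sections F (U \<restriction>\<^sub>o N) \<and> (\<forall>v\<in>N. germ F U v N y = \<sigma> v)"
  define \<V> where "\<V> = {N. openin (ctop U) N \<and> Ex (?good N)}"
  define s where "s N = Eps (?good N)" for N
  have s: "openin (ctop U) N" "s N \<in> sections F (U \<restriction>\<^sub>o N)" "\<And>v. v \<in> N \<Longrightarrow> germ F U v N (s N) = \<sigma> v" if "N \<in> \<V>" for N
    using that someI_ex[of "?good N"] unfolding \<V>_def s_def by blast+
  have cov: "\<Union>\<V> = points U"
  proof
    show "\<Union>\<V> \<subseteq> points U" using s(1) openin_subset by blast
    show "points U \<subseteq> \<Union>\<V>"
    proof
      fix u assume "u \<in> points U"
      then obtain N where "N \<in> nbhds U u" "Ex (?good N)" using loc by blast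
      then show "u \<in> \<Union>\<V>" using nbhdsD(1,2)[of N U u] unfolding \<V>_def by blast
    qed
  qed
  have "restr_open F U (V \<inter> V') V (s V) = restr_open F U (V \<inter> V') V' (s V')" if V: "V \<in> \<V>" "V' \<in> \<V>" for V V'
  proof -
    let ?N = "V \<inter> V'"
    have N: "openin (ctop U) ?N" using s(1) V by blast
    \<comment> \<open>The overlap is regarded as a space of its own, so that
      \<open>section_eqI\<close> applies; germs in it are compared with germs in \<open>U\<close> by
      \<open>germ_eq_open_sub\<close>.\<close>
    interpret N: sheaf_on F "U \<restriction>\<^sub>o ?N"
      using sheaf sheaf_space N by unfold_locales (auto intro: complex_space_open_sub)
    have P: "points (U \<restriction>\<^sub>o ?N) = ?N" using N by (rule points_open_sub_openin)
    have in1: "restr_open F U ?N V (s V) \<in> sections F (U \<restriction>\<^sub>o ?N)" and in2: "restr_open F U ?N V' (s V') \<in> sections F (U \<restriction>\<^sub>o ?N)"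
      using s V N by (auto intro: restr_open_in)
    show ?thesis
    proof (rule N.section_eqI[OF in1 in2])
      fix u assume "u \<in> points (U \<restriction>\<^sub>o ?N)"
      then have u: "u \<in> V" "u \<in> V'" using P by auto
      have nb: "V \<in> nbhds U u" "V' \<in> nbhds U u" "?N \<in> nbhds U u" using s(1) V u N by (auto simp: nbhds_def)
      have "germ F U u ?N (restr_open F U ?N V (s V)) = germ F U u ?N (restr_open F U ?N V' (s V'))"
        using nb s(2)[OF V(1)] s(2)[OF V(2)] s(3)[OF V(1) u(1)] s(3)[OF V(2) u(2)] by (simp add: germ_restr_open)
      then show "germ F (U \<restriction>\<^sub>o ?N) u (points (U \<restriction>\<^sub>o ?N)) (restr_open F U ?N V (s V)) =
          germ F (U \<restriction>\<^sub>o ?N) u (points (U \<restriction>\<^sub>o ?N)) (restr_open F U ?N V' (s V'))"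
        unfolding P using nb in1 in2 N by (subst germ_eq_open_sub) auto
    qed
  qed
  then obtain t where t: "t \<in> sections F U" "\<And>V. V \<in> \<V> \<Longrightarrow> restr_open F U V (points U) t = s V"
    using glue[OF _ cov, of s] s by blast
  have "germ F U u (points U) t = \<sigma> u" if u: "u \<in> points U" for u
  proof -
    obtain N where N: "N \<in> \<V>" "u \<in> N" using cov u by blast
    have "germ F U u (points U) t = germ F U u N (restr_open F U N (points U) t)"
      using s(1)[OF N(1)] N u t(1) openin_subset nbhds_points[OF u]
      by (subst germ_restr_open) (auto simp: nbhds_def)
    then show ?thesis using t(2) s(3) N by simp
  qed
  then show ?thesis using that t by blast
qed

end

section \<open>Effect of holomorphic maps and of natural maps on germs\<close>

lemma pull_in:
  assumes F: "is_presheaf F" and U: "complex_space U" and V: "complex_space V" and f: "f \<in> hol_maps U V"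
    and W: "openin (ctop V) W" and s: "s \<in> sections F (V \<restriction>\<^sub>o W)"
  shows "pull F U V f W s \<in> sections F (U \<restriction>\<^sub>o {x\<in>points U. f x \<in> W})"
  unfolding pull_def using F U V f W s hol_mapsD(5)[OF f W]
  by (intro restr_in[of F]) (auto intro!: hol_maps_restrict complex_space_open_sub)

lemma pull_restr_open:
  assumes F: "is_presheaf F" and U: "complex_space U" and V: "complex_space V" and f: "f \<in> hol_maps U V"
    and W: "openin (ctop V) W" and Z: "openin (ctop V) Z" "W \<subseteq> Z" and s: "s \<in> sections F (V \<restriction>\<^sub>o Z)"
  shows "pull F U V f W (restr_open F V W Z s) =
    restr_open F U {x\<in>points U. f x \<in> W} {x\<in>points U. f x \<in> Z} (pull F U V f Z s)"
proof -
  let ?W = "{x\<in>points U. f x \<in> W}" and ?Z = "{x\<in>points U. f x \<in> Z}"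
  have o: "openin (ctop U) ?W" "openin (ctop U) ?Z" "?W \<subseteq> ?Z" using hol_mapsD(5)[OF f] W Z by auto
  have c: "complex_space (U \<restriction>\<^sub>o ?W)" "complex_space (U \<restriction>\<^sub>o ?Z)" "complex_space (V \<restriction>\<^sub>o W)" "complex_space (V \<restriction>\<^sub>o Z)"
    using U V W Z o by (auto intro: complex_space_open_sub)
  have h: "restrict f ?W \<in> hol_maps (U \<restriction>\<^sub>o ?W) (V \<restriction>\<^sub>o W)" "restrict f ?Z \<in> hol_maps (U \<restriction>\<^sub>o ?Z) (V \<restriction>\<^sub>o Z)"
    using U V f W Z o by (auto intro!: hol_maps_restrict)
  have i: "incl W \<in> hol_maps (V \<restriction>\<^sub>o W) (V \<restriction>\<^sub>o Z)" "incl ?W \<in> hol_maps (U \<restriction>\<^sub>o ?W) (U \<restriction>\<^sub>o ?Z)"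
    using U V W Z o by (auto intro!: hol_maps_incl)
  have "compose (points (U \<restriction>\<^sub>o ?W)) (incl W) (restrict f ?W) = compose (points (U \<restriction>\<^sub>o ?W)) (restrict f ?Z) (incl ?W)"
    using o(3) by (auto simp: fun_eq_iff restrict_def points_open_sub_openin[OF o(1)] compose_def incl_def)
  then show ?thesis
    unfolding pull_def restr_open_def
    using restr_compose[OF F c(1,3,4) h(1) i(1) s] restr_compose[OF F c(1,2,4) i(2) h(2) s] by simp
qed

lemma germ_pull:
  assumes F: "is_presheaf F" and U: "complex_space U" and V: "complex_space V" and f: "f \<in> hol_maps U V" and u: "u \<in> points U"
    and W: "W \<in> nbhds V (f u)" "s \<in> sections F (V \<restriction>\<^sub>o W)" and W': "W' \<in> nbhds V (f u)" "s' \<in> sections F (V \<restriction>\<^sub>o W')"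
    and eq: "germ F V (f u) W s = germ F V (f u) W' s'"
  shows "germ F U u {x\<in>points U. f x \<in> W} (pull F U V f W s) = germ F U u {x\<in>points U. f x \<in> W'} (pull F U V f W' s')"
proof -
  interpret U: presheaf_on F U using F U by unfold_locales
  interpret V: presheaf_on F V using F V by unfold_locales
  obtain N where N: "N \<in> nbhds V (f u)" "N \<subseteq> W" "N \<subseteq> W'" "restr_open F V N W s = restr_open F V N W' s'"
    using V.germ_eq_restr_open[OF W W' eq] by blast
  have eq': "restr_open F U {x\<in>points U. f x \<in> N} {x\<in>points U. f x \<in> W} (pull F U V f W s) =
      restr_open F U {x\<in>points U. f x \<in> N} {x\<in>points U. f x \<in> W'} (pull F U V f W' s')"
    using pull_restr_open[OF F U V f nbhdsD(1)[OF N(1)] nbhdsD(1)[OF W(1)] N(2) W(2)]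
      pull_restr_open[OF F U V f nbhdsD(1)[OF N(1)] nbhdsD(1)[OF W'(1)] N(3) W'(2)]
    by (simp only: N(4))
  have p: "pull F U V f W s \<in> sections F (U \<restriction>\<^sub>o {x\<in>points U. f x \<in> W})" "pull F U V f W' s' \<in> sections F (U \<restriction>\<^sub>o {x\<in>points U. f x \<in> W'})"
    using W W' nbhdsD(1)[OF W(1)] nbhdsD(1)[OF W'(1)] by (auto intro: pull_in[OF F U V f])
  have "{x\<in>points U. f x \<in> N} \<subseteq> {x\<in>points U. f x \<in> W} \<inter> {x\<in>points U. f x \<in> W'}" using N by blast
  then show ?thesis
    unfolding U.germ_eq_iff[OF nbhds_vimage[OF f u W(1)] p(1) nbhds_vimage[OF f u W'(1)] p(2)]
    using eq' nbhds_vimage[OF f u N(1)] by blast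
qed

lemma germ_natural:
  assumes F: "is_presheaf F" and G: "is_presheaf G" and U: "complex_space U" and nat: "natural F G \<phi>"
    and V: "V \<in> nbhds U u" "s \<in> sections F (U \<restriction>\<^sub>o V)" and V': "V' \<in> nbhds U u" "s' \<in> sections F (U \<restriction>\<^sub>o V')"
    and eq: "germ F U u V s = germ F U u V' s'"
  shows "germ G U u V (\<phi> (U \<restriction>\<^sub>o V) s) = germ G U u V' (\<phi> (U \<restriction>\<^sub>o V') s')"
proof -
  interpret F: presheaf_on F U using F U by unfold_locales
  interpret G: presheaf_on G U using G U by unfold_locales
  obtain N where N: "N \<in> nbhds U u" "N \<subseteq> V" "N \<subseteq> V'" "restr_open F U N V s = restr_open F U N V' s'"
    using F.germ_eq_restr_open[OF V V' eq] by blast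
  have "restr_open G U N V (\<phi> (U \<restriction>\<^sub>o V) s) = restr_open G U N V' (\<phi> (U \<restriction>\<^sub>o V') s')"
    using natural_restr_open[OF nat U nbhdsD(1)[OF V(1)] nbhdsD(1)[OF N(1)] N(2) V(2)]
      natural_restr_open[OF nat U nbhdsD(1)[OF V'(1)] nbhdsD(1)[OF N(1)] N(3) V'(2)]
    by (simp only: N(4))
  moreover have p: "\<phi> (U \<restriction>\<^sub>o V) s \<in> sections G (U \<restriction>\<^sub>o V)" "\<phi> (U \<restriction>\<^sub>o V') s' \<in> sections G (U \<restriction>\<^sub>o V')"
    using V V' nbhdsD(1)[OF V(1)] nbhdsD(1)[OF V'(1)] U
    by (auto intro: natural_in[OF nat] complex_space_open_sub)
  ultimately show ?thesis
    unfolding G.germ_eq_iff[OF V(1) p(1) V'(1) p(2)] using N by blast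
qed

text \<open>\<open>stalk_map\<close> is a union over all representatives of a germ; by
  \<open>germ_natural\<close> each contributes the same germ.\<close>

lemma stalk_map_germ:
  assumes F: "is_presheaf F" and G: "is_presheaf G" and U: "complex_space U" and nat: "natural F G \<phi>"
    and V: "V \<in> nbhds U u" "s \<in> sections F (U \<restriction>\<^sub>o V)"
  shows "stalk_map G U u \<phi> (germ F U u V s) = germ G U u V (\<phi> (U \<restriction>\<^sub>o V) s)"
proof -
  interpret F: presheaf_on F U using F U by unfold_locales
  have *: "germ G U u V' (\<phi> (U \<restriction>\<^sub>o V') s') = germ G U u V (\<phi> (U \<restriction>\<^sub>o V) s)" if "(V', s') \<in> germ F U u V s" for V' s'
    using germ_natural[OF F G U nat F.germ_eq_if_mem(1,2)[OF V that] V F.germ_eq_if_mem(3)[OF V that]] .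
  show ?thesis
  proof
    show "stalk_map G U u \<phi> (germ F U u V s) \<subseteq> germ G U u V (\<phi> (U \<restriction>\<^sub>o V) s)"
      unfolding stalk_map_def using * by (intro UN_least) (simp add: split_beta)
    show "germ G U u V (\<phi> (U \<restriction>\<^sub>o V) s) \<subseteq> stalk_map G U u \<phi> (germ F U u V s)"
      unfolding stalk_map_def using UN_upper[OF F.germ_self[OF V], of "\<lambda>(V, s). germ G U u V (\<phi> (U \<restriction>\<^sub>o V) s)"] by simp
  qed
qed

lemma pull_points:
  assumes "f \<in> hol_maps U V"
  shows "pull F U V f (points V) s = restr F U V f s"
proof -
  have "{x\<in>points U. f x \<in> points V} = points U" using hol_mapsD(4)[OF assms] by blast
  moreover have "restrict f (points U) = f" using hol_mapsD(1)[OF assms] by (rule extensional_restrict)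
  ultimately show ?thesis by (simp add: pull_def)
qed

lemma natural_pull:
  assumes "natural F G \<phi>" "complex_space U" "complex_space V" "f \<in> hol_maps U V" "openin (ctop V) W"
    "s \<in> sections F (V \<restriction>\<^sub>o W)"
  shows "\<phi> (U \<restriction>\<^sub>o {x\<in>points U. f x \<in> W}) (pull F U V f W s) = pull G U V f W (\<phi> (V \<restriction>\<^sub>o W) s)"
proof -
  note o = hol_mapsD(5)[OF assms(4,5)]
  have "restrict f {x\<in>points U. f x \<in> W} \<in> hol_maps (U \<restriction>\<^sub>o {x\<in>points U. f x \<in> W}) (V \<restriction>\<^sub>o W)"
    by (rule hol_maps_restrict[OF assms(2,4,5) o]) auto
  then show ?thesis
    unfolding pull_def
    by (rule natural_restr[OF assms(1) complex_space_open_sub[OF assms(2) o] complex_space_open_sub[OF assms(3,5)] _ assms(6)])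
qed

section \<open>Simplicial sheaves\<close>

lemma ssheaf_level: "is_ssheaf X \<Longrightarrow> is_sheaf (level X n)"
  unfolding is_ssheaf_def by blast

lemma sheaf_presheaf: "is_sheaf F \<Longrightarrow> is_presheaf F"
  unfolding is_sheaf_def by blast

lemma ssheaf_presheaf: "is_ssheaf X \<Longrightarrow> is_presheaf (level X n)"
  using ssheaf_level sheaf_presheaf by blast

lemma ssheaf_oper: "is_ssheaf X \<Longrightarrow> \<alpha> \<in> delta m n \<Longrightarrow> natural (level X n) (level X m) (oper X m n \<alpha>)"
  unfolding is_ssheaf_def by blast

lemma const_ss_simps [simp]: "level (const_ss F) n = F" "oper (const_ss F) m n \<alpha> U s = s"
  by (simp_all add: const_ss_def)

lemma is_ssheaf_const_ss:
  assumes "is_sheaf F"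
  shows "is_ssheaf (const_ss F)"
proof -
  have "natural F F (\<lambda>U s. s)" by (simp add: natural_def restr_in[OF sheaf_presheaf[OF assms]])
  then show ?thesis using assms unfolding is_ssheaf_def by (simp add: const_ss_def)
qed

lemma ss_hom_natural: "\<phi> \<in> ss_hom X Y \<Longrightarrow> natural (level X n) (level Y n) (\<phi> n)"
  unfolding ss_hom_def by blast

lemma ss_hom_oper:
  "\<phi> \<in> ss_hom X Y \<Longrightarrow> \<alpha> \<in> delta m n \<Longrightarrow> complex_space U \<Longrightarrow> s \<in> sections (level X n) U \<Longrightarrow>
    \<phi> m U (oper X m n \<alpha> U s) = oper Y m n \<alpha> U (\<phi> n U s)"
  unfolding ss_hom_def by blast

lemma norm_mor_apply: "complex_space U \<Longrightarrow> s \<in> sections (level X n) U \<Longrightarrow> norm_mor X \<phi> n U s = \<phi> n U s"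
  by (simp add: norm_mor_def)

lemma norm_mor_cong:
  assumes "\<And>n U s. complex_space U \<Longrightarrow> s \<in> sections (level X n) U \<Longrightarrow> \<phi> n U s = \<psi> n U s"
  shows "norm_mor X \<phi> = norm_mor X \<psi>"
  using assms by (auto simp: norm_mor_def fun_eq_iff restrict_def)

lemma ss_hom_eqI:
  assumes "\<phi> \<in> ss_hom X Y" "\<psi> \<in> ss_hom X Z"
    and "\<And>n U s. complex_space U \<Longrightarrow> s \<in> sections (level X n) U \<Longrightarrow> \<phi> n U s = \<psi> n U s"
  shows "\<phi> = \<psi>"
proof -
  have "\<phi> = norm_mor X \<phi>" using assms(1) unfolding ss_hom_def by simp
  also have "\<dots> = norm_mor X \<psi>" by (rule norm_mor_cong) (rule assms(3))
  also have "\<dots> = \<psi>" using assms(2) unfolding ss_hom_def by simp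
  finally show ?thesis .
qed

lemma norm_mor_in_ss_hom:
  assumes X: "is_ssheaf X"
    and nat: "\<And>n. natural (level X n) (level Y n) (\<phi> n)"
    and op: "\<And>m n \<alpha> U s. \<alpha> \<in> delta m n \<Longrightarrow> complex_space U \<Longrightarrow> s \<in> sections (level X n) U \<Longrightarrow>
        \<phi> m U (oper X m n \<alpha> U s) = oper Y m n \<alpha> U (\<phi> n U s)"
  shows "norm_mor X \<phi> \<in> ss_hom X Y"
proof -
  have "natural (level X n) (level Y n) (norm_mor X \<phi> n)" for n
    using nat[of n] restr_in[OF ssheaf_presheaf[OF X, of n]]
    by (simp add: natural_def norm_mor_apply Pi_iff)
  moreover have "norm_mor X (norm_mor X \<phi>) = norm_mor X \<phi>"
    by (rule norm_mor_cong) (simp add: norm_mor_apply)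
  moreover have "oper X m n \<alpha> U s \<in> sections (level X m) U"
    if "\<alpha> \<in> delta m n" "complex_space U" "s \<in> sections (level X n) U" for m n \<alpha> U s
    using natural_in[OF ssheaf_oper[OF X that(1)] that(2,3)] .
  ultimately show ?thesis
    unfolding ss_hom_def using op by (simp add: norm_mor_apply)
qed

lemma ss_id_in: "is_ssheaf X \<Longrightarrow> ss_id X \<in> ss_hom X X"
  unfolding ss_id_def by (rule norm_mor_in_ss_hom) (auto simp: natural_def)

lemma ss_comp_apply: "complex_space U \<Longrightarrow> s \<in> sections (level X n) U \<Longrightarrow> ss_comp X g f n U s = g n U (f n U s)"
  by (simp add: ss_comp_def norm_mor_apply)

lemma natural_comp:
  assumes f: "natural F G f" and g: "natural G H g"
  shows "natural F H (\<lambda>U s. g U (f U s))"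
  unfolding natural_def
proof (intro conjI allI impI funcsetI; (elim conjE)?)
  fix U s assume "complex_space U" "s \<in> sections F U"
  then show "g U (f U s) \<in> sections H U" by (intro natural_in[OF g] natural_in[OF f])
next
  fix U V h s assume a: "complex_space U" "complex_space V" "h \<in> hol_maps U V" "s \<in> sections F V"
  then show "g U (f U (restr F U V h s)) = restr H U V h (g V (f V s))"
    using natural_restr[OF g a(1-3) natural_in[OF f a(2,4)]] by (simp add: natural_restr[OF f])
qed

lemma ss_comp_in:
  assumes X: "is_ssheaf X" and f: "f \<in> ss_hom X Y" and g: "g \<in> ss_hom Y Z"
  shows "ss_comp X g f \<in> ss_hom X Z"
  unfolding ss_comp_def
proof (rule norm_mor_in_ss_hom[OF X])
  show "natural (level X n) (level Z n) (\<lambda>U s. g n U (f n U s))" for n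
    using ss_hom_natural[OF f] ss_hom_natural[OF g] by (rule natural_comp)
  show "g m U (f m U (oper X m n \<alpha> U s)) = oper Z m n \<alpha> U (g n U (f n U s))"
    if "\<alpha> \<in> delta m n" "complex_space U" "s \<in> sections (level X n) U" for m n \<alpha> U s
    using that natural_in[OF ss_hom_natural[OF f]] by (simp add: ss_hom_oper[OF f] ss_hom_oper[OF g])
qed

section \<open>Stalkwise path components\<close>

text \<open>Expressed by representatives rather than germs, so that the same two local sections can
  be compared at varying points \<open>u\<close>.\<close>

definition stalk_joined :: "('p, 'v) simplicial \<Rightarrow> 'p cspace \<Rightarrow> 'p \<Rightarrow> nat \<Rightarrow> 'p set \<Rightarrow> 'v \<Rightarrow> nat \<Rightarrow> 'p set \<Rightarrow> 'v \<Rightarrow> bool" where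
  "stalk_joined X U u n V s m W t \<longleftrightarrow>
     joined (stalk_sset X U u) n (germ (level X n) U u V s) m (germ (level X m) U u W t)"

definition local_section :: "('p, 'v) simplicial \<Rightarrow> 'p cspace \<Rightarrow> 'p \<Rightarrow> nat \<Rightarrow> 'p set \<Rightarrow> 'v \<Rightarrow> bool" where
  "local_section X U u n V s \<longleftrightarrow> V \<in> nbhds U u \<and> s \<in> sections (level X n) (U \<restriction>\<^sub>o V)"

lemma local_sectionD: "local_section X U u n V s \<Longrightarrow> V \<in> nbhds U u" "local_section X U u n V s \<Longrightarrow> s \<in> sections (level X n) (U \<restriction>\<^sub>o V)"
  by (simp_all add: local_section_def)

lemma local_section_other: "local_section X U u n V s \<Longrightarrow> v \<in> V \<Longrightarrow> local_section X U v n V s"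
  by (auto simp: local_section_def nbhds_def)

lemma stalk_simplices:
  "simplices (stalk_sset X U u) n = {germ (level X n) U u V s | V s. local_section X U u n V s}"
  by (simp add: stalk_sset_def stalk_def local_section_def)

lemma local_section_natural:
  assumes "natural (level X n) (level Y m) \<phi>" "complex_space U" "local_section X U u n V s"
  shows "local_section Y U u m V (\<phi> (U \<restriction>\<^sub>o V) s)"
  using assms natural_in[OF assms(1)] nbhdsD(1) by (metis complex_space_open_sub local_section_def)

lemma stalk_soper:
  assumes X: "is_ssheaf X" and U: "complex_space U" and \<alpha>: "\<alpha> \<in> delta m n" and s: "local_section X U u n V s"
  shows "soper (stalk_sset X U u) m n \<alpha> (germ (level X n) U u V s) = germ (level X m) U u V (oper X m n \<alpha> (U \<restriction>\<^sub>o V) s)"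
  using stalk_map_germ[OF ssheaf_presheaf[OF X] ssheaf_presheaf[OF X] U ssheaf_oper[OF X \<alpha>] local_sectionD[OF s]]
  by (simp add: stalk_sset_def)

lemma local_section_oper:
  "is_ssheaf X \<Longrightarrow> complex_space U \<Longrightarrow> \<alpha> \<in> delta m n \<Longrightarrow> local_section X U u n V s \<Longrightarrow>
    local_section X U u m V (oper X m n \<alpha> (U \<restriction>\<^sub>o V) s)"
  using local_section_natural ssheaf_oper by metis

lemma stalk_joined_refl: "local_section X U u n V s \<Longrightarrow> stalk_joined X U u n V s n V s"
  unfolding stalk_joined_def by (rule joined_refl) (auto simp: stalk_simplices)

lemma stalk_joined_sym: "stalk_joined X U u n V s m W t \<Longrightarrow> stalk_joined X U u m W t n V s"
  unfolding stalk_joined_def by (rule joined_sym)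

lemma stalk_joined_trans:
  "stalk_joined X U u n V s m W t \<Longrightarrow> stalk_joined X U u m W t l T r \<Longrightarrow> stalk_joined X U u n V s l T r"
  unfolding stalk_joined_def by (rule joined_trans)

lemma stalk_joined_cong:
  "stalk_joined X U u m W t l T r \<Longrightarrow> stalk_joined X U u n V s m W t = stalk_joined X U u n V s l T r"
  by (blast intro: stalk_joined_trans stalk_joined_sym)

lemma stalk_joined_oper:
  assumes "is_ssheaf X" "complex_space U" "\<alpha> \<in> delta m n" "local_section X U u n V s"
  shows "stalk_joined X U u m V (oper X m n \<alpha> (U \<restriction>\<^sub>o V) s) n V s"
  unfolding stalk_joined_def stalk_soper[OF assms, symmetric]
  using assms by (intro joined_oper) (auto simp: stalk_simplices)

text \<open>The induction principle for path components of a stalk. Invariance under equality of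
  germs lets \<open>R\<close> descend to a property \<open>Q\<close> of the simplices of the stalk,
  to which \<open>joined_invariant\<close> applies.\<close>

lemma stalk_joined_invariant:
  assumes X: "is_ssheaf X" and U: "complex_space U"
    and germ: "\<And>n V s V' s'. local_section X U u n V s \<Longrightarrow> local_section X U u n V' s' \<Longrightarrow>
      germ (level X n) U u V s = germ (level X n) U u V' s' \<Longrightarrow> R n V s \<Longrightarrow> R n V' s'"
    and op: "\<And>m n \<alpha> V s. \<alpha> \<in> delta m n \<Longrightarrow> local_section X U u n V s \<Longrightarrow> R m V (oper X m n \<alpha> (U \<restriction>\<^sub>o V) s) = R n V s"
    and j: "stalk_joined X U u n V s m W t" and s: "local_section X U u n V s" and t: "local_section X U u m W t"
    and R: "R n V s"
  shows "R m W t"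
proof -
  define Q where "Q n c \<longleftrightarrow> (\<exists>V s. local_section X U u n V s \<and> c = germ (level X n) U u V s \<and> R n V s)" for n c
  have Q_iff: "Q n (germ (level X n) U u V s) \<longleftrightarrow> R n V s" if s: "local_section X U u n V s" for n V s
  proof
    assume "Q n (germ (level X n) U u V s)"
    then obtain V' s' where s': "local_section X U u n V' s'" "R n V' s'"
        "germ (level X n) U u V s = germ (level X n) U u V' s'" unfolding Q_def by blast
    show "R n V s" by (rule germ[OF s'(1) s s'(3)[symmetric] s'(2)])
  next
    assume "R n V s"
    then show "Q n (germ (level X n) U u V s)" unfolding Q_def using s by blast
  qed
  have "Q m (germ (level X m) U u W t)"
  proof (rule joined_invariant[where K = "stalk_sset X U u" and Q = Q])
    fix m n \<alpha> c assume \<alpha>: "\<alpha> \<in> delta m n" and "c \<in> simplices (stalk_sset X U u) n"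
    then obtain V s where s: "local_section X U u n V s" and c: "c = germ (level X n) U u V s"
      by (auto simp: stalk_simplices)
    show "Q m (soper (stalk_sset X U u) m n \<alpha> c) = Q n c"
      unfolding c stalk_soper[OF X U \<alpha> s] Q_iff[OF s] Q_iff[OF local_section_oper[OF X U \<alpha> s]]
      by (rule op[OF \<alpha> s])
  next
    show "joined (stalk_sset X U u) n (germ (level X n) U u V s) m (germ (level X m) U u W t)"
      using j unfolding stalk_joined_def .
    show "Q n (germ (level X n) U u V s)" using Q_iff[OF s] R by blast
  qed (use s t in \<open>auto simp: stalk_simplices\<close>)
  then show ?thesis using Q_iff[OF t] by blast
qed

text \<open>A path in the realization of one stalk says nothing directly about other stalks. But
  being joined to \<open>s\<close> throughout some neighbourhood of \<open>u\<close> is a property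
  \<open>R\<close> stable under change of representative and under operators, so it spreads to
  everything joined to \<open>s\<close> at \<open>u\<close>.\<close>

lemma stalk_joined_near:
  assumes X: "is_ssheaf X" and U: "complex_space U" and j: "stalk_joined X U u n V s m W t"
    and s: "local_section X U u n V s" and t: "local_section X U u m W t"
  obtains N where "N \<in> nbhds U u" "N \<subseteq> V" "N \<subseteq> W" "\<And>v. v \<in> N \<Longrightarrow> stalk_joined X U v n V s m W t"
proof -
  define R where "R m W t \<longleftrightarrow> (\<exists>N\<in>nbhds U u. N \<subseteq> V \<inter> W \<and> (\<forall>v\<in>N. stalk_joined X U v n V s m W t))" for m W t
  have "R m W t"
  proof (rule stalk_joined_invariant[OF X U _ _ j s t, of R])
    fix m W t W' t'
    assume t: "local_section X U u m W t" and t': "local_section X U u m W' t'"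
      and eq: "germ (level X m) U u W t = germ (level X m) U u W' t'" and "R m W t"
    then obtain N where N: "N \<in> nbhds U u" "N \<subseteq> V \<inter> W" "\<forall>v\<in>N. stalk_joined X U v n V s m W t"
      unfolding R_def by blast
    interpret presheaf_on "level X m" U using ssheaf_presheaf[OF X] U by unfold_locales
    obtain M where M: "M \<in> nbhds U u" "M \<subseteq> W" "M \<subseteq> W'"
        "\<And>v. v \<in> M \<Longrightarrow> germ (level X m) U v W t = germ (level X m) U v W' t'"
      using germ_eq_near[OF local_sectionD[OF t] local_sectionD[OF t'] eq] by metis
    have "stalk_joined X U v n V s m W' t'" if "v \<in> N \<inter> M" for v
      using N(3) that M(4)[of v] unfolding stalk_joined_def by auto
    moreover have "N \<inter> M \<in> nbhds U u" using N M by (intro nbhds_Int)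
    moreover have "N \<inter> M \<subseteq> V \<inter> W'" using N M by blast
    ultimately show "R m W' t'" unfolding R_def by blast
  next
    fix k l \<alpha> W t assume \<alpha>: "\<alpha> \<in> delta k l" and t: "local_section X U u l W t"
    have "stalk_joined X U v k W (oper X k l \<alpha> (U \<restriction>\<^sub>o W) t) l W t" if "v \<in> W" for v
      using stalk_joined_oper[OF X U \<alpha> local_section_other[OF t that]] .
    then have "stalk_joined X U v n V s k W (oper X k l \<alpha> (U \<restriction>\<^sub>o W) t) = stalk_joined X U v n V s l W t" if "v \<in> W" for v
      using that by (intro stalk_joined_cong)
    then show "R k W (oper X k l \<alpha> (U \<restriction>\<^sub>o W) t) = R l W t"
      unfolding R_def by (intro bex_cong refl conj_cong ball_cong) auto
  next
    show "R n V s"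
      unfolding R_def using local_sectionD(1)[OF s] stalk_joined_refl[OF local_section_other[OF s]] by blast
  qed
  then show ?thesis using that unfolding R_def by blast
qed

text \<open>The induction principle is applied to the property of being joined to the pullback of
  \<open>s\<close> after pulling back; pullback respects germs and commutes with the
  operators.\<close>

lemma stalk_joined_pull:
  assumes X: "is_ssheaf X" and U: "complex_space U" and U': "complex_space U'" and f: "f \<in> hol_maps U' U"
    and u: "u \<in> points U'" and j: "stalk_joined X U (f u) n V s m W t"
    and s: "local_section X U (f u) n V s" and t: "local_section X U (f u) m W t"
  shows "stalk_joined X U' u n {x\<in>points U'. f x \<in> V} (pull (level X n) U' U f V s)
    m {x\<in>points U'. f x \<in> W} (pull (level X m) U' U f W t)"
proof -
  let ?f = "\<lambda>W. {x\<in>points U'. f x \<in> W}"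
  have ls: "local_section X U' u m (?f W) (pull (level X m) U' U f W t)" if "local_section X U (f u) m W t" for m W t
    using that nbhds_vimage[OF f u] pull_in[OF ssheaf_presheaf[OF X] U' U f nbhdsD(1)]
    unfolding local_section_def by blast
  show ?thesis
  proof (rule stalk_joined_invariant[OF X U _ _ j s t])
    fix l W t W' t'
    assume t: "local_section X U (f u) l W t" and t': "local_section X U (f u) l W' t'"
      and eq: "germ (level X l) U (f u) W t = germ (level X l) U (f u) W' t'"
      and j: "stalk_joined X U' u n (?f V) (pull (level X n) U' U f V s) l (?f W) (pull (level X l) U' U f W t)"
    show "stalk_joined X U' u n (?f V) (pull (level X n) U' U f V s) l (?f W') (pull (level X l) U' U f W' t')"
      using j unfolding stalk_joined_def
        germ_pull[OF ssheaf_presheaf[OF X] U' U f u local_sectionD[OF t] local_sectionD[OF t'] eq] .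
  next
    fix k l \<alpha> W t assume \<alpha>: "\<alpha> \<in> delta k l" and t: "local_section X U (f u) l W t"
    have "pull (level X k) U' U f W (oper X k l \<alpha> (U \<restriction>\<^sub>o W) t) =
        oper X k l \<alpha> (U' \<restriction>\<^sub>o ?f W) (pull (level X l) U' U f W t)"
      using natural_pull[OF ssheaf_oper[OF X \<alpha>] U' U f nbhdsD(1)[OF local_sectionD(1)[OF t]] local_sectionD(2)[OF t]] by simp
    then have "stalk_joined X U' u k (?f W) (pull (level X k) U' U f W (oper X k l \<alpha> (U \<restriction>\<^sub>o W) t))
        l (?f W) (pull (level X l) U' U f W t)"
      using stalk_joined_oper[OF X U' \<alpha> ls[OF t]] by simp
    then show "stalk_joined X U' u n (?f V) (pull (level X n) U' U f V s) k (?f W) (pull (level X k) U' U f W (oper X k l \<alpha> (U \<restriction>\<^sub>o W) t)) =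
        stalk_joined X U' u n (?f V) (pull (level X n) U' U f V s) l (?f W) (pull (level X l) U' U f W t)"
      by (rule stalk_joined_cong)
  next
    show "stalk_joined X U' u n (?f V) (pull (level X n) U' U f V s) n (?f V) (pull (level X n) U' U f V s)"
      by (rule stalk_joined_refl[OF ls[OF s]])
  qed
qed

text \<open>The operators of \<open>const_ss F\<close> are identities, so the germ of the value
  under \<open>g\<close> is unchanged by operators and the induction principle applies.\<close>

lemma stalk_joined_const:
  assumes X: "is_ssheaf X" and F: "is_sheaf F" and g: "g \<in> ss_hom X (const_ss F)" and U: "complex_space U"
    and j: "stalk_joined X U u n V s m W t" and s: "local_section X U u n V s" and t: "local_section X U u m W t"
  shows "germ F U u V (g n (U \<restriction>\<^sub>o V) s) = germ F U u W (g m (U \<restriction>\<^sub>o W) t)"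
proof (rule stalk_joined_invariant[OF X U _ _ j s t])
  fix l W t W' t'
  assume t: "local_section X U u l W t" "local_section X U u l W' t'"
    and eq: "germ (level X l) U u W t = germ (level X l) U u W' t'"
    and h: "germ F U u V (g n (U \<restriction>\<^sub>o V) s) = germ F U u W (g l (U \<restriction>\<^sub>o W) t)"
  have "natural (level X l) F (g l)" using ss_hom_natural[OF g, of l] by simp
  then show "germ F U u V (g n (U \<restriction>\<^sub>o V) s) = germ F U u W' (g l (U \<restriction>\<^sub>o W') t')"
    using germ_natural[OF ssheaf_presheaf[OF X] sheaf_presheaf[OF F] U _ local_sectionD[OF t(1)] local_sectionD[OF t(2)] eq] h
    by simp
next
  fix k l \<alpha> W t assume \<alpha>: "\<alpha> \<in> delta k l" and t: "local_section X U u l W t"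
  have "g k (U \<restriction>\<^sub>o W) (oper X k l \<alpha> (U \<restriction>\<^sub>o W) t) = g l (U \<restriction>\<^sub>o W) t"
    using ss_hom_oper[OF g \<alpha> complex_space_open_sub[OF U nbhdsD(1)[OF local_sectionD(1)[OF t]]] local_sectionD(2)[OF t]]
    by simp
  then show "(germ F U u V (g n (U \<restriction>\<^sub>o V) s) = germ F U u W (g k (U \<restriction>\<^sub>o W) (oper X k l \<alpha> (U \<restriction>\<^sub>o W) t))) =
      (germ F U u V (g n (U \<restriction>\<^sub>o V) s) = germ F U u W (g l (U \<restriction>\<^sub>o W) t))" by simp
qed simp

lemma simplicial_map_stalk:
  assumes X: "is_ssheaf X" and Y: "is_ssheaf Y" and f: "f \<in> ss_hom X Y" and U: "complex_space U"
  shows "simplicial_map (stalk_sset X U u) (stalk_sset Y U u) (\<lambda>n. stalk_map (level Y n) U u (f n))"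
proof -
  have eq: "stalk_map (level Y n) U u (f n) (germ (level X n) U u V s) = germ (level Y n) U u V (f n (U \<restriction>\<^sub>o V) s)"
    if "local_section X U u n V s" for n V s
    using stalk_map_germ[OF ssheaf_presheaf[OF X] ssheaf_presheaf[OF Y] U ss_hom_natural[OF f] local_sectionD[OF that]] .
  have ls: "local_section Y U u n V (f n (U \<restriction>\<^sub>o V) s)" if "local_section X U u n V s" for n V s
    using local_section_natural[OF ss_hom_natural[OF f] U that] .
  show ?thesis
    unfolding simplicial_map_def
  proof (intro conjI allI ballI funcsetI)
    fix n c assume "c \<in> simplices (stalk_sset X U u) n"
    then show "stalk_map (level Y n) U u (f n) c \<in> simplices (stalk_sset Y U u) n"
      unfolding stalk_simplices using eq ls by blast
  next
    fix m n \<alpha> c assume \<alpha>: "\<alpha> \<in> delta m n" and "c \<in> simplices (stalk_sset X U u) n"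
    then obtain V s where s: "local_section X U u n V s" and c: "c = germ (level X n) U u V s"
      by (auto simp: stalk_simplices)
    have "f m (U \<restriction>\<^sub>o V) (oper X m n \<alpha> (U \<restriction>\<^sub>o V) s) = oper Y m n \<alpha> (U \<restriction>\<^sub>o V) (f n (U \<restriction>\<^sub>o V) s)"
      using ss_hom_oper[OF f \<alpha> complex_space_open_sub[OF U nbhdsD(1)[OF local_sectionD(1)[OF s]]] local_sectionD(2)[OF s]] .
    then show "stalk_map (level Y m) U u (f m) (soper (stalk_sset X U u) m n \<alpha> c) =
        soper (stalk_sset Y U u) m n \<alpha> (stalk_map (level Y n) U u (f n) c)"
      by (simp add: c stalk_soper[OF X U \<alpha> s] stalk_soper[OF Y U \<alpha> ls[OF s]] eq[OF s] eq[OF local_section_oper[OF X U \<alpha> s]])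
  qed
qed

lemma swe_stalk_joined_reflect:
  assumes X: "is_ssheaf X" and Y: "is_ssheaf Y" and f: "f \<in> swe X Y" and U: "complex_space U"
    and s: "local_section X U u n V s" and t: "local_section X U u m W t"
    and j: "stalk_joined Y U u n V (f n (U \<restriction>\<^sub>o V) s) m W (f m (U \<restriction>\<^sub>o W) t)"
  shows "stalk_joined X U u n V s m W t"
proof -
  have f': "f \<in> ss_hom X Y" using f by (simp add: swe_def)
  have "u \<in> points U" using nbhdsD(4)[OF local_sectionD(1)[OF s]] .
  then have w: "sset_weak_equiv (stalk_sset X U u) (stalk_sset Y U u) (\<lambda>n. stalk_map (level Y n) U u (f n))"
    using f U by (simp add: swe_def)
  show ?thesis
    unfolding stalk_joined_def
    using j s t
    by (intro weak_equiv_joined_reflect[OF w simplicial_map_stalk[OF X Y f' U]])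
       (auto simp: stalk_simplices stalk_joined_def local_sectionD
         stalk_map_germ[OF ssheaf_presheaf[OF X] ssheaf_presheaf[OF Y] U ss_hom_natural[OF f']])
qed

lemma swe_stalk_joined_onto:
  assumes X: "is_ssheaf X" and Y: "is_ssheaf Y" and f: "f \<in> swe X Y" and U: "complex_space U"
    and s: "local_section Y U u n V s"
  obtains m W t where "local_section X U u m W t" "stalk_joined Y U u m W (f m (U \<restriction>\<^sub>o W) t) n V s"
proof -
  have f': "f \<in> ss_hom X Y" using f by (simp add: swe_def)
  have "u \<in> points U" using nbhdsD(4)[OF local_sectionD(1)[OF s]] .
  then have w: "sset_weak_equiv (stalk_sset X U u) (stalk_sset Y U u) (\<lambda>n. stalk_map (level Y n) U u (f n))"
    using f U by (simp add: swe_def)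
  have "germ (level Y n) U u V s \<in> simplices (stalk_sset Y U u) n" using s by (auto simp: stalk_simplices)
  then obtain m c where c: "c \<in> simplices (stalk_sset X U u) m"
      "joined (stalk_sset Y U u) m (stalk_map (level Y m) U u (f m) c) n (germ (level Y n) U u V s)"
    by (rule weak_equiv_joined_onto[OF w simplicial_map_stalk[OF X Y f' U]])
  then obtain W t where t: "local_section X U u m W t" "c = germ (level X m) U u W t"
    by (auto simp: stalk_simplices)
  have "stalk_joined Y U u m W (f m (U \<restriction>\<^sub>o W) t) n V s"
    using c(2) unfolding stalk_joined_def t(2)
      stalk_map_germ[OF ssheaf_presheaf[OF X] ssheaf_presheaf[OF Y] U ss_hom_natural[OF f'] local_sectionD[OF t(1)]] .
  then show ?thesis using that t by blast
qed

section \<open>Maps to discrete sheaves\<close>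

lemma const_hom_oper:
  "g \<in> ss_hom Y (const_ss F) \<Longrightarrow> \<alpha> \<in> delta m n \<Longrightarrow> complex_space U \<Longrightarrow> s \<in> sections (level Y n) U \<Longrightarrow>
    g m U (oper Y m n \<alpha> U s) = g n U s"
  by (simp add: ss_hom_oper)

lemma const_hom_natural: "g \<in> ss_hom Y (const_ss F) \<Longrightarrow> natural (level Y n) F (g n)"
  using ss_hom_natural by fastforce

lemma local_section_points:
  "u \<in> points U \<Longrightarrow> local_section X U u n (points U) s \<longleftrightarrow> s \<in> sections (level X n) U"
  by (simp add: local_section_def nbhds_points)

text \<open>Every germ of \<open>Y\<close> is joined to one that comes from \<open>X\<close>, and
  maps to a discrete sheaf are constant on path components. So the composite with \<open>f\<close>
  determines all germs of the values.\<close>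

lemma const_hom_swe_inj:
  assumes X: "is_ssheaf X" and Y: "is_ssheaf Y" and F: "is_sheaf F" and f: "f \<in> swe X Y"
  shows "inj_on (\<lambda>g. ss_comp X g f) (ss_hom Y (const_ss F))"
proof (rule inj_onI)
  fix g h assume g: "g \<in> ss_hom Y (const_ss F)" and h: "h \<in> ss_hom Y (const_ss F)"
    and eq: "ss_comp X g f = ss_comp X h f"
  have f': "f \<in> ss_hom X Y" using f by (simp add: swe_def)
  show "g = h"
  proof (rule ss_hom_eqI[OF g h])
    fix n U s assume U: "complex_space U" and s: "s \<in> sections (level Y n) U"
    interpret sheaf_on F U using F U by unfold_locales
    show "g n U s = h n U s"
    proof (rule section_eqI)
      fix u assume u: "u \<in> points U"
      have ls: "local_section Y U u n (points U) s" using s by (simp add: local_section_points[OF u])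
      then obtain m W t where t: "local_section X U u m W t"
          and j: "stalk_joined Y U u m W (f m (U \<restriction>\<^sub>o W) t) n (points U) s"
        by (rule swe_stalk_joined_onto[OF X Y f U])
      have ft: "local_section Y U u m W (f m (U \<restriction>\<^sub>o W) t)"
        using local_section_natural[OF ss_hom_natural[OF f'] U t] .
      have "g m (U \<restriction>\<^sub>o W) (f m (U \<restriction>\<^sub>o W) t) = h m (U \<restriction>\<^sub>o W) (f m (U \<restriction>\<^sub>o W) t)"
        using fun_cong[OF fun_cong[OF fun_cong[OF eq, of m], of "U \<restriction>\<^sub>o W"], of t]
        unfolding ss_comp_apply[OF complex_space_open_sub[OF U nbhdsD(1)[OF local_sectionD(1)[OF t]]] local_sectionD(2)[OF t]] .
      then show "germ F U u (points U) (g n U s) = germ F U u (points U) (h n U s)"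
        using stalk_joined_const[OF Y F g U j ft ls] stalk_joined_const[OF Y F h U j ft ls] by simp
    qed (use natural_in[OF const_hom_natural[OF g] U s] natural_in[OF const_hom_natural[OF h] U s] in auto)
  qed
qed

text \<open>The germ of the value on \<open>s\<close> is prescribed as the germ of \<open>k\<close>
  at any local section of \<open>X\<close> whose image is joined to \<open>s\<close>. Such sections
  exist and give one germ since \<open>f\<close> is bijective on path components; the prescribed
  germs glue since being joined persists nearby.\<close>

lemma const_hom_swe_surj:
  assumes X: "is_ssheaf X" and Y: "is_ssheaf Y" and F: "is_sheaf F" and f: "f \<in> swe X Y"
    and k: "k \<in> ss_hom X (const_ss F)"
  shows "\<exists>g\<in>ss_hom Y (const_ss F). ss_comp X g f = k"
proof -
  have f': "f \<in> ss_hom X Y" using f by (simp add: swe_def)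
  \<comment> \<open>A lift of \<open>s\<close> at \<open>u\<close> maps to the path component of
    \<open>s\<close> only, not to \<open>s\<close> itself, and may have a different level
    \<open>m\<close>.\<close>
  define lift where "lift U u n s m W t \<longleftrightarrow> local_section X U u m W t \<and>
      stalk_joined Y U u m W (f m (U \<restriction>\<^sub>o W) t) n (points U) s" for U u n s m W t
  define val where "val U n s y \<longleftrightarrow> y \<in> sections F U \<and> (\<forall>u\<in>points U. \<forall>m W t. lift U u n s m W t \<longrightarrow>
      germ F U u (points U) y = germ F U u W (k m (U \<restriction>\<^sub>o W) t))" for U n s y
  define g where "g n U s = Eps (val U n s)" for n U s
  have f_ls: "local_section Y U u m W (f m (U \<restriction>\<^sub>o W) t)" if "complex_space U" "local_section X U u m W t" for U u m W t
    using local_section_natural[OF ss_hom_natural[OF f'] that] .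
  have k_ls: "k m (U \<restriction>\<^sub>o W) t \<in> sections F (U \<restriction>\<^sub>o W)" if "complex_space U" "local_section X U u m W t" for U u m W t
    using natural_in[OF const_hom_natural[OF k] complex_space_open_sub[OF that(1) nbhdsD(1)]] local_sectionD[OF that(2)] .
  have lift_ex: "\<exists>m W t. lift U u n s m W t" if "complex_space U" "s \<in> sections (level Y n) U" "u \<in> points U" for U u n s
    using swe_stalk_joined_onto[OF X Y f that(1), of u n "points U" s] that(2) local_section_points[OF that(3)]
    unfolding lift_def by metis
  have lift_unique: "germ F U u W (k m (U \<restriction>\<^sub>o W) t) = germ F U u W' (k m' (U \<restriction>\<^sub>o W') t')"
    if U: "complex_space U" and t: "lift U u n s m W t" and t': "lift U u n s m' W' t'" for U u n s m W t m' W' t'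
  proof -
    have "stalk_joined Y U u m W (f m (U \<restriction>\<^sub>o W) t) m' W' (f m' (U \<restriction>\<^sub>o W') t')"
      using t t' unfolding lift_def by (blast intro: stalk_joined_trans stalk_joined_sym)
    then have "stalk_joined X U u m W t m' W' t'"
      using t t' unfolding lift_def by (intro swe_stalk_joined_reflect[OF X Y f U]) auto
    then show ?thesis
      using t t' unfolding lift_def by (intro stalk_joined_const[OF X F k U]) auto
  qed
  have val_ex: "Ex (val U n s)" if U: "complex_space U" and s: "s \<in> sections (level Y n) U" for U n s
  proof -
    interpret sheaf_on F U using F U by unfold_locales
    \<comment> \<open>For a point of \<open>U\<close> the germ \<open>c\<close> is the one shared by
      all lifts; off \<open>U\<close> there are no lifts and any value will do.\<close>
    have "\<forall>u. \<exists>c. \<forall>m W t. lift U u n s m W t \<longrightarrow> germ F U u W (k m (U \<restriction>\<^sub>o W) t) = c"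
    proof
      fix u
      show "\<exists>c. \<forall>m W t. lift U u n s m W t \<longrightarrow> germ F U u W (k m (U \<restriction>\<^sub>o W) t) = c"
      proof (cases "\<exists>m W t. lift U u n s m W t")
        case True
        then obtain m' W' t' where "lift U u n s m' W' t'" by blast
        from lift_unique[OF U _ this] show ?thesis
          by (intro exI[of _ "germ F U u W' (k m' (U \<restriction>\<^sub>o W') t')"]) simp
      qed blast
    qed
    from choice[OF this]
    obtain \<sigma> where \<sigma>: "\<And>u m W t. lift U u n s m W t \<Longrightarrow> germ F U u W (k m (U \<restriction>\<^sub>o W) t) = \<sigma> u" by blast
    obtain y where "y \<in> sections F U" "\<And>u. u \<in> points U \<Longrightarrow> germ F U u (points U) y = \<sigma> u"
    proof (rule section_of_germs[of \<sigma>])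
      fix u assume u: "u \<in> points U"
      then obtain m W t where t: "lift U u n s m W t" using lift_ex[OF U s] by blast
      have ls: "local_section X U u m W t" and j: "stalk_joined Y U u m W (f m (U \<restriction>\<^sub>o W) t) n (points U) s"
        using t by (auto simp: lift_def)
      \<comment> \<open>One lift at \<open>u\<close> remains a lift at all points of
        \<open>N\<close>, so a single local section of \<open>F\<close> realizes the prescribed
        germs on \<open>N\<close>.\<close>
      obtain N where N: "N \<in> nbhds U u" "N \<subseteq> W" "\<And>v. v \<in> N \<Longrightarrow> stalk_joined Y U v m W (f m (U \<restriction>\<^sub>o W) t) n (points U) s"
        using stalk_joined_near[OF Y U j f_ls[OF U ls]] s local_section_points[OF u] by metis
      have nb: "W \<in> nbhds U u" and kt: "k m (U \<restriction>\<^sub>o W) t \<in> sections F (U \<restriction>\<^sub>o W)"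
        using local_sectionD[OF ls] k_ls[OF U ls] by auto
      have "germ F U v N (restr_open F U N W (k m (U \<restriction>\<^sub>o W) t)) = \<sigma> v" if v: "v \<in> N" for v
      proof -
        have "lift U v n s m W t"
          using N(2,3) v local_section_other[OF ls] unfolding lift_def by blast
        then show ?thesis
          using germ_restr_open[OF nbhds_other[OF nb] nbhds_other[OF N(1) v] N(2) kt] N(2) v \<sigma> by auto
      qed
      then show "\<exists>N\<in>nbhds U u. \<exists>y\<in>sections F (U \<restriction>\<^sub>o N). \<forall>v\<in>N. germ F U v N y = \<sigma> v"
        using N(1) restr_open_in[OF nbhdsD(1)[OF nb] nbhdsD(1)[OF N(1)] N(2) kt] by blast
    qed blast
    then have "val U n s y" unfolding val_def using \<sigma> by auto
    then show ?thesis ..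
  qed
  have g_val: "val U n s (g n U s)" if "complex_space U" "s \<in> sections (level Y n) U" for U n s
    unfolding g_def using val_ex[OF that] by (rule someI_ex)
  \<comment> \<open>As all lifts at a point give the same germ, it suffices to compare with one lift
    over each point.\<close>
  have g_eqI: "g n U s = y" if U: "complex_space U" and s: "s \<in> sections (level Y n) U" and y: "y \<in> sections F U"
    and germ: "\<And>u. u \<in> points U \<Longrightarrow> \<exists>m W t. lift U u n s m W t \<and> germ F U u (points U) y = germ F U u W (k m (U \<restriction>\<^sub>o W) t)"
    for n U s y
  proof -
    interpret sheaf_on F U using F U by unfold_locales
    show ?thesis
    proof (rule section_eqI[OF _ y])
      show "g n U s \<in> sections F U" using g_val[OF U s] by (simp add: val_def)
      show "germ F U u (points U) (g n U s) = germ F U u (points U) y" if u: "u \<in> points U" for u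
        using germ[OF u] g_val[OF U s] u unfolding val_def by metis
    qed
  qed
  have "natural (level Y n) F (g n)" for n
    unfolding natural_def
  proof (intro conjI allI impI funcsetI; (elim conjE)?)
    fix U s assume "complex_space U" "s \<in> sections (level Y n) U"
    then show "g n U s \<in> sections F U" using g_val by (simp add: val_def)
  next
    fix U V h s assume U: "complex_space U" and V: "complex_space V" and h: "h \<in> hol_maps U V"
      and s: "s \<in> sections (level Y n) V"
    note pX = ssheaf_presheaf[OF X] and pY = ssheaf_presheaf[OF Y] and pF = sheaf_presheaf[OF F]
    have gs: "g n V s \<in> sections F V" using g_val[OF V s] by (simp add: val_def)
    show "g n U (restr (level Y n) U V h s) = restr F U V h (g n V s)"
    proof (rule g_eqI[OF U restr_in[OF pY U V h s] restr_in[OF pF U V h gs]])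
      fix u assume u: "u \<in> points U"
      then have hu: "h u \<in> points V" by (rule hol_mapsD(4)[OF h])
      obtain m W t where t: "lift V (h u) n s m W t" using lift_ex[OF V s hu] by blast
      then have ls: "local_section X V (h u) m W t"
        and j: "stalk_joined Y V (h u) m W (f m (V \<restriction>\<^sub>o W) t) n (points V) s" by (auto simp: lift_def)
      have W: "openin (ctop V) W" "W \<in> nbhds V (h u)" and tW: "t \<in> sections (level X m) (V \<restriction>\<^sub>o W)"
        using local_sectionD[OF ls] nbhdsD(1) by auto
      let ?W = "{x\<in>points U. h x \<in> W}" and ?t = "pull (level X m) U V h W t"
      have pts: "{x\<in>points U. h x \<in> points V} = points U" using hol_mapsD(4)[OF h] by blast
      \<comment> \<open>A lift of \<open>s\<close> pulled back along \<open>h\<close> is a lift of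
        the pullback of \<open>s\<close>; this is what makes the chosen values natural.\<close>
      have "stalk_joined Y U u m ?W (pull (level Y m) U V h W (f m (V \<restriction>\<^sub>o W) t))
          n {x\<in>points U. h x \<in> points V} (pull (level Y n) U V h (points V) s)"
        by (rule stalk_joined_pull[OF Y V U h u j f_ls[OF V ls]]) (simp add: local_section_points[OF hu] s)
      then have "stalk_joined Y U u m ?W (f m (U \<restriction>\<^sub>o ?W) ?t) n (points U) (restr (level Y n) U V h s)"
        unfolding pts pull_points[OF h] natural_pull[OF ss_hom_natural[OF f'] U V h W(1) tW] .
      moreover have "local_section X U u m ?W ?t"
        using nbhds_vimage[OF h u W(2)] pull_in[OF pX U V h W(1) tW] by (simp add: local_section_def)
      ultimately have "lift U u n (restr (level Y n) U V h s) m ?W ?t" unfolding lift_def by blast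
      moreover have "germ F V (h u) (points V) (g n V s) = germ F V (h u) W (k m (V \<restriction>\<^sub>o W) t)"
        using g_val[OF V s, unfolded val_def, THEN conjunct2, rule_format, OF hu t] .
      then have "germ F U u {x\<in>points U. h x \<in> points V} (pull F U V h (points V) (g n V s)) =
          germ F U u ?W (pull F U V h W (k m (V \<restriction>\<^sub>o W) t))"
        using gs by (intro germ_pull[OF pF U V h u nbhds_points[OF hu] _ W(2) k_ls[OF V ls]]) simp_all
      then have "germ F U u (points U) (restr F U V h (g n V s)) = germ F U u ?W (k m (U \<restriction>\<^sub>o ?W) ?t)"
        unfolding pts pull_points[OF h] natural_pull[OF const_hom_natural[OF k] U V h W(1) tW] .
      ultimately show "\<exists>m W t. lift U u n (restr (level Y n) U V h s) m W t \<and>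
          germ F U u (points U) (restr F U V h (g n V s)) = germ F U u W (k m (U \<restriction>\<^sub>o W) t)" by blast
    qed
  qed
  moreover have "g m U (oper Y m n \<alpha> U s) = g n U s"
    if \<alpha>: "\<alpha> \<in> delta m n" and U: "complex_space U" and s: "s \<in> sections (level Y n) U" for m n \<alpha> U s
  proof (rule g_eqI[OF U natural_in[OF ssheaf_oper[OF Y \<alpha>] U s]])
    show "g n U s \<in> sections F U" using g_val[OF U s] by (simp add: val_def)
    fix u assume u: "u \<in> points U"
    then obtain l W t where t: "lift U u n s l W t" using lift_ex[OF U s] by blast
    have "local_section Y U u n (points U) s" using s by (simp add: local_section_points[OF u])
    from stalk_joined_oper[OF Y U \<alpha> this]
    have "stalk_joined Y U u m (points U) (oper Y m n \<alpha> U s) n (points U) s" by simp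
    \<comment> \<open>\<open>s\<close> and its image under an operator are joined, so they have the
      same lifts and receive the same value.\<close>
    then have "lift U u m (oper Y m n \<alpha> U s) l W t"
      using t unfolding lift_def by (blast intro: stalk_joined_trans stalk_joined_sym)
    moreover have "germ F U u (points U) (g n U s) = germ F U u W (k l (U \<restriction>\<^sub>o W) t)"
      using g_val[OF U s, unfolded val_def, THEN conjunct2, rule_format, OF u t] .
    ultimately show "\<exists>l W t. lift U u m (oper Y m n \<alpha> U s) l W t \<and>
        germ F U u (points U) (g n U s) = germ F U u W (k l (U \<restriction>\<^sub>o W) t)" by blast
  qed
  ultimately have g: "norm_mor Y g \<in> ss_hom Y (const_ss F)"
    by (intro norm_mor_in_ss_hom[OF Y]) simp_all
  have "ss_comp X (norm_mor Y g) f = k"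
  proof (rule ss_hom_eqI[OF ss_comp_in[OF X f' g] k])
    fix n U s assume U: "complex_space U" and s: "s \<in> sections (level X n) U"
    have fs: "f n U s \<in> sections (level Y n) U" using natural_in[OF ss_hom_natural[OF f'] U s] .
    have "g n U (f n U s) = k n U s"
    proof (rule g_eqI[OF U fs natural_in[OF const_hom_natural[OF k] U s]])
      fix u assume u: "u \<in> points U"
      have "lift U u n (f n U s) n (points U) s"
        using s fs u stalk_joined_refl[of Y U u n "points U" "f n U s"] by (simp add: lift_def local_section_points)
      then show "\<exists>m W t. lift U u n (f n U s) m W t \<and>
          germ F U u (points U) (k n U s) = germ F U u W (k m (U \<restriction>\<^sub>o W) t)"
        by (intro exI[of _ n] exI[of _ "points U"] exI[of _ s]) simp
    qed
    then show "ss_comp X (norm_mor Y g) f n U s = k n U s"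
      using U s fs by (simp add: ss_comp_apply norm_mor_apply)
  qed
  then show ?thesis using g by blast
qed

lemma const_hom_swe_bij:
  assumes "is_ssheaf X" "is_ssheaf Y" "is_sheaf F" "f \<in> swe X Y"
  shows "bij_betw (\<lambda>g. ss_comp X g f) (ss_hom Y (const_ss F)) (ss_hom X (const_ss F))"
  unfolding bij_betw_def
proof (intro conjI const_hom_swe_inj[OF assms] equalityI subsetI)
  fix k assume "k \<in> (\<lambda>g. ss_comp X g f) ` ss_hom Y (const_ss F)"
  then show "k \<in> ss_hom X (const_ss F)" using assms ss_comp_in by (auto simp: swe_def)
next
  fix k assume "k \<in> ss_hom X (const_ss F)"
  then show "k \<in> (\<lambda>g. ss_comp X g f) ` ss_hom Y (const_ss F)" using const_hom_swe_surj[OF assms] by blast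
qed

section \<open>Products and quotients\<close>

lemma is_presheafI:
  assumes "\<And>U V f s. complex_space U \<Longrightarrow> complex_space V \<Longrightarrow> f \<in> hol_maps U V \<Longrightarrow> s \<in> sections F V \<Longrightarrow>
      restr F U V f s \<in> sections F U"
    and "\<And>U s. complex_space U \<Longrightarrow> s \<in> sections F U \<Longrightarrow> restr F U U (incl (points U)) s = s"
    and "\<And>U V W f g s. complex_space U \<Longrightarrow> complex_space V \<Longrightarrow> complex_space W \<Longrightarrow>
        f \<in> hol_maps U V \<Longrightarrow> g \<in> hol_maps V W \<Longrightarrow> s \<in> sections F W \<Longrightarrow>
        restr F U W (compose (points U) g f) s = restr F U V f (restr F V W g s)"
  shows "is_presheaf F"
  unfolding is_presheaf_def
  by (intro conjI allI impI funcsetI; (elim conjE)?; rule assms; assumption)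

lemma naturalI:
  assumes "\<And>U s. complex_space U \<Longrightarrow> s \<in> sections F U \<Longrightarrow> \<phi> U s \<in> sections G U"
    and "\<And>U V f s. complex_space U \<Longrightarrow> complex_space V \<Longrightarrow> f \<in> hol_maps U V \<Longrightarrow> s \<in> sections F V \<Longrightarrow>
        \<phi> U (restr F U V f s) = restr G U V f (\<phi> V s)"
  shows "natural F G \<phi>"
  unfolding natural_def
  by (intro conjI allI impI funcsetI; (elim conjE)?; rule assms; assumption)

lemma is_sheafI:
  assumes "is_presheaf F"
    and "\<And>U \<V> t t'. complex_space U \<Longrightarrow> \<forall>V\<in>\<V>. openin (ctop U) V \<Longrightarrow> \<Union>\<V> = points U \<Longrightarrow>
        t \<in> sections F U \<Longrightarrow> t' \<in> sections F U \<Longrightarrow>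
        \<forall>V\<in>\<V>. restr_open F U V (points U) t = restr_open F U V (points U) t' \<Longrightarrow> t = t'"
    and "\<And>U \<V> s. complex_space U \<Longrightarrow> \<forall>V\<in>\<V>. openin (ctop U) V \<Longrightarrow> \<Union>\<V> = points U \<Longrightarrow>
        \<forall>V\<in>\<V>. s V \<in> sections F (U \<restriction>\<^sub>o V) \<Longrightarrow>
        \<forall>V\<in>\<V>. \<forall>V'\<in>\<V>. restr_open F U (V \<inter> V') V (s V) = restr_open F U (V \<inter> V') V' (s V') \<Longrightarrow>
        \<exists>t\<in>sections F U. \<forall>V\<in>\<V>. restr_open F U V (points U) t = s V"
  shows "is_sheaf F"
  unfolding is_sheaf_def
proof (intro conjI allI impI assms(1); elim conjE)
  fix U \<V> s assume a: "complex_space U" "\<forall>V\<in>\<V>. openin (ctop U) V" "\<Union>\<V> = points U"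
    "\<forall>V\<in>\<V>. s V \<in> sections F (U \<restriction>\<^sub>o V)"
    "\<forall>V\<in>\<V>. \<forall>V'\<in>\<V>. restr_open F U (V \<inter> V') V (s V) = restr_open F U (V \<inter> V') V' (s V')"
  obtain t where t: "t \<in> sections F U" "\<forall>V\<in>\<V>. restr_open F U V (points U) t = s V"
    using assms(3)[OF a] by blast
  show "\<exists>!t. t \<in> sections F U \<and> (\<forall>V\<in>\<V>. restr_open F U V (points U) t = s V)"
  proof (rule ex1I)
    show "t \<in> sections F U \<and> (\<forall>V\<in>\<V>. restr_open F U V (points U) t = s V)" using t by blast
    fix t' assume "t' \<in> sections F U \<and> (\<forall>V\<in>\<V>. restr_open F U V (points U) t' = s V)"
    then show "t' = t" using t by (intro assms(2)[OF a(1-3)]) auto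
  qed
qed

subsection \<open>Representable sheaves\<close>

lemma rep_simps [simp]:
  "sections (rep X) U = SHol ` hol_maps U X"
  "restr (rep X) U V f (SHol g) = SHol (compose (points U) g f)"
  by (simp_all add: rep_def)

lemma is_presheaf_rep: "is_presheaf (rep X :: ('p, ('p, 'b) sect) presheaf)"
proof (rule is_presheafI)
  fix U and s :: "('p, 'b) sect" assume "s \<in> sections (rep X) U"
  then obtain g where "s = SHol g" "g \<in> extensional (points U)" using hol_mapsD(1) by force
  then show "restr (rep X) U U (incl (points U)) s = s"
    by (simp add: compose_def incl_def extensional_restrict cong: restrict_cong)
next
  fix U V W :: "'p cspace" and f g and s :: "('p, 'b) sect" assume "f \<in> hol_maps U V" "s \<in> sections (rep X) W"
  then show "restr (rep X) U W (compose (points U) g f) s = restr (rep X) U V f (restr (rep X) V W g s)"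
    using hol_mapsD(4) by (fastforce simp: compose_def)
qed (auto intro: hol_maps_compose)

lemma restr_open_rep:
  "openin (ctop U) W \<Longrightarrow> restr_open (rep X) U W V (SHol g) = SHol (restrict g W)"
  by (simp add: restr_open_def compose_incl)

lemma is_sheaf_rep: "is_sheaf (rep X :: ('p, ('p, 'b) sect) presheaf)"
proof (rule is_sheafI[OF is_presheaf_rep])
  fix U \<V> and t t' :: "('p, 'b) sect" assume cov: "\<forall>V\<in>\<V>. openin (ctop U) V" "\<Union>\<V> = points U"
    and t: "t \<in> sections (rep X) U" "t' \<in> sections (rep X) U"
    and eq: "\<forall>V\<in>\<V>. restr_open (rep X) U V (points U) t = restr_open (rep X) U V (points U) t'"
  then obtain g g' where g: "t = SHol g" "t' = SHol g'" "g \<in> hol_maps U X" "g' \<in> hol_maps U X" by auto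
  have "g u = g' u" if u: "u \<in> points U" for u
  proof -
    obtain V where V: "V \<in> \<V>" "u \<in> V" using u cov(2) by blast
    then have "SHol (restrict g V) = (SHol (restrict g' V) :: ('p, 'b) sect)" using eq cov(1) unfolding g(1,2) by (metis restr_open_rep)
    then show ?thesis using V(2) by (metis restrict_apply' sect.inject(2))
  qed
  then show "t = t'" using g hol_mapsD(1) extensionalityI by metis
next
  fix U \<V> and s :: "'p set \<Rightarrow> ('p, 'b) sect" assume U: "complex_space U" and cov: "\<forall>V\<in>\<V>. openin (ctop U) V" "\<Union>\<V> = points U"
    and s: "\<forall>V\<in>\<V>. s V \<in> sections (rep X) (U \<restriction>\<^sub>o V)"
    and compat: "\<forall>V\<in>\<V>. \<forall>V'\<in>\<V>. restr_open (rep X) U (V \<inter> V') V (s V) = restr_open (rep X) U (V \<inter> V') V' (s V')"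
  have "\<forall>V\<in>\<V>. \<exists>g. s V = SHol g \<and> g \<in> hol_maps (U \<restriction>\<^sub>o V) X" using s by auto
  from bchoice[OF this] obtain g where g: "\<And>V. V \<in> \<V> \<Longrightarrow> s V = SHol (g V)" "\<And>V. V \<in> \<V> \<Longrightarrow> g V \<in> hol_maps (U \<restriction>\<^sub>o V) X"
    by blast
  have "\<forall>u\<in>points U. \<exists>V. V \<in> \<V> \<and> u \<in> V" using cov(2) by blast
  from bchoice[OF this] obtain c where c: "\<And>u. u \<in> points U \<Longrightarrow> c u \<in> \<V>" "\<And>u. u \<in> points U \<Longrightarrow> u \<in> c u" by blast
  have agree: "g V u = g V' u" if "V \<in> \<V>" "V' \<in> \<V>" "u \<in> V" "u \<in> V'" for V V' u
  proof -
    have o: "openin (ctop U) (V \<inter> V')" using cov(1) that by blast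
    have "restr_open (rep X) U (V \<inter> V') V (s V) = restr_open (rep X) U (V \<inter> V') V' (s V')"
      by (rule compat[rule_format, OF that(1,2)])
    then have "SHol (restrict (g V) (V \<inter> V')) = (SHol (restrict (g V') (V \<inter> V')) :: ('p, 'b) sect)"
      unfolding g(1)[OF that(1)] g(1)[OF that(2)] restr_open_rep[OF o] .
    then have "restrict (g V) (V \<inter> V') u = restrict (g V') (V \<inter> V') u" by simp
    then show ?thesis using that by simp
  qed
  \<comment> \<open>\<open>c u\<close> is some member of the cover that contains \<open>u\<close>;
    by \<open>agree\<close> the value does not depend on this choice.\<close>
  define h where "h = (\<lambda>u\<in>points U. g (c u) u)"
  have hV: "restrict h V = g V" if V: "V \<in> \<V>" for V
  proof -
    have sub: "V \<subseteq> points U" using cov(2) V by blast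
    have "points (U \<restriction>\<^sub>o V) = V" using cov(1) V points_open_sub_openin by blast
    then have "g V \<in> extensional V" using hol_mapsD(1)[OF g(2)[OF V]] by simp
    moreover have "h u = g V u" if u: "u \<in> V" for u
    proof -
      have "u \<in> points U" using sub u by blast
      then show ?thesis using agree[OF c(1) V c(2) u] by (simp add: h_def)
    qed
    ultimately show ?thesis by (auto simp: fun_eq_iff extensional_def)
  qed
  have "h \<in> hol_maps U X"
  proof (rule hol_maps_local[OF U])
    fix u assume u: "u \<in> points U"
    then have "c u \<in> nbhds U u" using c cov(1) by (auto simp: nbhds_def)
    then show "\<exists>V\<in>nbhds U u. restrict h V \<in> hol_maps (U \<restriction>\<^sub>o V) X" using hV[OF c(1)[OF u]] g(2)[OF c(1)[OF u]] by metis
  qed (simp add: h_def)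
  then show "\<exists>t\<in>sections (rep X) U. \<forall>V\<in>\<V>. restr_open (rep X) U V (points U) t = s V"
    using cov(1) g(1) hV by (intro bexI[of _ "SHol h"]) (simp_all add: restr_open_rep)
qed

lemma is_ssheaf_srep: "is_ssheaf (srep X)"
  unfolding srep_def by (rule is_ssheaf_const_ss[OF is_sheaf_rep])

subsection \<open>Products\<close>

lemma sprod_simps:
  "sections (level (sprod X Y) n) U = {SPair a b | a b. a \<in> sections (level X n) U \<and> b \<in> sections (level Y n) U}"
  "restr (level (sprod X Y) n) U V f (SPair a b) = SPair (restr (level X n) U V f a) (restr (level Y n) U V f b)"
  "oper (sprod X Y) m n \<alpha> U (SPair a b) = SPair (oper X m n \<alpha> U a) (oper Y m n \<alpha> U b)"
  by (simp_all add: sprod_def)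

lemma restr_open_sprod:
  "restr_open (level (sprod X Y) n) U W V (SPair a b) = SPair (restr_open (level X n) U W V a) (restr_open (level Y n) U W V b)"
  by (simp add: restr_open_def sprod_simps)

lemma is_presheaf_sprod:
  assumes "is_presheaf (level X n)" "is_presheaf (level Y n)"
  shows "is_presheaf (level (sprod X Y) n)"
  by (rule is_presheafI)
     (auto simp: sprod_simps restr_incl[OF assms(1)] restr_incl[OF assms(2)] restr_compose[OF assms(1)]
       restr_compose[OF assms(2)] restr_in[OF assms(1)] restr_in[OF assms(2)])

lemma is_sheaf_sprod:
  assumes X: "is_sheaf (level X n)" and Y: "is_sheaf (level Y n)"
  shows "is_sheaf (level (sprod X Y) n)"
proof (rule is_sheafI)
  show "is_presheaf (level (sprod X Y) n)" using X Y by (intro is_presheaf_sprod sheaf_presheaf)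
next
  fix U \<V> t t' assume U: "complex_space U" and cov: "\<forall>V\<in>\<V>. openin (ctop U) V" "\<Union>\<V> = points U"
    and t: "t \<in> sections (level (sprod X Y) n) U" "t' \<in> sections (level (sprod X Y) n) U"
    and eq: "\<forall>V\<in>\<V>. restr_open (level (sprod X Y) n) U V (points U) t = restr_open (level (sprod X Y) n) U V (points U) t'"
  obtain a b a' b' where ab: "t = SPair a b" "t' = SPair a' b'" "a \<in> sections (level X n) U" "a' \<in> sections (level X n) U"
      "b \<in> sections (level Y n) U" "b' \<in> sections (level Y n) U"
    using t by (auto simp: sprod_simps)
  have uniq: "x = x'" if "is_sheaf F" "x \<in> sections F U" "x' \<in> sections F U"
      "\<forall>V\<in>\<V>. restr_open F U V (points U) x = restr_open F U V (points U) x'" for F and x x' :: "('a, 'b) sect"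
    using that U by (intro sheaf_on.separated[OF sheaf_on.intro cov])
  have "restr_open (level X n) U V (points U) a = restr_open (level X n) U V (points U) a'"
    and "restr_open (level Y n) U V (points U) b = restr_open (level Y n) U V (points U) b'" if "V \<in> \<V>" for V
    using eq that unfolding ab(1,2) restr_open_sprod by auto
  then show "t = t'" using uniq[OF X ab(3,4)] uniq[OF Y ab(5,6)] ab(1,2) by simp
next
  fix U \<V> s assume U: "complex_space U" and cov: "\<forall>V\<in>\<V>. openin (ctop U) V" "\<Union>\<V> = points U"
    and s: "\<forall>V\<in>\<V>. s V \<in> sections (level (sprod X Y) n) (U \<restriction>\<^sub>o V)"
    and compat: "\<forall>V\<in>\<V>. \<forall>V'\<in>\<V>. restr_open (level (sprod X Y) n) U (V \<inter> V') V (s V) =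
        restr_open (level (sprod X Y) n) U (V \<inter> V') V' (s V')"
  interpret X: sheaf_on "level X n" U using X U by unfold_locales
  interpret Y: sheaf_on "level Y n" U using Y U by unfold_locales
  have s_eq: "s V = SPair (sfst (s V)) (ssnd (s V))" and s_in: "sfst (s V) \<in> sections (level X n) (U \<restriction>\<^sub>o V)"
      "ssnd (s V) \<in> sections (level Y n) (U \<restriction>\<^sub>o V)" if "V \<in> \<V>" for V
    using s that by (force simp: sprod_simps)+
  have c0: "restr_open (level (sprod X Y) n) U (V \<inter> V') V (SPair (sfst (s V)) (ssnd (s V))) =
      restr_open (level (sprod X Y) n) U (V \<inter> V') V' (SPair (sfst (s V')) (ssnd (s V')))"
    if "V \<in> \<V>" "V' \<in> \<V>" for V V'
    using compat that by (simp add: s_eq[symmetric])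
  have c: "restr_open (level X n) U (V \<inter> V') V (sfst (s V)) = restr_open (level X n) U (V \<inter> V') V' (sfst (s V'))"
      "restr_open (level Y n) U (V \<inter> V') V (ssnd (s V)) = restr_open (level Y n) U (V \<inter> V') V' (ssnd (s V'))"
    if "V \<in> \<V>" "V' \<in> \<V>" for V V'
    using c0[OF that] unfolding restr_open_sprod by auto
  obtain a where a: "a \<in> sections (level X n) U" "\<forall>V\<in>\<V>. restr_open (level X n) U V (points U) a = sfst (s V)"
    using X.glue[OF cov, of "\<lambda>V. sfst (s V)"] s_in c by blast
  obtain b where b: "b \<in> sections (level Y n) U" "\<forall>V\<in>\<V>. restr_open (level Y n) U V (points U) b = ssnd (s V)"
    using Y.glue[OF cov, of "\<lambda>V. ssnd (s V)"] s_in c by blast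
  show "\<exists>t\<in>sections (level (sprod X Y) n) U. \<forall>V\<in>\<V>. restr_open (level (sprod X Y) n) U V (points U) t = s V"
    using a b s_eq[symmetric] by (intro bexI[of _ "SPair a b"]) (auto simp: restr_open_sprod sprod_simps)
qed

lemma is_ssheaf_sprod:
  assumes X: "is_ssheaf X" and Y: "is_ssheaf Y"
  shows "is_ssheaf (sprod X Y)"
  unfolding is_ssheaf_def
proof (intro conjI allI ballI impI; (elim conjE)?)
  show "is_sheaf (level (sprod X Y) n)" for n using X Y by (intro is_sheaf_sprod ssheaf_level)
  show "natural (level (sprod X Y) n) (level (sprod X Y) m) (oper (sprod X Y) m n \<alpha>)" if "\<alpha> \<in> delta m n" for m n \<alpha>
    by (rule naturalI)
       (auto simp: sprod_simps natural_in[OF ssheaf_oper[OF X that]] natural_in[OF ssheaf_oper[OF Y that]]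
         natural_restr[OF ssheaf_oper[OF X that]] natural_restr[OF ssheaf_oper[OF Y that]])
  show "oper (sprod X Y) n n (\<lambda>i\<in>{..n}. i) U s = s"
    if "complex_space U" "s \<in> sections (level (sprod X Y) n) U" for n U s
    using that X Y unfolding is_ssheaf_def by (auto simp: sprod_simps)
  show "oper (sprod X Y) l n (compose {..l} \<beta> \<alpha>) U s = oper (sprod X Y) l m \<alpha> U (oper (sprod X Y) m n \<beta> U s)"
    if "\<alpha> \<in> delta l m" "\<beta> \<in> delta m n" "complex_space U" "s \<in> sections (level (sprod X Y) n) U" for l m n U s \<alpha> \<beta>
    using that X Y unfolding is_ssheaf_def by (auto simp: sprod_simps)
qed

lemma natural_sfst: "natural (level (sprod X Y) n) (level X n) (\<lambda>U. sfst)"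
  by (rule naturalI) (auto simp: sprod_simps)

lemma natural_ssnd: "natural (level (sprod X Y) n) (level Y n) (\<lambda>U. ssnd)"
  by (rule naturalI) (auto simp: sprod_simps)

lemma natural_SPair:
  assumes "natural E (level X n) \<phi>" "natural E (level Y n) \<psi>"
  shows "natural E (level (sprod X Y) n) (\<lambda>U s. SPair (\<phi> U s) (\<psi> U s))"
  by (rule naturalI)
     (auto simp: sprod_simps natural_in[OF assms(1)] natural_in[OF assms(2)] natural_restr[OF assms(1)] natural_restr[OF assms(2)])

lemma sproj_in:
  assumes "is_ssheaf X" "is_ssheaf Y"
  shows "sproj X Y \<in> ss_hom (sprod X Y) X"
  unfolding sproj_def
  by (rule norm_mor_in_ss_hom[OF is_ssheaf_sprod[OF assms]]) (auto simp: natural_sfst sprod_simps)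

lemma sproj_apply:
  "complex_space U \<Longrightarrow> a \<in> sections (level X n) U \<Longrightarrow> b \<in> sections (level Y n) U \<Longrightarrow> sproj X Y n U (SPair a b) = a"
  by (simp add: sproj_def norm_mor_apply sprod_simps)

subsection \<open>Sheafification\<close>

text \<open>The code is chosen from the germ as a set, hence depends on the germ alone and not on
  the representative.\<close>

lemma germ_code_cong: "germ F U u V s = germ F U u V' s' \<Longrightarrow> germ_code F U u V s = germ_code F U u V' s'"
  by (simp add: germ_code_def)

context presheaf_on
begin

lemma germ_codeD:
  assumes V: "V \<in> nbhds U u" "s \<in> sections F (U \<restriction>\<^sub>o V)" and c: "germ_code F U u V s = (W, t)"
  shows "W \<in> nbhds U u" "t \<in> sections F (U \<restriction>\<^sub>o W)" "germ F U u W t = germ F U u V s"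
proof -
  have "germ_code F U u V s \<in> germ F U u V s"
    unfolding germ_code_def using germ_self[OF V] by (rule someI)
  then have "(W, t) \<in> germ F U u V s" by (simp add: c)
  from germ_eq_if_mem[OF V this]
  show "W \<in> nbhds U u" "t \<in> sections F (U \<restriction>\<^sub>o W)" "germ F U u W t = germ F U u V s" .
qed

end

definition locally_coded :: "('p, ('p, 'b) sect) presheaf \<Rightarrow> 'p cspace \<Rightarrow> ('p \<Rightarrow> 'p set \<times> ('p, 'b) sect) \<Rightarrow> bool" where
  "locally_coded F U \<sigma> \<longleftrightarrow> (\<forall>u\<in>points U. \<exists>V\<in>nbhds U u. \<exists>s\<in>sections F (U \<restriction>\<^sub>o V). \<forall>v\<in>V. \<sigma> v = germ_code F U v V s)"

lemma sections_sheafify: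
  "sections (sheafify F) U = {SGerms \<sigma> | \<sigma>. \<sigma> \<in> extensional (points U) \<and> locally_coded F U \<sigma>}"
  by (simp add: sheafify_def locally_coded_def)

lemma locally_codedE:
  assumes "locally_coded F U \<sigma>" "u \<in> points U"
  obtains V s where "V \<in> nbhds U u" "s \<in> sections F (U \<restriction>\<^sub>o V)" "\<And>v. v \<in> V \<Longrightarrow> \<sigma> v = germ_code F U v V s"
  using assms unfolding locally_coded_def by blast

lemma restr_sheafify:
  "restr (sheafify F) U V f (SGerms \<sigma>) =
    SGerms (\<lambda>u\<in>points U. case \<sigma> (f u) of (W, s) \<Rightarrow> germ_code F U u {x\<in>points U. f x \<in> W} (pull F U V f W s))"
  by (simp add: sheafify_def pull_def Let_def)

text \<open>The restriction maps of \<open>sheafify\<close> work with the representative that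
  \<open>germ_code\<close> happens to pick. By \<open>germ_pull\<close> any other representative of
  the germ gives the same code.\<close>

lemma germ_code_pull:
  assumes F: "is_presheaf F" and U: "complex_space U" and V: "complex_space V" and f: "f \<in> hol_maps U V" and u: "u \<in> points U"
    and W: "W \<in> nbhds V (f u)" "s \<in> sections F (V \<restriction>\<^sub>o W)"
  shows "(case germ_code F V (f u) W s of (W, s) \<Rightarrow> germ_code F U u {x\<in>points U. f x \<in> W} (pull F U V f W s)) =
    germ_code F U u {x\<in>points U. f x \<in> W} (pull F U V f W s)"
proof (cases "germ_code F V (f u) W s")
  case (Pair W' s')
  interpret presheaf_on F V using F V by unfold_locales
  note c = germ_codeD[OF W Pair]
  show ?thesis
    using germ_code_cong[OF germ_pull[OF F U V f u c(1,2) W c(3)]] by (simp add: Pair)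
qed

lemma pull_incl:
  assumes F: "is_presheaf F" and U: "complex_space U" and V: "openin (ctop U) V" and W: "openin (ctop U) W" "W \<subseteq> V"
    and s: "s \<in> sections F (U \<restriction>\<^sub>o W)"
  shows "pull F (U \<restriction>\<^sub>o V) U (incl V) W s = s" "{x \<in> points (U \<restriction>\<^sub>o V). incl V x \<in> W} = W"
proof -
  show eq: "{x \<in> points (U \<restriction>\<^sub>o V). incl V x \<in> W} = W"
    using W by (auto simp: points_open_sub_openin[OF V] incl_def)
  have r: "restrict (incl V) W = incl (points (U \<restriction>\<^sub>o W))"
    using W(2) by (simp add: points_open_sub_openin[OF W(1)] incl_def restrict_restrict inf.absorb2)
  show "pull F (U \<restriction>\<^sub>o V) U (incl V) W s = s"
    unfolding pull_def eq open_sub_open_sub[OF W(2)] r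
    by (rule restr_incl[OF F complex_space_open_sub[OF U W(1)] s])
qed

text \<open>The equation of preimages goes with that of sections, because preimages are themselves
  arguments of \<open>germ_code\<close>.\<close>

lemma pull_compose:
  assumes F: "is_presheaf F" and U: "complex_space U" and V: "complex_space V" and W: "complex_space W"
    and f: "f \<in> hol_maps U V" and g: "g \<in> hol_maps V W" and N: "openin (ctop W) N" and s: "s \<in> sections F (W \<restriction>\<^sub>o N)"
  shows "pull F U W (compose (points U) g f) N s = pull F U V f {y\<in>points V. g y \<in> N} (pull F V W g N s)"
    "{x\<in>points U. compose (points U) g f x \<in> N} = {x\<in>points U. f x \<in> {y\<in>points V. g y \<in> N}}"
proof -
  let ?M = "{y\<in>points V. g y \<in> N}" and ?L = "{x\<in>points U. f x \<in> {y\<in>points V. g y \<in> N}}"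
  show eq: "{x\<in>points U. compose (points U) g f x \<in> N} = ?L"
    using hol_mapsD(4)[OF f] by (auto simp: compose_def)
  have M: "openin (ctop V) ?M" by (rule hol_mapsD(5)[OF g N])
  have L: "openin (ctop U) ?L" by (rule hol_mapsD(5)[OF f M])
  have hf: "restrict f ?L \<in> hol_maps (U \<restriction>\<^sub>o ?L) (V \<restriction>\<^sub>o ?M)" by (rule hol_maps_restrict[OF U f M L]) blast
  have hg: "restrict g ?M \<in> hol_maps (V \<restriction>\<^sub>o ?M) (W \<restriction>\<^sub>o N)" by (rule hol_maps_restrict[OF V g N M]) blast
  have "restrict (compose (points U) g f) ?L = compose (points (U \<restriction>\<^sub>o ?L)) (restrict g ?M) (restrict f ?L)"
    by (simp only: points_open_sub_openin[OF L]) (auto simp: compose_def fun_eq_iff restrict_def)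
  then show "pull F U W (compose (points U) g f) N s = pull F U V f ?M (pull F V W g N s)"
    unfolding pull_def eq
    using restr_compose[OF F complex_space_open_sub[OF U L] complex_space_open_sub[OF V M]
        complex_space_open_sub[OF W N] hf hg s] by simp
qed

lemma is_presheaf_sheafify:
  assumes F: "is_presheaf F"
  shows "is_presheaf (sheafify F)"
proof (rule is_presheafI)
  fix U V f t assume U: "complex_space U" and V: "complex_space V" and f: "f \<in> hol_maps U V" and t: "t \<in> sections (sheafify F) V"
  then obtain \<sigma> where \<sigma>: "t = SGerms \<sigma>" "locally_coded F V \<sigma>" by (auto simp: sections_sheafify)
  define \<tau> where "\<tau> = (\<lambda>u\<in>points U. case \<sigma> (f u) of (W, s) \<Rightarrow> germ_code F U u {x\<in>points U. f x \<in> W} (pull F U V f W s))"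
  have "locally_coded F U \<tau>"
    unfolding locally_coded_def
  proof
    fix u assume u: "u \<in> points U"
    obtain W s where W: "W \<in> nbhds V (f u)" and s: "s \<in> sections F (V \<restriction>\<^sub>o W)" and c: "\<And>v. v \<in> W \<Longrightarrow> \<sigma> v = germ_code F V v W s"
      using locally_codedE[OF \<sigma>(2) hol_mapsD(4)[OF f u]] by blast
    let ?W = "{x\<in>points U. f x \<in> W}"
    have "\<tau> v = germ_code F U v ?W (pull F U V f W s)" if "v \<in> ?W" for v
      using that c germ_code_pull[OF F U V f _ nbhds_other[OF W] s] by (simp add: \<tau>_def)
    then show "\<exists>V\<in>nbhds U u. \<exists>s\<in>sections F (U \<restriction>\<^sub>o V). \<forall>v\<in>V. \<tau> v = germ_code F U v V s"
      using nbhds_vimage[OF f u W] pull_in[OF F U V f nbhdsD(1)[OF W] s] by blast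
  qed
  then show "restr (sheafify F) U V f t \<in> sections (sheafify F) U"
    unfolding \<sigma>(1) restr_sheafify sections_sheafify by (auto simp: \<tau>_def)
next
  fix U t assume U: "complex_space U" and t: "t \<in> sections (sheafify F) U"
  then obtain \<sigma> where \<sigma>: "t = SGerms \<sigma>" "\<sigma> \<in> extensional (points U)" "locally_coded F U \<sigma>" by (auto simp: sections_sheafify)
  let ?i = "incl (points U)"
  have "(case \<sigma> (?i u) of (W, s) \<Rightarrow> germ_code F U u {x\<in>points U. ?i x \<in> W} (pull F U U ?i W s)) = \<sigma> u" if u: "u \<in> points U" for u
  proof -
    obtain W s where W: "W \<in> nbhds U u" and s: "s \<in> sections F (U \<restriction>\<^sub>o W)" and c: "\<sigma> u = germ_code F U u W s"
      using locally_codedE[OF \<sigma>(3) u] nbhdsD(2) by metis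
    have iu: "?i u = u" using u by (simp add: incl_def)
    have "W \<in> nbhds U (?i u)" using W iu by simp
    note g = germ_code_pull[OF F U U hol_maps_incl_points[OF U] u this s]
    show ?thesis
      using g pull_incl[OF F U openin_topspace nbhdsD(1)[OF W] nbhdsD(3)[OF W] s] unfolding iu c by simp
  qed
  then have "(\<lambda>u\<in>points U. case \<sigma> (?i u) of (W, s) \<Rightarrow> germ_code F U u {x\<in>points U. ?i x \<in> W} (pull F U U ?i W s)) = \<sigma>"
    using \<sigma>(2) by (auto simp: fun_eq_iff extensional_def)
  then show "restr (sheafify F) U U (incl (points U)) t = t"
    unfolding \<sigma>(1) restr_sheafify by simp
next
  fix U V W f g t assume U: "complex_space U" and V: "complex_space V" and W: "complex_space W"
    and f: "f \<in> hol_maps U V" and g: "g \<in> hol_maps V W" and t: "t \<in> sections (sheafify F) W"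
  then obtain \<sigma> where \<sigma>: "t = SGerms \<sigma>" "locally_coded F W \<sigma>" by (auto simp: sections_sheafify)
  define \<tau> where "\<tau> = (\<lambda>v\<in>points V. case \<sigma> (g v) of (N, s) \<Rightarrow> germ_code F V v {x\<in>points V. g x \<in> N} (pull F V W g N s))"
  let ?h = "compose (points U) g f"
  have "(case \<sigma> (?h u) of (N, s) \<Rightarrow> germ_code F U u {x\<in>points U. ?h x \<in> N} (pull F U W ?h N s)) =
      (case \<tau> (f u) of (N, s) \<Rightarrow> germ_code F U u {x\<in>points U. f x \<in> N} (pull F U V f N s))" if u: "u \<in> points U" for u
  proof -
    have fu: "f u \<in> points V" and gfu: "g (f u) \<in> points W" using u hol_mapsD(4)[OF f] hol_mapsD(4)[OF g] by auto
    have hu: "?h u = g (f u)" using u by (simp add: compose_def)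
    obtain N s where N: "N \<in> nbhds W (g (f u))" and s: "s \<in> sections F (W \<restriction>\<^sub>o N)" and c: "\<sigma> (g (f u)) = germ_code F W (g (f u)) N s"
      using locally_codedE[OF \<sigma>(2) gfu] nbhdsD(2) by metis
    have Nh: "N \<in> nbhds W (?h u)" using N hu by simp
    have "\<tau> (f u) = germ_code F V (f u) {x\<in>points V. g x \<in> N} (pull F V W g N s)"
      using germ_code_pull[OF F V W g fu N s] fu by (simp add: \<tau>_def c)
    then have "(case \<tau> (f u) of (N, s) \<Rightarrow> germ_code F U u {x\<in>points U. f x \<in> N} (pull F U V f N s)) =
        germ_code F U u {x\<in>points U. f x \<in> {x\<in>points V. g x \<in> N}} (pull F U V f {x\<in>points V. g x \<in> N} (pull F V W g N s))"
      using germ_code_pull[OF F U V f u nbhds_vimage[OF g fu N] pull_in[OF F V W g nbhdsD(1)[OF N] s]] by simp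
    moreover have "(case \<sigma> (?h u) of (N, s) \<Rightarrow> germ_code F U u {x\<in>points U. ?h x \<in> N} (pull F U W ?h N s)) =
        germ_code F U u {x\<in>points U. ?h x \<in> N} (pull F U W ?h N s)"
      using germ_code_pull[OF F U W hol_maps_compose[OF f g] u Nh s] unfolding hu c .
    ultimately show ?thesis
      using pull_compose[OF F U V W f g nbhdsD(1)[OF N] s] by simp
  qed
  then show "restr (sheafify F) U W (compose (points U) g f) t = restr (sheafify F) U V f (restr (sheafify F) V W g t)"
    unfolding \<sigma>(1) restr_sheafify \<tau>_def[symmetric] by (simp cong: restrict_cong)
qed

lemma sheafify_unit_natural:
  assumes F: "is_presheaf F"
  shows "natural F (sheafify F) (sheafify_unit F)"
proof (rule naturalI)
  fix U s assume "complex_space U" "s \<in> sections F U"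
  then show "sheafify_unit F U s \<in> sections (sheafify F) U"
    unfolding sheafify_unit_def sections_sheafify locally_coded_def
    by (auto intro!: bexI[of _ "points U"] bexI[of _ s] simp: nbhds_points)
next
  fix U V f s assume U: "complex_space U" and V: "complex_space V" and f: "f \<in> hol_maps U V" and s: "s \<in> sections F V"
  have s': "s \<in> sections F (V \<restriction>\<^sub>o points V)" using s by simp
  have pts: "{x\<in>points U. f x \<in> points V} = points U" using hol_mapsD(4)[OF f] by blast
  have "(case (\<lambda>v\<in>points V. germ_code F V v (points V) s) (f u) of (W, s) \<Rightarrow>
      germ_code F U u {x\<in>points U. f x \<in> W} (pull F U V f W s)) = germ_code F U u (points U) (restr F U V f s)"
    if u: "u \<in> points U" for u
    using germ_code_pull[OF F U V f u nbhds_points[OF hol_mapsD(4)[OF f u]] s'] hol_mapsD(4)[OF f u]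
    by (simp add: pts pull_points[OF f])
  then show "sheafify_unit F U (restr F U V f s) = restr (sheafify F) U V f (sheafify_unit F V s)"
    unfolding sheafify_unit_def restr_sheafify by (simp cong: restrict_cong)
qed

text \<open>Codes in \<open>U\<close> and in an open subspace are chosen from different sets, so
  restriction encodes every germ anew. The new codes are computed by pulling back along the
  inclusion.\<close>

lemma sheafify_local:
  assumes F: "is_presheaf F" and U: "complex_space U" and t: "t \<in> sections (sheafify F) U" and u: "u \<in> points U"
  obtains V s where "V \<in> nbhds U u" "s \<in> sections F (U \<restriction>\<^sub>o V)"
    "restr_open (sheafify F) U V (points U) t = sheafify_unit F (U \<restriction>\<^sub>o V) s"
proof -
  obtain \<sigma> where \<sigma>: "t = SGerms \<sigma>" "locally_coded F U \<sigma>" using t by (auto simp: sections_sheafify)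
  obtain V s where V: "V \<in> nbhds U u" and s: "s \<in> sections F (U \<restriction>\<^sub>o V)" and c: "\<And>v. v \<in> V \<Longrightarrow> \<sigma> v = germ_code F U v V s"
    using locally_codedE[OF \<sigma>(2) u] by blast
  note o = nbhdsD(1)[OF V]
  have pV: "points (U \<restriction>\<^sub>o V) = V" by (rule points_open_sub_openin[OF o])
  have i: "incl V \<in> hol_maps (U \<restriction>\<^sub>o V) U"
    using hol_maps_incl[OF U openin_topspace o] nbhdsD(3)[OF V] by simp
  note p = pull_incl[OF F U o o order_refl s]
  have "(case \<sigma> (incl V v) of (W, s) \<Rightarrow> germ_code F (U \<restriction>\<^sub>o V) v {x\<in>points (U \<restriction>\<^sub>o V). incl V x \<in> W} (pull F (U \<restriction>\<^sub>o V) U (incl V) W s)) =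
      germ_code F (U \<restriction>\<^sub>o V) v V s" if v: "v \<in> V" for v
  proof -
    have iv: "incl V v = v" using v by (simp add: incl_def)
    have "V \<in> nbhds U (incl V v)" using V v iv by (simp add: nbhds_def)
    moreover have "v \<in> points (U \<restriction>\<^sub>o V)" using v pV by simp
    ultimately show ?thesis
      using germ_code_pull[OF F complex_space_open_sub[OF U o] U i _ _ s, of v] unfolding p iv c[OF v] by blast
  qed
  then have "restr_open (sheafify F) U V (points U) t = sheafify_unit F (U \<restriction>\<^sub>o V) s"
    unfolding restr_open_def \<sigma>(1) open_sub_points restr_sheafify sheafify_unit_def pV by (simp cong: restrict_cong)
  then show ?thesis using that V s by blast
qed

section \<open>Hyperbolic discrete sheaves\<close>

lemma SSh_simps [simp]:
  "Ob SSh = {X. is_ssheaf X}" "Hom SSh = ss_hom" "Idt SSh = ss_id" "Cmp SSh = ss_comp"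
  by (simp_all add: SSh_def)

lemma ss_id_apply: "complex_space U \<Longrightarrow> s \<in> sections (level X n) U \<Longrightarrow> ss_id X n U s = s"
  by (simp add: ss_id_def norm_mor_apply)

lemma ss_hom_in: "\<phi> \<in> ss_hom X Y \<Longrightarrow> complex_space U \<Longrightarrow> s \<in> sections (level X n) U \<Longrightarrow> \<phi> n U s \<in> sections (level Y n) U"
  using natural_in[OF ss_hom_natural] .

lemma ss_comp_assoc:
  assumes X: "is_ssheaf X" and Y: "is_ssheaf Y" and f: "f \<in> ss_hom X Y" and g: "g \<in> ss_hom Y Z" and h: "h \<in> ss_hom Z V"
  shows "ss_comp X h (ss_comp X g f) = ss_comp X (ss_comp Y h g) f"
  by (rule ss_hom_eqI[OF ss_comp_in[OF X ss_comp_in[OF X f g] h] ss_comp_in[OF X f ss_comp_in[OF Y g h]]])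
     (simp add: ss_comp_apply ss_hom_in[OF f])

lemma ss_comp_id: "is_ssheaf X \<Longrightarrow> f \<in> ss_hom X Y \<Longrightarrow> ss_comp X f (ss_id X) = f"
  by (rule ss_hom_eqI[OF ss_comp_in[OF _ ss_id_in]]) (auto simp: ss_comp_apply ss_id_apply)

lemma ss_id_comp:
  assumes "is_ssheaf X" "is_ssheaf Y" "f \<in> ss_hom X Y"
  shows "ss_comp X (ss_id Y) f = f"
  by (rule ss_hom_eqI[OF ss_comp_in[OF assms(1,3) ss_id_in[OF assms(2)]] assms(3)])
     (simp add: ss_comp_apply ss_id_apply ss_hom_in[OF assms(3)])

lemma localizable_SSh:
  assumes "\<And>X Y w. w \<in> W X Y \<Longrightarrow> w \<in> ss_hom X Y"
  shows "localizable SSh W"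
  by unfold_locales
     (simp_all add: assms ss_id_in ss_comp_in ss_comp_assoc ss_comp_id ss_id_comp)

lemma localizable_swe: "localizable SSh swe"
  by (rule localizable_SSh) (simp add: swe_def)

lemma localizable_C_weq: "localizable SSh C_weq"
  by (rule localizable_SSh) (simp add: C_weq_def)

lemma discrete_target_const:
  assumes "is_sheaf F"
  shows "discrete_target SSh swe (const_ss F)"
  using const_hom_swe_bij[OF _ _ assms] is_ssheaf_const_ss[OF assms]
  by (intro discrete_target.intro localizable_swe discrete_target_axioms.intro) auto

lemma loc_precomp_const_bij_iff:
  assumes "is_sheaf F" "is_ssheaf X" "is_ssheaf Y" "f \<in> ss_hom X Y"
  shows "bij_betw (loc_precomp SSh swe X Y (const_ss F) f) (loc_hom SSh swe Y (const_ss F)) (loc_hom SSh swe X (const_ss F)) \<longleftrightarrow>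
    bij_betw (\<lambda>g. ss_comp X g f) (ss_hom Y (const_ss F)) (ss_hom X (const_ss F))"
  using discrete_target.loc_precomp_bij_iff[OF discrete_target_const[OF assms(1)], of X Y f] assms(2-4) by simp

text \<open>For a discrete sheaf both localized Hom-sets in the definition are strict ones.\<close>

lemma hyperbolic_const_iff:
  assumes F: "is_sheaf F"
  shows "hyperbolic (const_ss F) \<longleftrightarrow> (\<forall>Y. is_ssheaf Y \<longrightarrow>
    bij_betw (\<lambda>g. ss_comp (sprod Y (srep cline)) g (sproj Y (srep cline)))
      (ss_hom Y (const_ss F)) (ss_hom (sprod Y (srep cline)) (const_ss F)))"
  unfolding hyperbolic_def
  using is_ssheaf_const_ss[OF F] loc_precomp_const_bij_iff[OF F is_ssheaf_sprod[OF _ is_ssheaf_srep] _ sproj_in[OF _ is_ssheaf_srep]]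
  by blast

lemma C_weq_const_bij:
  assumes "is_sheaf F" "hyperbolic (const_ss F)" "is_ssheaf X" "is_ssheaf Y" "f \<in> C_weq X Y"
  shows "bij_betw (\<lambda>g. ss_comp X g f) (ss_hom Y (const_ss F)) (ss_hom X (const_ss F))"
proof -
  have f: "f \<in> ss_hom X Y" and b: "bij_betw (loc_precomp SSh swe X Y (const_ss F) f)
      (loc_hom SSh swe Y (const_ss F)) (loc_hom SSh swe X (const_ss F))"
    using assms(2,5) unfolding C_weq_def by blast+
  show ?thesis using b loc_precomp_const_bij_iff[OF assms(1,3,4) f] by blast
qed

text \<open>
  The map is pulled back to \<open>U \<times> \<complex>\<close> along the section \<open>e\<close>, so that \<open>E\<close> itself need not be an object
  of the category.
\<close>

lemma hyperbolic_const_line: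
  fixes E :: "('q, 'b) ssh"
  assumes F: "is_sheaf F" and hyp: "hyperbolic (const_ss F)" and E: "is_presheaf (level E n)"
    and \<phi>: "natural (level (sprod E (srep cline)) n) F \<phi>"
    and U: "complex_space U" and e: "e \<in> sections (level E n) U"
    and c: "c \<in> hol_maps U cline" and c': "c' \<in> hol_maps U cline"
  shows "\<phi> U (SPair e (SHol c)) = \<phi> U (SPair e (SHol c'))"
proof -
  let ?L = "srep cline :: ('q, 'b) ssh" and ?U = "srep U :: ('q, 'b) ssh"
  have SL: "level (srep X :: ('q, 'b) ssh) m = rep X" for X m by (simp add: srep_def)
  \<comment> \<open>The Yoneda map from \<open>U\<close> to \<open>E\<close> that sends the identity
    of \<open>U\<close> to \<open>e\<close>.\<close>
  define y :: "'q pts cspace \<Rightarrow> ('q pts, 'b) sect \<Rightarrow> ('q pts, 'b) sect" where "y V s = (case s of SHol f \<Rightarrow> restr (level E n) V U f e)" for V s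
  have y: "natural (rep U) (level E n) y"
  proof (rule naturalI)
    show "y V s \<in> sections (level E n) V" if "complex_space V" "s \<in> sections (rep U) V" for V s
      using that restr_in[OF E _ U _ e] by (auto simp: y_def)
    show "y V (restr (rep U) V W f s) = restr (level E n) V W f (y W s)"
      if "complex_space V" "complex_space W" "f \<in> hol_maps V W" "s \<in> sections (rep U) W" for V W f s
      using that restr_compose[OF E _ _ U _ _ e] by (auto simp: y_def)
  qed
  define G :: "'q pts cspace \<Rightarrow> ('q pts, 'b) sect \<Rightarrow> ('q pts, 'b) sect" where "G V s = \<phi> V (SPair (y V (sfst s)) (ssnd s))" for V s
  \<comment> \<open>\<open>\<phi>\<close> belongs to the single level \<open>n\<close> of
    \<open>E\<close>, but \<open>U\<close> and the line are constant simplicial sheaves, so the same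
    \<open>G\<close> serves at every level \<open>m\<close>.\<close>
  have G_nat: "natural (level (sprod ?U ?L) m) F G" for m
  proof -
    have 1: "natural (level (sprod ?U ?L) m) (level E n) (\<lambda>V s. y V (sfst s))"
      using natural_comp[OF natural_sfst[of ?U ?L m, unfolded SL] y] .
    have 2: "natural (level (sprod ?U ?L) m) (level ?L n) (\<lambda>V. ssnd)"
      using natural_ssnd[of ?U ?L m] unfolding SL .
    show ?thesis
      unfolding G_def using natural_comp[OF natural_SPair[OF 1 2] \<phi>] .
  qed
  have P: "is_ssheaf (sprod ?U ?L)" by (intro is_ssheaf_sprod is_ssheaf_srep)
  have "norm_mor (sprod ?U ?L) (\<lambda>m. G) \<in> ss_hom (sprod ?U ?L) (const_ss F)"
  proof (rule norm_mor_in_ss_hom[OF P])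
    show "natural (level (sprod ?U ?L) m) (level (const_ss F) m) G" for m using G_nat by simp
    show "G V (oper (sprod ?U ?L) m l \<alpha> V s) = oper (const_ss F) m l \<alpha> V (G V s)"
      if "s \<in> sections (level (sprod ?U ?L) l) V" for m l \<alpha> V s
      using that by (auto simp: sprod_simps srep_def)
  qed
  moreover have "bij_betw (\<lambda>g. ss_comp (sprod ?U ?L) g (sproj ?U ?L))
      (ss_hom ?U (const_ss F)) (ss_hom (sprod ?U ?L) (const_ss F))"
    using hyp is_ssheaf_srep unfolding hyperbolic_const_iff[OF F] by blast
  ultimately obtain h where h: "norm_mor (sprod ?U ?L) (\<lambda>m. G) = ss_comp (sprod ?U ?L) h (sproj ?U ?L)"
    unfolding bij_betw_def by (metis (no_types, lifting) imageE)
  \<comment> \<open>By hyperbolicity \<open>G\<close> factors through the projection; evaluated at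
    the identity of \<open>U\<close>, the factorization gives a value in which \<open>d\<close> does
    not occur.\<close>
  have "\<phi> U (SPair e (SHol d)) = h 0 U (SHol (incl (points U)))" if d: "d \<in> hol_maps U cline" for d
  proof -
    let ?s = "SPair (SHol (incl (points U))) (SHol d)"
    have i: "SHol (incl (points U)) \<in> sections (level ?U 0) U" and d': "SHol d \<in> sections (level ?L 0) U"
      using hol_maps_incl_points[OF U] d by (auto simp: SL)
    then have s: "?s \<in> sections (level (sprod ?U ?L) 0) U" by (auto simp: sprod_simps)
    have "norm_mor (sprod ?U ?L) (\<lambda>m. G) 0 U ?s = \<phi> U (SPair e (SHol d))"
      using U s restr_incl[OF E U e] by (simp add: norm_mor_apply G_def y_def)
    moreover have "ss_comp (sprod ?U ?L) h (sproj ?U ?L) 0 U ?s = h 0 U (SHol (incl (points U)))"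
      using U s by (simp add: ss_comp_apply sproj_apply[OF U i d'])
    ultimately show ?thesis by (simp add: h)
  qed
  then show ?thesis using c c' by simp
qed

section \<open>Maps from suspensions to hyperbolic sheaves\<close>

lemma collapse_simps:
  "sections (level (collapse X A) n) U = insert (SLeft SPt) (SRight ` (sections (level X n) U - A n U))"
  "restr (level (collapse X A) n) U V f = collapse_map (A n U) (restr (level X n) U V f)"
  by (simp_all add: collapse_def)

lemma collapse_map_simps:
  "collapse_map A \<phi> (SLeft s) = SLeft SPt" "collapse_map A \<phi> (SRight s) = collapse_sec A (\<phi> s)"
  by (simp_all add: collapse_map_def)

text \<open>\<open>A\<close> is a subpresheaf at level \<open>n\<close>. If a section in
  \<open>A\<close> could restrict to one outside \<open>A\<close>, restriction in one step and in
  two steps could differ after collapsing.\<close>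

definition restr_closed :: "('p, ('p, 'b) sect) simplicial \<Rightarrow> (nat \<Rightarrow> 'p cspace \<Rightarrow> ('p, 'b) sect set) \<Rightarrow> nat \<Rightarrow> bool" where
  "restr_closed X A n \<longleftrightarrow> (\<forall>U V f s. complex_space U \<and> complex_space V \<and> f \<in> hol_maps U V \<and>
     s \<in> sections (level X n) V \<and> s \<in> A n V \<longrightarrow> restr (level X n) U V f s \<in> A n U)"

lemma restr_closedD:
  "restr_closed X A n \<Longrightarrow> complex_space U \<Longrightarrow> complex_space V \<Longrightarrow> f \<in> hol_maps U V \<Longrightarrow> s \<in> sections (level X n) V \<Longrightarrow>
    s \<in> A n V \<Longrightarrow> restr (level X n) U V f s \<in> A n U"
  unfolding restr_closed_def by blast

lemma collapse_sec_in:
  "s \<in> sections (level X n) U \<Longrightarrow> collapse_sec (A n U) s \<in> sections (level (collapse X A) n) U"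
  by (auto simp: collapse_simps collapse_sec_def)

lemma collapse_sec_restr:
  assumes A: "restr_closed X A n" and "complex_space U" "complex_space V" "f \<in> hol_maps U V" "s \<in> sections (level X n) V"
  shows "collapse_sec (A n U) (restr (level X n) U V f s) = restr (level (collapse X A) n) U V f (collapse_sec (A n V) s)"
  using restr_closedD[OF A assms(2-5)] by (simp add: collapse_simps collapse_sec_def collapse_map_simps)

text \<open>The base point is a case of its own, since it need not be the image of a section: for
  \<open>S0\<close> the collapsed part is empty.\<close>

lemma collapse_cases:
  assumes "t \<in> sections (level (collapse X A) n) U"
  obtains "t = SLeft SPt" | s where "s \<in> sections (level X n) U" "t = collapse_sec (A n U) s"
  using assms by (auto simp: collapse_simps collapse_sec_def)

lemma is_presheaf_collapse:
  assumes X: "is_presheaf (level X n)" and A: "restr_closed X A n"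
  shows "is_presheaf (level (collapse X A) n)"
proof (rule is_presheafI)
  have base: "restr (level (collapse X A) n) U V f (SLeft SPt) = SLeft SPt" for U V f
    by (simp add: collapse_simps collapse_map_simps)
  show "restr (level (collapse X A) n) U V f t \<in> sections (level (collapse X A) n) U"
    if "complex_space U" "complex_space V" "f \<in> hol_maps U V" "t \<in> sections (level (collapse X A) n) V" for U V f t
    using that(4)
  proof (cases rule: collapse_cases)
    case 1
    then show ?thesis by (simp only: base) (simp add: collapse_simps)
  next
    case (2 s)
    show ?thesis
      unfolding 2(2) collapse_sec_restr[OF A that(1-3) 2(1), symmetric]
      by (rule collapse_sec_in[OF restr_in[OF X that(1-3) 2(1)]])
  qed
  show "restr (level (collapse X A) n) U U (incl (points U)) t = t"
    if U: "complex_space U" and t: "t \<in> sections (level (collapse X A) n) U" for U t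
    using t
  proof (cases rule: collapse_cases)
    case (2 s)
    show ?thesis
      unfolding 2(2) collapse_sec_restr[OF A U U hol_maps_incl_points[OF U] 2(1), symmetric] restr_incl[OF X U 2(1)] ..
  qed (simp add: base)
  show "restr (level (collapse X A) n) U W (compose (points U) g f) t =
      restr (level (collapse X A) n) U V f (restr (level (collapse X A) n) V W g t)"
    if U: "complex_space U" and V: "complex_space V" and W: "complex_space W" and f: "f \<in> hol_maps U V" and g: "g \<in> hol_maps V W"
      and t: "t \<in> sections (level (collapse X A) n) W" for U V W f g t
    using t
  proof (cases rule: collapse_cases)
    case (2 s)
    show ?thesis
      unfolding 2(2) collapse_sec_restr[OF A V W g 2(1), symmetric]
        collapse_sec_restr[OF A U V f restr_in[OF X V W g 2(1)], symmetric]
        collapse_sec_restr[OF A U W hol_maps_compose[OF f g] 2(1), symmetric]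
        restr_compose[OF X U V W f g 2(1)] ..
  qed (simp add: base)
qed

text \<open>One level of a pointed simplicial sheaf. The argument for suspensions compares values at
  a fixed level, where naturality in the space is the structure that matters.\<close>

definition pointed_presheaf :: "nat \<Rightarrow> ('q, 'b) pssh \<Rightarrow> bool" where
  "pointed_presheaf n P \<longleftrightarrow> is_presheaf (level (fst P) n) \<and>
     natural (level spt n) (level (fst P) n) (snd P n)"

definition quot_map :: "('q, 'b) ssh \<Rightarrow> (nat \<Rightarrow> 'q pts cspace \<Rightarrow> ('q pts, 'b) sect set) \<Rightarrow> ('q, 'b) ssh_mor" where
  "quot_map X A n U s = sheafify_unit (level (collapse X A) n) U (collapse_sec (A n U) s)"

lemma level_spt [simp]: "sections (level spt n) U = {SPt}" "restr (level spt n) U V f s = s"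
  by (simp_all add: spt_def)

lemma pquot_simps:
  "level (fst (pquot X A)) n = sheafify (level (collapse X A) n)"
  "complex_space U \<Longrightarrow> snd (pquot X A) n U SPt = sheafify_unit (level (collapse X A) n) U (SLeft SPt)"
  by (simp_all add: pquot_def ssheafify_def norm_mor_apply)

context
  fixes X :: "('q, 'b) ssh" and A n
  assumes X: "is_presheaf (level X n)" and A: "restr_closed X A n"
begin

lemma quot_map_natural: "natural (level X n) (level (fst (pquot X A)) n) (quot_map X A n)"
proof -
  have "natural (level X n) (level (collapse X A) n) (\<lambda>U. collapse_sec (A n U))"
    by (rule naturalI) (simp_all add: collapse_sec_in collapse_sec_restr[OF A])
  from natural_comp[OF this sheafify_unit_natural[OF is_presheaf_collapse[OF X A]]] show ?thesis
    by (simp add: pquot_simps quot_map_def[abs_def])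
qed

lemma pointed_presheaf_pquot: "pointed_presheaf n (pquot X A)"
proof -
  note C = is_presheaf_collapse[OF X A]
  have base: "restr (level (collapse X A) n) U V f (SLeft SPt) = SLeft SPt" for U V f
    by (simp add: collapse_simps collapse_map_simps)
  have "natural (level spt n) (level (collapse X A) n) (\<lambda>U _. SLeft SPt)"
    by (rule naturalI) (simp_all add: base, simp add: collapse_simps)
  from natural_comp[OF this sheafify_unit_natural[OF C]]
  have "natural (level spt n) (level (fst (pquot X A)) n) (\<lambda>U s. sheafify_unit (level (collapse X A) n) U (SLeft SPt))"
    by (simp add: pquot_simps)
  then have "natural (level spt n) (level (fst (pquot X A)) n) (snd (pquot X A) n)"
    unfolding natural_def by (auto simp: pquot_simps(2))
  then show ?thesis
    using is_presheaf_sheafify[OF C] by (simp add: pointed_presheaf_def pquot_simps)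
qed

lemma quot_map_base: "complex_space U \<Longrightarrow> s \<in> A n U \<Longrightarrow> quot_map X A n U s = snd (pquot X A) n U SPt"
  by (simp add: quot_map_def collapse_sec_def pquot_simps)

text \<open>Combines \<open>sheafify_local\<close> with the two cases of the collapse. Through it a
  natural map from the quotient to a sheaf is controlled by its base value and its composite with
  \<open>quot_map\<close>.\<close>

lemma pquot_local:
  assumes U: "complex_space U" and t: "t \<in> sections (level (fst (pquot X A)) n) U" and u: "u \<in> points U"
  obtains V where "V \<in> nbhds U u"
      "restr_open (level (fst (pquot X A)) n) U V (points U) t = snd (pquot X A) n (U \<restriction>\<^sub>o V) SPt"
  | V s where "V \<in> nbhds U u" "s \<in> sections (level X n) (U \<restriction>\<^sub>o V)"
      "restr_open (level (fst (pquot X A)) n) U V (points U) t = quot_map X A n (U \<restriction>\<^sub>o V) s"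
proof -
  obtain V c where V: "V \<in> nbhds U u" "c \<in> sections (level (collapse X A) n) (U \<restriction>\<^sub>o V)"
    and r: "restr_open (level (fst (pquot X A)) n) U V (points U) t = sheafify_unit (level (collapse X A) n) (U \<restriction>\<^sub>o V) c"
    using sheafify_local[OF is_presheaf_collapse[OF X A] U t[unfolded pquot_simps] u] unfolding pquot_simps by metis
  note UV = complex_space_open_sub[OF U nbhdsD(1)[OF V(1)]]
  from V(2) show ?thesis
  proof (cases rule: collapse_cases)
    case 1
    then show ?thesis using that(1)[OF V(1)] r UV by (simp add: pquot_simps)
  next
    case (2 s)
    then show ?thesis using that(2)[OF V(1) 2(1)] r by (simp add: quot_map_def)
  qed
qed

end

section \<open>Smash products and spheres as pointed presheaves\<close>

lemma pointed_presheafD: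
  assumes "pointed_presheaf n P"
  shows "is_presheaf (level (fst P) n)" "natural (level spt n) (level (fst P) n) (snd P n)"
  using assms by (simp_all add: pointed_presheaf_def)

definition wedge :: "('q, 'b) pssh \<Rightarrow> ('q, 'b) pssh \<Rightarrow> nat \<Rightarrow> 'q pts cspace \<Rightarrow> ('q pts, 'b) sect set" where
  "wedge P Q n U = {SPair a b | a b. a \<in> sections (level (fst P) n) U \<and> b \<in> sections (level (fst Q) n) U \<and>
     (a = snd P n U SPt \<or> b = snd Q n U SPt)}"

lemma smash_eq: "smash P Q = pquot (sprod (fst P) (fst Q)) (wedge P Q)"
  by (simp add: smash_def wedge_def[abs_def] split_beta)

lemma restr_closed_wedge:
  assumes P: "pointed_presheaf n P" and Q: "pointed_presheaf n Q"
  shows "restr_closed (sprod (fst P) (fst Q)) (wedge P Q) n"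
proof -
  note p = pointed_presheafD[OF P] and q = pointed_presheafD[OF Q]
  have "restr (level (fst P) n) U V f (snd P n V SPt) = snd P n U SPt"
    and "restr (level (fst Q) n) U V f (snd Q n V SPt) = snd Q n U SPt"
    if "complex_space U" "complex_space V" "f \<in> hol_maps U V" for U V f
    using natural_restr[OF p(2) that, of SPt] natural_restr[OF q(2) that, of SPt] by simp_all
  then show ?thesis
    unfolding restr_closed_def wedge_def
    by (auto simp: sprod_simps restr_in[OF p(1)] restr_in[OF q(1)] natural_in[OF p(2)] natural_in[OF q(2)])
qed

lemma pointed_presheaf_smash:
  assumes P: "pointed_presheaf n P" and Q: "pointed_presheaf n Q"
  shows "pointed_presheaf n (smash P Q)"
  unfolding smash_eq
  by (rule pointed_presheaf_pquot[OF is_presheaf_sprod[OF pointed_presheafD(1)[OF P] pointed_presheafD(1)[OF Q]]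
      restr_closed_wedge[OF P Q]])

lemma const_sec_in: "complex_space U \<Longrightarrow> p \<in> points X \<Longrightarrow> const_sec U p \<in> sections (rep X) U"
  by (simp add: const_sec_def hol_maps_const)

lemma restr_const_sec: "f \<in> hol_maps U V \<Longrightarrow> restr (rep X) U V f (const_sec V p) = const_sec U p"
  using hol_mapsD(4) by (fastforce simp: const_sec_def compose_def)

lemma level_srep [simp]: "level (srep X) n = rep X"
  by (simp add: srep_def)

lemma pointed_presheaf_srep_pt:
  assumes "p \<in> points X"
  shows "pointed_presheaf n (srep_pt X p)"
proof -
  have "natural (level spt n) (rep X) (snd (srep_pt X p) n)"
    using assms by (intro naturalI) (auto simp: srep_pt_def norm_mor_apply const_sec_in restr_const_sec simp del: rep_simps)
  then show ?thesis by (simp add: pointed_presheaf_def srep_pt_def is_presheaf_rep)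
qed

lemma restr_closed_two_points: "restr_closed (srep X) (\<lambda>n U. {const_sec U p, const_sec U q}) n"
  unfolding restr_closed_def by (auto simp: restr_const_sec simp del: rep_simps)

lemma pointed_presheaf_two_point_quot: "pointed_presheaf n (two_point_quot X p q)"
  unfolding two_point_quot_def
  by (rule pointed_presheaf_pquot[OF _ restr_closed_two_points]) (simp add: is_presheaf_rep)

lemma pointed_presheaf_S0: "pointed_presheaf n S0"
  unfolding S0_def
proof (rule pointed_presheaf_pquot)
  show "is_presheaf (level spt n)" by (rule is_presheafI) auto
qed (simp add: restr_closed_def)

lemma pointed_presheaf_smash_power: "pointed_presheaf n P \<Longrightarrow> pointed_presheaf n (smash_power P k)"
  by (induction k) (auto intro: pointed_presheaf_S0 pointed_presheaf_smash)

lemma openin_cline: "openin (ctop cline) S \<longleftrightarrow> S \<subseteq> range Inl \<and> open (Inl -` S)"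
proof -
  have "istopology (\<lambda>S :: 'a pts set. S \<subseteq> range Inl \<and> open (Inl -` S))"
    unfolding istopology_def by (auto simp: vimage_Union)
  then show ?thesis by (simp add: cline_def topology_inverse')
qed

lemma points_cline: "points cline = range Inl"
proof
  show "points cline \<subseteq> range Inl" using openin_topspace[of "ctop cline"] openin_cline by blast
  have "openin (ctop cline) (range Inl)" by (simp add: openin_cline inj_vimage_image_eq)
  then show "range Inl \<subseteq> points cline" by (rule openin_subset)
qed

lemma points_punctured_line: "points punctured_line = Inl ` (- {0})"
  by (auto simp: punctured_line_def points_open_sub points_cline)

lemma pointed_presheaf_Gm: "pointed_presheaf n Gm"
  unfolding Gm_def by (rule pointed_presheaf_srep_pt) (auto simp: points_punctured_line)

lemma natural_eqI_local:
  assumes F: "is_sheaf F" and \<phi>: "natural E F \<phi>" and \<psi>: "natural E F \<psi>"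
    and loc: "\<And>U s u. complex_space U \<Longrightarrow> s \<in> sections E U \<Longrightarrow> u \<in> points U \<Longrightarrow>
      \<exists>V\<in>nbhds U u. \<phi> (U \<restriction>\<^sub>o V) (restr_open E U V (points U) s) = \<psi> (U \<restriction>\<^sub>o V) (restr_open E U V (points U) s)"
    and U: "complex_space U" and s: "s \<in> sections E U"
  shows "\<phi> U s = \<psi> U s"
proof -
  interpret sheaf_on F U using F U by unfold_locales
  have in1: "\<phi> U s \<in> sections F U" and in2: "\<psi> U s \<in> sections F U"
    using natural_in[OF \<phi> U s] natural_in[OF \<psi> U s] by auto
  have s': "s \<in> sections E (U \<restriction>\<^sub>o points U)" using s by simp
  show ?thesis
  proof (rule section_eqI[OF in1 in2])
    fix u assume u: "u \<in> points U"
    obtain V where V: "V \<in> nbhds U u"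
        "\<phi> (U \<restriction>\<^sub>o V) (restr_open E U V (points U) s) = \<psi> (U \<restriction>\<^sub>o V) (restr_open E U V (points U) s)"
      using loc[OF U s u] by blast
    note o = openin_topspace nbhdsD(1)[OF V(1)] nbhdsD(3)[OF V(1)]
    have "restr_open F U V (points U) (\<phi> U s) = restr_open F U V (points U) (\<psi> U s)"
      using natural_restr_open[OF \<phi> U o s'] natural_restr_open[OF \<psi> U o s'] V(2) by simp
    moreover have "germ F U u V (restr_open F U V (points U) y) = germ F U u (points U) y" if "y \<in> sections F U" for y
      using that by (intro germ_restr_open nbhds_points[OF u] V(1) o(3)) simp
    ultimately show "germ F U u (points U) (\<phi> U s) = germ F U u (points U) (\<psi> U s)"
      using in1 in2 by metis
  qed
qed

lemma quot_map_smash_base: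
  assumes U: "complex_space U" and P: "pointed_presheaf n P" and a: "a \<in> sections (level (fst P) n) U"
    and Q: "pointed_presheaf n Q"
  shows "quot_map (sprod (fst P) (fst Q)) (wedge P Q) n U (SPair a (snd Q n U SPt)) = snd (smash P Q) n U SPt"
proof -
  have "SPair a (snd Q n U SPt) \<in> wedge P Q n U"
    using a natural_in[OF pointed_presheafD(2)[OF Q] U] by (auto simp: wedge_def)
  then show ?thesis
    unfolding smash_eq
    by (intro quot_map_base[OF is_presheaf_sprod[OF pointed_presheafD(1)[OF P] pointed_presheafD(1)[OF Q]]
      restr_closed_wedge[OF P Q] U])
qed

text \<open>
  On \<open>P \<times> (Q \<times> \<complex>)\<close> the map does not depend on the coordinate in \<open>\<complex>\<close>, and at \<open>0\<close> it is the base
  point. Since the iterated quotient is locally covered by this product, the map is constant.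
\<close>

lemma suspension_map_constant:
  fixes P Q :: "('q, 'b) pssh"
  assumes F: "is_sheaf F" and hyp: "hyperbolic (const_ss F)"
    and P: "pointed_presheaf n P" and Q: "pointed_presheaf n Q"
    and g: "natural (level (fst (smash P (smash Q S1_par))) n) F g"
    and z: "natural (level spt n) F (\<lambda>U _. z U)"
    and base: "\<And>U. complex_space U \<Longrightarrow> g U (snd (smash P (smash Q S1_par)) n U SPt) = z U"
    and U: "complex_space U" and t: "t \<in> sections (level (fst (smash P (smash Q S1_par))) n) U"
  shows "g U t = z U"
proof -
  let ?L = "srep cline :: ('q, 'b) ssh" and ?S1 = "S1_par :: ('q, 'b) pssh"
  let ?A = "\<lambda>n U. {const_sec U (Inl 0), const_sec U (Inl 1)} :: ('q pts, 'b) sect set"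
  let ?T = "smash Q ?S1"
  let ?X = "sprod (fst Q) (fst ?S1)" and ?Y = "sprod (fst P) (fst ?T)" and ?E = "sprod (fst P) (fst Q)"
  have S1: "?S1 = pquot ?L ?A" by (simp add: S1_par_def two_point_quot_def)
  have S1p: "pointed_presheaf n ?S1" by (simp add: S1_par_def pointed_presheaf_two_point_quot)
  have Tp: "pointed_presheaf n ?T" by (rule pointed_presheaf_smash[OF Q S1p])
  note pP = pointed_presheafD(1)[OF P] and pQ = pointed_presheafD(1)[OF Q] and pS1 = pointed_presheafD(1)[OF S1p]
    and pT = pointed_presheafD(1)[OF Tp]
  have pL: "is_presheaf (level ?L n)" by (simp add: is_presheaf_rep)
  note pX = is_presheaf_sprod[OF pQ pS1] and pY = is_presheaf_sprod[OF pP pT] and pE = is_presheaf_sprod[OF pP pQ]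
  note wX = restr_closed_wedge[OF Q S1p] and wY = restr_closed_wedge[OF P Tp] and wL = restr_closed_two_points
  let ?qc = "quot_map ?L ?A n" and ?qT = "quot_map ?X (wedge Q ?S1) n" and ?qS = "quot_map ?Y (wedge P ?T) n"
  have Nc: "natural (level ?L n) (level (fst ?S1) n) ?qc"
    unfolding S1 by (rule quot_map_natural[OF pL wL])
  have NT: "natural (level ?X n) (level (fst ?T) n) ?qT"
    unfolding smash_eq by (rule quot_map_natural[OF pX wX])
  have NS: "natural (level ?Y n) (level (fst (smash P ?T)) n) ?qS"
    unfolding smash_eq[of P] by (rule quot_map_natural[OF pY wY])
  have Z: "natural E F (\<lambda>U _. z U)" for E
    using natural_in[OF z] natural_restr[OF z] by (intro naturalI) simp_all
  have qS_base: "g U (?qS U (SPair a (snd ?T n U SPt))) = z U"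
    if "complex_space U" "a \<in> sections (level (fst P) n) U" for U a
    using quot_map_smash_base[OF that(1) P that(2) Tp] base[OF that(1)] by simp
  have qT_base: "g U (?qS U (SPair a (?qT U (SPair b (snd ?S1 n U SPt))))) = z U"
    if "complex_space U" "a \<in> sections (level (fst P) n) U" "b \<in> sections (level (fst Q) n) U" for U a b
    using quot_map_smash_base[OF that(1) Q that(3) S1p] qS_base[OF that(1,2)] by simp
  have restr_in': "restr_open E U V (points U) s \<in> sections E (U \<restriction>\<^sub>o V)"
    if "is_presheaf E" "complex_space U" "s \<in> sections E U" "V \<in> nbhds U u" for E :: "('q pts, ('q pts, 'b) sect) presheaf" and U s V u
    using restr_open_points[OF _ that(3) nbhdsD(1)[OF that(4)]] that(1,2) by (simp add: presheaf_on_def)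
  have step1: "g U (?qS U (SPair a (?qT U (SPair b (?qc U c))))) = z U"
    if U: "complex_space U" and a: "a \<in> sections (level (fst P) n) U" and b: "b \<in> sections (level (fst Q) n) U"
      and c: "c \<in> sections (level ?L n) U" for U a b c
  proof -
    \<comment> \<open>The product is rebracketed as (P x Q) x C, so that the line is the last
      factor, as in \<open>hyperbolic_const_line\<close>.\<close>
    define \<phi> where "\<phi> U x = g U (?qS U (SPair (sfst (sfst x)) (?qT U (SPair (ssnd (sfst x)) (?qc U (ssnd x))))))" for U x
    have 1: "natural (level (sprod ?E ?L) n) (level ?X n) (\<lambda>U x. SPair (ssnd (sfst x)) (?qc U (ssnd x)))"
      by (rule natural_SPair[OF natural_comp[OF natural_sfst natural_ssnd] natural_comp[OF natural_ssnd Nc]])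
    have 2: "natural (level (sprod ?E ?L) n) (level ?Y n)
        (\<lambda>U x. SPair (sfst (sfst x)) (?qT U (SPair (ssnd (sfst x)) (?qc U (ssnd x)))))"
      by (rule natural_SPair[OF natural_comp[OF natural_sfst natural_sfst] natural_comp[OF 1 NT]])
    have \<phi>: "natural (level (sprod ?E ?L) n) F \<phi>"
      unfolding \<phi>_def by (rule natural_comp[OF natural_comp[OF 2 NS] g])
    obtain d where d: "c = SHol d" "d \<in> hol_maps U cline" using c by auto
    have ab: "SPair a b \<in> sections (level ?E n) U" using a b by (auto simp: sprod_simps)
    have k: "(\<lambda>u\<in>points U. Inl 0) \<in> hol_maps U cline" using U by (rule hol_maps_const) (simp add: points_cline)
    \<comment> \<open>0 is one of the two points collapsed in the circle, so the value there is the
      base point.\<close>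
    have "?qc U (const_sec U (Inl 0)) = snd ?S1 n U SPt"
      unfolding S1 by (rule quot_map_base[OF pL wL U]) simp
    then have "\<phi> U (SPair (SPair a b) (const_sec U (Inl 0))) = z U"
      using qT_base[OF U a b] by (simp add: \<phi>_def)
    moreover have "\<phi> U (SPair (SPair a b) (SHol d)) = \<phi> U (SPair (SPair a b) (const_sec U (Inl 0)))"
      unfolding const_sec_def by (rule hyperbolic_const_line[OF F hyp pE \<phi> U ab d(2) k])
    ultimately show ?thesis by (simp add: \<phi>_def d(1))
  qed
  \<comment> \<open>Descent from the line to the circle: locally a section of the circle is the base
    point or comes from the line.\<close>
  have step2: "g U (?qS U (SPair a (?qT U (SPair b s)))) = z U"
    if U: "complex_space U" and a: "a \<in> sections (level (fst P) n) U" and b: "b \<in> sections (level (fst Q) n) U"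
      and s: "s \<in> sections (level (fst ?S1) n) U" for U a b s
  proof -
    define \<phi> where "\<phi> U x = g U (?qS U (SPair (sfst (sfst x)) (?qT U (SPair (ssnd (sfst x)) (ssnd x)))))" for U x
    have 1: "natural (level (sprod ?E (fst ?S1)) n) (level ?X n) (\<lambda>U x. SPair (ssnd (sfst x)) (ssnd x))"
      by (rule natural_SPair[OF natural_comp[OF natural_sfst natural_ssnd] natural_ssnd])
    have 2: "natural (level (sprod ?E (fst ?S1)) n) (level ?Y n)
        (\<lambda>U x. SPair (sfst (sfst x)) (?qT U (SPair (ssnd (sfst x)) (ssnd x))))"
      by (rule natural_SPair[OF natural_comp[OF natural_sfst natural_sfst] natural_comp[OF 1 NT]])
    have \<phi>: "natural (level (sprod ?E (fst ?S1)) n) F \<phi>"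
      unfolding \<phi>_def by (rule natural_comp[OF natural_comp[OF 2 NS] g])
    have "\<phi> U (SPair (SPair a b) s) = z U"
    proof (rule natural_eqI_local[OF F \<phi> Z])
      fix U x u assume U: "complex_space U" and x: "x \<in> sections (level (sprod ?E (fst ?S1)) n) U" and u: "u \<in> points U"
      then obtain a b s where x: "x = SPair (SPair a b) s" and a: "a \<in> sections (level (fst P) n) U"
          and b: "b \<in> sections (level (fst Q) n) U" and s: "s \<in> sections (level (fst ?S1) n) U"
        by (auto simp: sprod_simps)
      show "\<exists>V\<in>nbhds U u. \<phi> (U \<restriction>\<^sub>o V) (restr_open (level (sprod ?E (fst ?S1)) n) U V (points U) x) = z (U \<restriction>\<^sub>o V)"
      proof (rule pquot_local[OF pL wL U s[unfolded S1] u])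
        fix V assume V: "V \<in> nbhds U u" and r: "restr_open (level (fst (pquot ?L ?A)) n) U V (points U) s = snd (pquot ?L ?A) n (U \<restriction>\<^sub>o V) SPt"
        show ?thesis
          using qT_base[OF complex_space_open_sub[OF U nbhdsD(1)[OF V]] restr_in'[OF pP U a V] restr_in'[OF pQ U b V]] r
          unfolding S1[symmetric] by (intro bexI[OF _ V]) (simp add: x restr_open_sprod \<phi>_def)
      next
        fix V c assume V: "V \<in> nbhds U u" and c: "c \<in> sections (level ?L n) (U \<restriction>\<^sub>o V)"
          and r: "restr_open (level (fst (pquot ?L ?A)) n) U V (points U) s = ?qc (U \<restriction>\<^sub>o V) c"
        show ?thesis
          using step1[OF complex_space_open_sub[OF U nbhdsD(1)[OF V]] restr_in'[OF pP U a V] restr_in'[OF pQ U b V] c] r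
          unfolding S1[symmetric] by (intro bexI[OF _ V]) (simp add: x restr_open_sprod \<phi>_def)
      qed
    qed (use U a b s in \<open>auto simp: sprod_simps\<close>)
    then show ?thesis by (simp add: \<phi>_def)
  qed
  \<comment> \<open>The same descent from Q x S^1 to the inner smash product; the concluding block
    repeats it for the outer one.\<close>
  have step3: "g U (?qS U x) = z U" if U: "complex_space U" and x: "x \<in> sections (level ?Y n) U" for U x
  proof (rule natural_eqI_local[OF F natural_comp[OF NS g] Z _ U x])
    fix U x u assume U: "complex_space U" and x: "x \<in> sections (level ?Y n) U" and u: "u \<in> points U"
    then obtain a s where x: "x = SPair a s" and a: "a \<in> sections (level (fst P) n) U" and s: "s \<in> sections (level (fst ?T) n) U"
      by (auto simp: sprod_simps)
    show "\<exists>V\<in>nbhds U u. g (U \<restriction>\<^sub>o V) (?qS (U \<restriction>\<^sub>o V) (restr_open (level ?Y n) U V (points U) x)) = z (U \<restriction>\<^sub>o V)"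
    proof (rule pquot_local[OF pX wX U s[unfolded smash_eq] u])
      fix V assume V: "V \<in> nbhds U u"
        and r: "restr_open (level (fst (pquot ?X (wedge Q ?S1))) n) U V (points U) s = snd (pquot ?X (wedge Q ?S1)) n (U \<restriction>\<^sub>o V) SPt"
      show ?thesis
        using qS_base[OF complex_space_open_sub[OF U nbhdsD(1)[OF V]] restr_in'[OF pP U a V]] r
        unfolding smash_eq[of Q, symmetric] by (intro bexI[OF _ V]) (simp add: x restr_open_sprod)
    next
      fix V y assume V: "V \<in> nbhds U u" and y: "y \<in> sections (level ?X n) (U \<restriction>\<^sub>o V)"
        and r: "restr_open (level (fst (pquot ?X (wedge Q ?S1))) n) U V (points U) s = ?qT (U \<restriction>\<^sub>o V) y"
      obtain b c where y: "y = SPair b c" and b: "b \<in> sections (level (fst Q) n) (U \<restriction>\<^sub>o V)" and c: "c \<in> sections (level (fst ?S1) n) (U \<restriction>\<^sub>o V)"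
        using y by (auto simp: sprod_simps)
      show ?thesis
        using step2[OF complex_space_open_sub[OF U nbhdsD(1)[OF V]] restr_in'[OF pP U a V] b c] r
        unfolding smash_eq[of Q, symmetric] y by (intro bexI[OF _ V]) (simp add: x restr_open_sprod)
    qed
  qed
  show ?thesis
  proof (rule natural_eqI_local[OF F g Z _ U t])
    fix U x u assume U: "complex_space U" and x: "x \<in> sections (level (fst (smash P ?T)) n) U" and u: "u \<in> points U"
    show "\<exists>V\<in>nbhds U u. g (U \<restriction>\<^sub>o V) (restr_open (level (fst (smash P ?T)) n) U V (points U) x) = z (U \<restriction>\<^sub>o V)"
    proof (rule pquot_local[OF pY wY U x[unfolded smash_eq[of P]] u])
      fix V assume V: "V \<in> nbhds U u"
        and r: "restr_open (level (fst (pquot ?Y (wedge P ?T))) n) U V (points U) x = snd (pquot ?Y (wedge P ?T)) n (U \<restriction>\<^sub>o V) SPt"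
      show ?thesis
        using base[OF complex_space_open_sub[OF U nbhdsD(1)[OF V]]] r
        unfolding smash_eq[of P, symmetric] by (intro bexI[OF _ V]) simp
    next
      fix V y assume V: "V \<in> nbhds U u" and y: "y \<in> sections (level ?Y n) (U \<restriction>\<^sub>o V)"
        and r: "restr_open (level (fst (pquot ?Y (wedge P ?T))) n) U V (points U) x = ?qS (U \<restriction>\<^sub>o V) y"
      show ?thesis
        using step3[OF complex_space_open_sub[OF U nbhdsD(1)[OF V]] y] r
        unfolding smash_eq[of P, symmetric] by (intro bexI[OF _ V]) simp
    qed
  qed
qed

section \<open>Pointed homotopy classes of maps from suspensions\<close>

context localizable
begin

lemma zz_equiv_cancel_right:
  assumes w: "w \<in> W X Y" and XY: "X \<in> Ob C" "Y \<in> Ob C" and p: "zigzag C W A p X" and q: "zigzag C W A q X"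
    and eq: "zz_equiv C W A Y (p @ [Fwd X Y w]) (q @ [Fwd X Y w])"
  shows "zz_equiv C W A X p q"
proof -
  have m: "elem_move C W X X [Fwd X Y w, Bwd Y X w] []" using XY w by (rule move_fb)
  have c: "zz_equiv C W A X (r @ [Fwd X Y w] @ [Bwd Y X w]) r" if "zigzag C W A r X" for r
    using zz_equiv_append_left[OF zz_equiv_elem[OF m] that] by simp
  have "zz_equiv C W A X (p @ [Fwd X Y w] @ [Bwd Y X w]) (q @ [Fwd X Y w] @ [Bwd Y X w])"
    using zz_equiv_append_right[OF eq zigzag_Bwd[OF XY(2,1) w]] by simp
  then show ?thesis
    using c[OF p] c[OF q] by (blast intro: zze_trans zze_sym)
qed

end

lemma PSSh_simps [simp]:
  "(X, x) \<in> Ob PSSh \<longleftrightarrow> is_ssheaf X \<and> x \<in> ss_hom spt X"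
  "Hom PSSh (X, x) (Y, y) = {f \<in> ss_hom X Y. ss_comp spt f x = y}"
  "Idt PSSh (X, x) = ss_id X" "Cmp PSSh (X, x) = ss_comp X"
  by (simp_all add: PSSh_def)

lemma is_ssheaf_spt: "is_ssheaf spt"
  unfolding spt_def
proof (rule is_ssheaf_const_ss, rule is_sheafI)
  show "is_presheaf \<lparr>sections = \<lambda>U. {SPt}, restr = \<lambda>U V f s. s\<rparr>" by (rule is_presheafI) auto
qed (auto simp: restr_open_def)

lemma localizable_PSSh: "localizable PSSh pointed_C_weq"
proof
  fix X :: "('q, 'b) pssh" assume "X \<in> Ob PSSh"
  then show "Idt PSSh X \<in> Hom PSSh X X"
    by (cases X) (simp add: ss_id_in ss_id_comp is_ssheaf_spt)
next
  fix X Y Z :: "('q, 'b) pssh" and f g assume "X \<in> Ob PSSh" "Y \<in> Ob PSSh" "Z \<in> Ob PSSh" "f \<in> Hom PSSh X Y" "g \<in> Hom PSSh Y Z"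
  moreover obtain X' x Y' y Z' z where "X = (X', x)" "Y = (Y', y)" "Z = (Z', z)" by fastforce
  ultimately show "Cmp PSSh X g f \<in> Hom PSSh X Z"
    using ss_comp_assoc[OF is_ssheaf_spt, where Y = X' and f = x and Z = Y' and g = f and V = Z' and h = g]
      ss_comp_in[of X' f Y' g Z'] by simp
next
  fix X Y Z V :: "('q, 'b) pssh" and f g h assume "X \<in> Ob PSSh" "Y \<in> Ob PSSh" "Z \<in> Ob PSSh" "V \<in> Ob PSSh"
    "f \<in> Hom PSSh X Y" "g \<in> Hom PSSh Y Z" "h \<in> Hom PSSh Z V"
  moreover obtain X' x Y' y Z' z V' v where "X = (X', x)" "Y = (Y', y)" "Z = (Z', z)" "V = (V', v)" by fastforce
  ultimately show "Cmp PSSh X h (Cmp PSSh X g f) = Cmp PSSh X (Cmp PSSh Y h g) f"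
    using ss_comp_assoc[where X = X' and Y = Y' and f = f and Z = Z' and g = g and V = V' and h = h] by simp
next
  fix X Y :: "('q, 'b) pssh" and f assume "X \<in> Ob PSSh" "Y \<in> Ob PSSh" "f \<in> Hom PSSh X Y"
  then show "Cmp PSSh X f (Idt PSSh X) = f" "Cmp PSSh X (Idt PSSh Y) f = f"
    by (cases X; cases Y; auto simp: ss_comp_id ss_id_comp)+
qed (simp add: pointed_C_weq_def)

definition null_mor :: "('q, 'b) pssh \<Rightarrow> ('q, 'b) pssh \<Rightarrow> ('q, 'b) ssh_mor" where
  "null_mor P Q = norm_mor (fst P) (\<lambda>n U _. snd Q n U SPt)"

lemma null_mor_in:
  assumes P: "P \<in> Ob PSSh" and Q: "Q \<in> Ob PSSh"
  shows "null_mor P Q \<in> Hom PSSh P Q"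
proof -
  obtain X x Y y where XY: "P = (X, x)" "Q = (Y, y)" by fastforce
  then have X: "is_ssheaf X" "x \<in> ss_hom spt X" and Y: "is_ssheaf Y" "y \<in> ss_hom spt Y" using P Q by auto
  have "norm_mor X (\<lambda>n U _. y n U SPt) \<in> ss_hom X Y"
  proof (rule norm_mor_in_ss_hom[OF X(1)])
    show "natural (level X n) (level Y n) (\<lambda>U _. y n U SPt)" for n
      using natural_in[OF ss_hom_natural[OF Y(2)]] natural_restr[OF ss_hom_natural[OF Y(2)]]
      by (intro naturalI) simp_all
    show "y m U SPt = oper Y m n \<alpha> U (y n U SPt)" if "\<alpha> \<in> delta m n" "complex_space U" for m n \<alpha> U
      using ss_hom_oper[OF Y(2) that, of SPt] by (simp add: spt_def)
  qed
  moreover have "ss_comp spt (norm_mor X (\<lambda>n U _. y n U SPt)) x = y"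
    using ss_comp_in[OF is_ssheaf_spt X(2) calculation] Y(2)
  proof (rule ss_hom_eqI)
    show "ss_comp spt (norm_mor X (\<lambda>n U _. y n U SPt)) x n U s = y n U s"
      if "complex_space U" "s \<in> sections (level spt n) U" for n U s
      using that ss_hom_in[OF X(2) that] by (simp add: ss_comp_apply norm_mor_apply)
  qed
  ultimately show ?thesis by (simp add: XY null_mor_def)
qed

text \<open>Uniqueness of strict pointed maps for every base point \<open>z\<close> of
  \<open>F\<close>. That \<open>S\<close> is an object is a hypothesis here; where the property is
  applied, it comes from a zigzag starting at \<open>S\<close>.\<close>

definition hyperbolically_trivial :: "('q, 'b) pssh \<Rightarrow> bool" where
  "hyperbolically_trivial S \<longleftrightarrow> (\<forall>F z g h. is_sheaf F \<and> hyperbolic (const_ss F) \<and> S \<in> Ob PSSh \<and> (const_ss F, z) \<in> Ob PSSh \<and>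
     g \<in> Hom PSSh S (const_ss F, z) \<and> h \<in> Hom PSSh S (const_ss F, z) \<longrightarrow> g = h)"

lemma hyperbolically_trivial_suspension:
  fixes P Q :: "('q, 'b) pssh"
  assumes P: "\<And>n. pointed_presheaf n P" and Q: "\<And>n. pointed_presheaf n Q"
  shows "hyperbolically_trivial (smash P (smash Q S1_par))"
proof -
  let ?S = "smash P (smash Q S1_par)"
  obtain S s where S: "?S = (S, s)" by fastforce
  have "g = h" if F: "is_sheaf F" "hyperbolic (const_ss F)" and s: "is_ssheaf S" "s \<in> ss_hom spt S" and z: "z \<in> ss_hom spt (const_ss F)"
    and g: "g \<in> ss_hom S (const_ss F)" "ss_comp spt g s = z" and h: "h \<in> ss_hom S (const_ss F)" "ss_comp spt h s = z" for F z g h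
  proof (rule ss_hom_eqI[OF g(1) h(1)])
    fix n U t assume U: "complex_space U" and t: "t \<in> sections (level S n) U"
    have const: "k n U t = z n U SPt" if k: "k \<in> ss_hom S (const_ss F)" "ss_comp spt k s = z" for k
    proof (rule suspension_map_constant[OF F P Q, where n = n and z = "\<lambda>U. z n U SPt" and g = "k n"])
      show "natural (level (fst ?S) n) F (k n)" using const_hom_natural[OF k(1)] by (simp add: S)
      have "natural (level spt n) F (z n)" using const_hom_natural[OF z] .
      then show "natural (level spt n) F (\<lambda>U _. z n U SPt)" unfolding natural_def by simp
      show "k n U (snd ?S n U SPt) = z n U SPt" if "complex_space U" for U
        using that by (simp add: S k(2)[symmetric] ss_comp_apply)
      show "complex_space U" "t \<in> sections (level (fst ?S) n) U" using U t by (simp_all add: S)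
    qed
    show "g n U t = h n U t" using const[OF g] const[OF h] by simp
  qed
  then show ?thesis unfolding hyperbolically_trivial_def S by auto
qed

text \<open>The extension \<open>h\<close> of the underlying map is automatically pointed: the base
  point of \<open>Q\<close> is the image under \<open>w\<close> of that of \<open>P\<close>, so
  \<open>h\<close> takes it where \<open>g\<close> takes the latter.\<close>

lemma pointed_C_weq_extend:
  assumes F: "is_sheaf F" "hyperbolic (const_ss F)"
    and P: "P \<in> Ob PSSh" and Q: "Q \<in> Ob PSSh" and w: "w \<in> pointed_C_weq P Q" and g: "g \<in> Hom PSSh P (const_ss F, z)"
  shows "\<exists>h\<in>Hom PSSh Q (const_ss F, z). g = Cmp PSSh P h w"
proof -
  obtain X x Y y where XY: "P = (X, x)" "Q = (Y, y)" by fastforce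
  then have X: "is_ssheaf X" "x \<in> ss_hom spt X" and Y: "is_ssheaf Y" "y \<in> ss_hom spt Y"
    and w: "w \<in> ss_hom X Y" "ss_comp spt w x = y" "w \<in> C_weq X Y" and g: "g \<in> ss_hom X (const_ss F)" "ss_comp spt g x = z"
    using P Q w g by (auto simp: pointed_C_weq_def)
  obtain h where h: "h \<in> ss_hom Y (const_ss F)" "g = ss_comp X h w"
    using C_weq_const_bij[OF F X(1) Y(1) w(3)] g(1) unfolding bij_betw_def by (metis (no_types, lifting) imageE)
  have "ss_comp spt h y = z"
    using ss_comp_assoc[OF is_ssheaf_spt X(1) X(2) w(1) h(1)] g(2) w(2) h(2) by simp
  then show ?thesis using h by (auto simp: XY)
qed

text \<open>Pointing \<open>F\<close> by the image \<open>z\<close> of \<open>x\<close> makes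
  \<open>\<phi>\<close> a pointed equivalence, whatever \<open>x\<close> is. After composition with
  \<open>\<phi>\<close> both \<open>c\<close> and the null class straighten to strict maps from
  \<open>S\<close> to \<open>F\<close>; these coincide, and \<open>\<phi>\<close> cancels.\<close>

lemma H_hom_trivial:
  assumes S: "hyperbolically_trivial S" and F: "is_sheaf F" "hyperbolic (const_ss F)"
    and \<phi>: "\<phi> \<in> C_weq X (const_ss F)" and c: "c \<in> H_hom S (X, x)"
  shows "c = H_null S (X, x)"
proof -
  interpret L: localizable PSSh pointed_C_weq by (rule localizable_PSSh)
  let ?P = "(X, x)"
  obtain p where p: "zigzag PSSh pointed_C_weq S p ?P" "c = L.zz_class S ?P p"
    using c unfolding H_hom_def L.loc_hom_eq by blast
  \<comment> \<open>A zigzag passes through objects only, so its existence shows that the sphere is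
    a pointed simplicial sheaf.\<close>
  have SP: "S \<in> Ob PSSh" "?P \<in> Ob PSSh" using L.zigzag_Ob[OF p(1)] .
  then have X: "is_ssheaf X" "x \<in> ss_hom spt X" by auto
  have \<phi>h: "\<phi> \<in> ss_hom X (const_ss F)" using \<phi> by (simp add: C_weq_def)
  define z where "z = ss_comp spt \<phi> x"
  let ?Q = "(const_ss F, z)"
  have Q: "?Q \<in> Ob PSSh"
    using ss_comp_in[OF is_ssheaf_spt X(2) \<phi>h] is_ssheaf_const_ss[OF F(1)] by (simp add: z_def)
  have w: "\<phi> \<in> pointed_C_weq ?P ?Q" using \<phi> \<phi>h by (simp add: pointed_C_weq_def z_def)
  note \<phi>Q = L.zigzag_Fwd[OF SP(2) Q L.W_hom[OF w]]
  let ?n = "[Fwd S ?P (null_mor S ?P)]"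
  have n: "zigzag PSSh pointed_C_weq S ?n ?P" by (rule L.zigzag_Fwd[OF SP null_mor_in[OF SP]])
  have straight: "\<exists>g\<in>Hom PSSh S ?Q. zz_equiv PSSh pointed_C_weq S ?Q q [Fwd S ?Q g]"
    if "zigzag PSSh pointed_C_weq S q ?Q" for q
    using that by (rule L.zigzag_straighten) (rule pointed_C_weq_extend[OF F])
  obtain g where g: "g \<in> Hom PSSh S ?Q" "zz_equiv PSSh pointed_C_weq S ?Q (p @ [Fwd ?P ?Q \<phi>]) [Fwd S ?Q g]"
    using straight[OF L.zigzag_append[OF p(1) \<phi>Q]] by blast
  obtain h where h: "h \<in> Hom PSSh S ?Q" "zz_equiv PSSh pointed_C_weq S ?Q (?n @ [Fwd ?P ?Q \<phi>]) [Fwd S ?Q h]"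
    using straight[OF L.zigzag_append[OF n \<phi>Q]] by blast
  have "g = h" using S F SP(1) Q g(1) h(1) unfolding hyperbolically_trivial_def by blast
  then have "zz_equiv PSSh pointed_C_weq S ?Q (p @ [Fwd ?P ?Q \<phi>]) (?n @ [Fwd ?P ?Q \<phi>])"
    using g(2) h(2) by (blast intro: zze_trans zze_sym)
  then have "zz_equiv PSSh pointed_C_weq S ?P p ?n"
    by (rule L.zz_equiv_cancel_right[OF w SP(2) Q p(1) n])
  then have "c = L.zz_class S ?P ?n"
    using L.zz_class_eq_iff[OF n] p(2) by blast
  then show ?thesis
    unfolding L.zz_class_Fwd H_null_def null_mor_def by simp
qed

lemma pointed_presheaf_circles: "pointed_presheaf n S1_par" "pointed_presheaf n (S1_iper z1 z2)"
  by (simp_all add: S1_par_def S1_iper_def pointed_presheaf_two_point_quot)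

lemma hyperbolically_trivial_par_sphere: "i > j \<Longrightarrow> hyperbolically_trivial (par_sphere i j)"
  unfolding par_sphere_def
  by (cases "i - j")
     (auto intro!: hyperbolically_trivial_suspension pointed_presheaf_smash_power pointed_presheaf_Gm pointed_presheaf_circles)

lemma hyperbolically_trivial_iper_sphere: "m > 0 \<Longrightarrow> hyperbolically_trivial (iper_sphere z1 z2 n m)"
  unfolding iper_sphere_def
  by (cases m)
     (auto intro!: hyperbolically_trivial_suspension pointed_presheaf_smash_power pointed_presheaf_circles)

lemma homotopy_trivial_if_C_weq_hyperbolic:
  assumes "is_sheaf F" "hyperbolic (const_ss F)" "\<phi> \<in> C_weq X (const_ss F)"
  shows "i > j \<Longrightarrow> \<not> pi_par_nonzero i j (X, x)" "m > 0 \<Longrightarrow> \<not> pi_iper_nonzero z1 z2 n m (X, x)"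
  using H_hom_trivial[OF _ assms] hyperbolically_trivial_par_sphere hyperbolically_trivial_iper_sphere
  unfolding pi_par_nonzero_def pi_par_def pi_iper_nonzero_def pi_iper_def by blast+

text \<open>
  An isomorphism \<open>X \<cong> F\<close> in the localization is the class of an actual map since \<open>F\<close> is discrete, and
  this map is a weak equivalence since the latter are saturated.
\<close>

lemma C_weq_if_loc_iso_const:
  fixes X :: "('q, 'b) ssh"
  assumes F: "is_sheaf F" "hyperbolic (const_ss F)" and X: "is_ssheaf X" and iso: "loc_iso SSh C_weq X (const_ss F)"
  obtains \<phi> where "\<phi> \<in> C_weq X (const_ss F)"
proof -
  interpret L: localizable SSh C_weq by (rule localizable_C_weq)
  let ?F = "const_ss F"
  have F': "is_ssheaf ?F" by (rule is_ssheaf_const_ss[OF F(1)])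
  obtain p q where pq: "zigzag SSh C_weq X p ?F" "zigzag SSh C_weq ?F q X"
    "zz_equiv SSh C_weq X X (p @ q) []" "zz_equiv SSh C_weq ?F ?F (q @ p) []"
    using iso unfolding loc_iso_def by blast
  have "\<exists>g\<in>Hom SSh X ?F. zz_equiv SSh C_weq X ?F p [Fwd X ?F g]"
    using pq(1)
  proof (rule L.zigzag_straighten)
    fix X Y :: "('q, 'b) ssh" and w g assume "X \<in> Ob SSh" "Y \<in> Ob SSh" "w \<in> C_weq X Y" "g \<in> Hom SSh X ?F"
    then have "bij_betw (\<lambda>g. ss_comp X g w) (ss_hom Y ?F) (ss_hom X ?F)" "g \<in> ss_hom X ?F"
      using C_weq_const_bij[OF F] by auto
    then show "\<exists>h\<in>Hom SSh Y ?F. g = Cmp SSh X h w" unfolding bij_betw_def by auto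
  qed
  then obtain \<phi> where \<phi>: "\<phi> \<in> ss_hom X ?F" "zz_equiv SSh C_weq X ?F p [Fwd X ?F \<phi>]" by auto
  have "bij_betw (loc_precomp SSh swe X ?F Z \<phi>) (loc_hom SSh swe ?F Z) (loc_hom SSh swe X Z)" if Z: "hyperbolic Z" for Z
  \<comment> \<open>Two localizations are in play: the functor consists of Homs into
    \<open>Z\<close> in the one at \<open>swe\<close>, and the invertible zigzag belongs to the one
    at \<open>C_weq\<close>.\<close>
  proof (rule loc_precomp_bij_saturated[OF localizable_swe localizable_C_weq _ _ _ _ pq \<phi>(2)])
    fix X Y :: "('q, 'b) ssh" and w assume "w \<in> C_weq X Y"
    then show "bij_betw (loc_precomp SSh swe X Y Z w) (loc_hom SSh swe Y Z) (loc_hom SSh swe X Z)"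
      using Z by (simp add: C_weq_def)
  qed (use X F' \<phi> in auto)
  then have "\<phi> \<in> C_weq X ?F" using \<phi>(1) by (simp add: C_weq_def)
  then show ?thesis by (rule that)
qed

text \<open>Transfers an equivalence from the resolution to \<open>X\<close> itself: the zigzags are
  extended by \<open>r\<close> and by its formal inverse.\<close>

lemma loc_iso_precomp_C_weq:
  assumes X: "is_ssheaf X" and Y: "is_ssheaf Y" and r: "r \<in> C_weq X Y" and iso: "loc_iso SSh C_weq Y Z"
  shows "loc_iso SSh C_weq X Z"
proof -
  interpret L: localizable SSh C_weq by (rule localizable_C_weq)
  obtain p q where pq: "zigzag SSh C_weq Y p Z" "zigzag SSh C_weq Z q Y"
    "zz_equiv SSh C_weq Y Y (p @ q) []" "zz_equiv SSh C_weq Z Z (q @ p) []"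
    using iso unfolding loc_iso_def by blast
  have XY: "X \<in> Ob SSh" "Y \<in> Ob SSh" using X Y by auto
  have r1: "zigzag SSh C_weq X [Fwd X Y r] Y" using L.zigzag_Fwd[OF XY L.W_hom[OF r]] .
  have r2: "zigzag SSh C_weq Y [Bwd Y X r] X" using L.zigzag_Bwd[OF XY(2,1) r] .
  have m1: "elem_move SSh C_weq X X [Fwd X Y r, Bwd Y X r] []" using XY r by (rule move_fb)
  have m2: "elem_move SSh C_weq Y Y [Bwd Y X r, Fwd X Y r] []" using XY r by (rule move_bf)
  have "zz_equiv SSh C_weq X X ([Fwd X Y r] @ (p @ q) @ [Bwd Y X r]) ([Fwd X Y r] @ [] @ [Bwd Y X r])"
    by (intro L.zz_equiv_append_left[OF _ r1] L.zz_equiv_append_right[OF _ r2] pq(3))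
  then have "zz_equiv SSh C_weq X X (([Fwd X Y r] @ p) @ (q @ [Bwd Y X r])) []"
    using L.zz_equiv_elem[OF m1] by (auto intro: zze_trans)
  moreover have "zz_equiv SSh C_weq Z Z (q @ ([Bwd Y X r, Fwd X Y r] @ p)) (q @ ([] @ p))"
    by (intro L.zz_equiv_append_left[OF _ pq(2)] L.zz_equiv_append_right[OF _ pq(1)] L.zz_equiv_elem m2)
  then have "zz_equiv SSh C_weq Z Z ((q @ [Bwd Y X r]) @ ([Fwd X Y r] @ p)) []"
    using pq(4) by (auto intro: zze_trans)
  ultimately show ?thesis
    unfolding loc_iso_def using L.zigzag_append[OF r1 pq(1)] L.zigzag_append[OF pq(2) r2] by blast
qed

text \<open>The identity represents the empty zigzag, which is invertible, so saturation
  applies.\<close>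

lemma ss_id_C_weq:
  assumes "is_ssheaf X"
  shows "ss_id X \<in> C_weq X X"
proof -
  interpret L: localizable SSh C_weq by (rule localizable_C_weq)
  have X: "X \<in> Ob SSh" using assms by simp
  have nil: "zigzag SSh C_weq X [] X" using X by (rule zz_nil)
  have "zz_equiv SSh C_weq X X [] [Fwd X X (ss_id X)]"
    using zze_sym[OF L.zz_equiv_elem[OF move_id[where C = SSh and X = X and W = C_weq, OF X]]] by simp
  then have "bij_betw (loc_precomp SSh swe X X Z (ss_id X)) (loc_hom SSh swe X Z) (loc_hom SSh swe X Z)"
    if "hyperbolic Z" for Z
    using loc_precomp_bij_saturated[OF localizable_swe localizable_C_weq _ X X _ nil nil, of Z "ss_id X"]
      that ss_id_in[OF assms] zze_refl[OF nil] by (simp add: C_weq_def)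
  then show ?thesis using ss_id_in[OF assms] by (simp add: C_weq_def)
qed

section \<open>The complex line and Brody hyperbolicity\<close>

text \<open>\<open>Cn_holomorphic\<close> divides by the modulus of the increment, the complex
  derivative by the increment itself. The two quotients have the same norm, so they tend to 0
  together.\<close>

lemma has_field_derivative_iff_little_o:
  fixes F :: "complex \<Rightarrow> complex"
  shows "(F has_field_derivative D) (at z within S) \<longleftrightarrow>
    ((\<lambda>y. (F y - F z - D * (y - z)) / of_real (cmod (y - z))) \<longlongrightarrow> 0) (at z within S)"
proof -
  have "(F has_field_derivative D) (at z within S) \<longleftrightarrow>
      ((\<lambda>y. norm ((F y - F z) / (y - z) - D)) \<longlongrightarrow> 0) (at z within S)"
    unfolding has_field_derivative_iff by (simp add: tendsto_norm_zero_iff LIM_zero_iff)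
  also have "\<dots> \<longleftrightarrow> ((\<lambda>y. norm ((F y - F z - D * (y - z)) / of_real (cmod (y - z)))) \<longlongrightarrow> 0) (at z within S)"
  proof (rule tendsto_cong)
    have "norm ((F y - F z) / (y - z) - D) = norm ((F y - F z - D * (y - z)) / of_real (cmod (y - z)))" if "y \<noteq> z" for y
    proof -
      have "(F y - F z) / (y - z) - D = (F y - F z - D * (y - z)) / (y - z)"
        using that by (simp add: field_simps)
      then show ?thesis by (simp add: norm_divide)
    qed
    then show "\<forall>\<^sub>F y in at z within S. norm ((F y - F z) / (y - z) - D) =
        norm ((F y - F z - D * (y - z)) / of_real (cmod (y - z)))"
      by (simp add: eventually_at_filter)
  qed
  finally show ?thesis by (simp only: tendsto_norm_zero_iff)
qed

text \<open>The identification of the complex numbers with \<open>Cn 1\<close>; its inverse is the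
  coordinate with index 0.\<close>

definition line_pt :: "complex \<Rightarrow> nat \<Rightarrow> complex" where
  "line_pt z = (\<lambda>i. if i = 0 then z else 0)"

lemma line_pt_0 [simp]: "line_pt z 0 = z"
  by (simp add: line_pt_def)

lemma line_pt_Cn: "line_pt z \<in> Cn 1"
  by (simp add: line_pt_def Cn_def)

lemma line_pt_coord: "w \<in> Cn 1 \<Longrightarrow> line_pt (w 0) = w"
  by (auto simp: line_pt_def Cn_def fun_eq_iff)

lemma continuous_on_line_pt: "continuous_on UNIV line_pt"
proof (rule continuous_on_coordinatewise_then_product)
  show "continuous_on UNIV (\<lambda>z. line_pt z i)" for i
    by (cases "i = 0") (simp_all add: line_pt_def)
qed

text \<open>Limits at a point leave out the point itself, so substitution into them relies on the
  injectivity of \<open>line_pt\<close>.\<close>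

lemma filterlim_line_pt: "filterlim line_pt (at (line_pt z) within line_pt ` S) (at z within S)"
proof -
  have "(line_pt \<longlongrightarrow> line_pt z) (at z within S)"
    using continuous_on_line_pt[unfolded continuous_on_def, rule_format, OF UNIV_I] subset_UNIV
    by (rule tendsto_within_subset)
  moreover have "line_pt y \<noteq> line_pt z" if "y \<noteq> z" for y
    using that by (auto dest: fun_cong[of _ _ 0])
  then have "\<forall>\<^sub>F y in at z within S. line_pt y \<in> line_pt ` S \<and> line_pt y \<noteq> line_pt z"
    by (auto simp: eventually_at_filter)
  ultimately show ?thesis by (auto simp: filterlim_at)
qed

text \<open>Inside \<open>Cn 1\<close> the coordinate 0 is injective, hence it maps punctured
  neighbourhoods to punctured ones.\<close>

lemma filterlim_coord: "W \<subseteq> Cn 1 \<Longrightarrow> a \<in> W \<Longrightarrow> filterlim (\<lambda>w. w 0) (at (a 0) within (\<lambda>w. w 0) ` W) (at a within W)"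
proof -
  assume W: "W \<subseteq> Cn 1" "a \<in> W"
  have "((\<lambda>w :: nat \<Rightarrow> complex. w 0) \<longlongrightarrow> a 0) (at a within W)"
    using continuous_on_product_coordinates[of "0 :: nat", unfolded continuous_on_def, rule_format, OF UNIV_I] subset_UNIV
    by (rule tendsto_within_subset)
  moreover have "w 0 \<noteq> a 0" if "w \<in> W" "w \<noteq> a" for w
    using W that line_pt_coord by (metis subsetD)
  then have "\<forall>\<^sub>F w in at a within W. w 0 \<in> (\<lambda>w. w 0) ` W \<and> w 0 \<noteq> a 0"
    by (auto simp: eventually_at_filter)
  ultimately show ?thesis by (auto simp: filterlim_at)
qed

lemma Cn_holomorphic_coord:
  assumes W: "W \<subseteq> Cn 1" and F: "F holomorphic_on (\<lambda>w. w 0) ` W"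
  shows "Cn_holomorphic 1 W (\<lambda>w. F (w 0))"
  unfolding Cn_holomorphic_def
proof
  fix a assume a: "a \<in> W"
  then obtain D where "(F has_field_derivative D) (at (a 0) within (\<lambda>w. w 0) ` W)"
    using F by (auto simp: holomorphic_on_def field_differentiable_def)
  from filterlim_compose[OF this[unfolded has_field_derivative_iff_little_o] filterlim_coord[OF W a]]
  show "\<exists>c. ((\<lambda>z. (F (z 0) - F (a 0) - (\<Sum>i<1. c i * (z i - a i))) / of_real (\<Sum>i<1. cmod (z i - a i))) \<longlongrightarrow> 0) (at a within W)"
    by (intro exI[of _ "\<lambda>_. D"]) simp
qed

lemma holomorphic_on_line_pt:
  assumes h: "Cn_holomorphic 1 W h" and S: "line_pt ` S \<subseteq> W"
  shows "(\<lambda>z. h (line_pt z)) holomorphic_on S"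
  unfolding holomorphic_on_def
proof
  fix z assume z: "z \<in> S"
  then obtain c where "((\<lambda>w. (h w - h (line_pt z) - (\<Sum>i<1. c i * (w i - line_pt z i))) / of_real (\<Sum>i<1. cmod (w i - line_pt z i)))
      \<longlongrightarrow> 0) (at (line_pt z) within W)"
    using h S unfolding Cn_holomorphic_def by blast
  then have "((\<lambda>w. (h w - h (line_pt z) - (\<Sum>i<1. c i * (w i - line_pt z i))) / of_real (\<Sum>i<1. cmod (w i - line_pt z i)))
      \<longlongrightarrow> 0) (at (line_pt z) within line_pt ` S)"
    using S by (rule tendsto_within_subset)
  from filterlim_compose[OF this filterlim_line_pt]
  have "((\<lambda>y. h (line_pt y)) has_field_derivative c 0) (at z within S)"
    unfolding has_field_derivative_iff_little_o by simp
  then show "(\<lambda>z. h (line_pt z)) field_differentiable at z within S"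
    unfolding field_differentiable_def by blast
qed

section \<open>The affine line as a complex space\<close>

lemma funs_cline: "f \<in> funs cline V \<longleftrightarrow> f \<in> extensional V \<and> (\<lambda>z. f (Inl z)) holomorphic_on (Inl -` V)"
  by (simp add: cline_def)

text \<open>A single chart with no equations suffices; locally extending functions on it are the
  holomorphic ones because \<open>line_pt\<close> and the coordinate transport derivatives.\<close>

lemma local_model_cline:
  "local_model (cline :: 'q pts cspace) (range Inl) 1 (Cn 1) {} (\<lambda>p. line_pt (projl p))"
  unfolding local_model_def
proof (intro conjI allI impI; (elim conjE)?)
  let ?\<phi> = "\<lambda>p :: 'q pts. line_pt (projl p)"
  let ?T = "ctop (cline :: 'q pts cspace)"
  have rng: "subtopology ?T (range Inl) = ?T"
    using subtopology_topspace[of ?T] by (simp add: points_cline)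
  show "openin ?T (range Inl)" using openin_topspace[of ?T] by (simp add: points_cline)
  show "Cn_open 1 (Cn 1)" by (simp add: Cn_open_def)
  show "finite {}" "\<forall>g\<in>{}. Cn_holomorphic 1 (Cn 1) g" by auto
  have "continuous_map ?T (top_of_set (Cn 1)) ?\<phi>"
  proof -
    have "openin ?T {p \<in> topspace ?T. ?\<phi> p \<in> S}" if "open S" for S
    proof -
      have "open (line_pt -` S)" using continuous_on_line_pt that by (simp add: open_vimage)
      moreover have "Inl -` {p \<in> topspace ?T. ?\<phi> p \<in> S} = line_pt -` S" by (auto simp: points_cline)
      ultimately show ?thesis by (auto simp: openin_cline points_cline)
    qed
    then have "continuous_map ?T euclidean ?\<phi>" by (simp add: continuous_map_def)
    then show ?thesis using line_pt_Cn by (auto simp: continuous_map_in_subtopology)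
  qed
  moreover have "continuous_map (top_of_set (Cn 1)) ?T (\<lambda>w. Inl (w 0))"
    unfolding continuous_map_def
  proof (intro conjI allI impI funcsetI)
    fix S assume "openin ?T S"
    then have "open (Inl -` S :: complex set)" by (simp add: openin_cline)
    then have "open ((\<lambda>w :: nat \<Rightarrow> complex. w 0) -` Inl -` S)"
      by (rule open_vimage) (rule continuous_on_product_coordinates)
    moreover have "{w \<in> topspace (top_of_set (Cn 1)). Inl (w 0) \<in> S} = Cn 1 \<inter> ((\<lambda>w. w 0) -` Inl -` S)" by auto
    ultimately show "openin (top_of_set (Cn 1)) {w \<in> topspace (top_of_set (Cn 1)). Inl (w 0) \<in> S}"
      by (simp add: openin_open_Int)
  qed (simp add: points_cline)
  ultimately have "homeomorphic_maps ?T (top_of_set (Cn 1)) ?\<phi> (\<lambda>w. Inl (w 0))"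
    by (auto simp: homeomorphic_maps_def points_cline line_pt_coord)
  then have "homeomorphic_map ?T (top_of_set (Cn 1)) ?\<phi>" by (rule homeomorphic_maps_imp_map)
  then show "homeomorphic_map (subtopology ?T (range Inl)) (top_of_set {z \<in> Cn 1. \<forall>g\<in>{}. g z = 0}) ?\<phi>"
    by (simp add: rng)
next
  let ?\<phi> = "\<lambda>p :: 'q pts. line_pt (projl p)"
  fix V :: "'q pts set" and f assume V: "openin (ctop cline) V"
  let ?V = "Inl -` V :: complex set"
  have oV: "open ?V" and rV: "V \<subseteq> range Inl" using V by (simp_all add: openin_cline)
  have open_W: "Cn_open 1 {w \<in> Cn 1. w 0 \<in> A}" if "open A" for A :: "complex set"
  proof -
    have "open ((\<lambda>w :: nat \<Rightarrow> complex. w 0) -` A)"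
      using that by (rule open_vimage) (rule continuous_on_product_coordinates)
    moreover have "{w \<in> Cn 1. w 0 \<in> A} = Cn 1 \<inter> ((\<lambda>w. w 0) -` A)" by auto
    ultimately show ?thesis by (simp add: Cn_open_def openin_open_Int)
  qed
  show "f \<in> funs cline V \<longleftrightarrow> f \<in> extensional V \<and>
      (\<forall>p\<in>V. \<exists>W' h. Cn_open 1 W' \<and> ?\<phi> p \<in> W' \<and> Cn_holomorphic 1 W' h \<and> (\<forall>q\<in>V. ?\<phi> q \<in> W' \<longrightarrow> f q = h (?\<phi> q)))"
    (is "_ \<longleftrightarrow> _ \<and> ?R")
  proof (intro iffI conjI)
    assume f: "f \<in> funs cline V"
    then show "f \<in> extensional V" by (simp add: funs_cline)
    let ?W = "{w \<in> Cn 1. w 0 \<in> ?V}" and ?h = "\<lambda>w :: nat \<Rightarrow> complex. f (Inl (w 0))"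
    have "Cn_holomorphic 1 ?W ?h"
    proof (rule Cn_holomorphic_coord)
      show "(\<lambda>z. f (Inl z)) holomorphic_on (\<lambda>w. w 0) ` ?W"
        using f by (rule holomorphic_on_subset[OF conjunct2[OF iffD1[OF funs_cline]]]) auto
    qed auto
    moreover have "?\<phi> p \<in> ?W" if "p \<in> V" for p using that rV line_pt_Cn by auto
    moreover have "\<forall>q\<in>V. ?\<phi> q \<in> ?W \<longrightarrow> f q = ?h (?\<phi> q)" using rV by auto
    ultimately show ?R using open_W[OF oV] by blast
  next
    assume R: "f \<in> extensional V \<and> ?R"
    have "\<exists>N. open N \<and> z \<in> N \<and> (\<lambda>z. f (Inl z)) holomorphic_on N" if z: "z \<in> ?V" for z
    proof -
      have zV: "Inl z \<in> V" using z by simp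
      from R[THEN conjunct2, rule_format, OF zV]
      obtain W' h where W': "Cn_open 1 W'" "line_pt z \<in> W'" "Cn_holomorphic 1 W' h"
        "\<forall>q\<in>V. ?\<phi> q \<in> W' \<longrightarrow> f q = h (?\<phi> q)" by auto
      \<comment> \<open>\<open>W'\<close> is open only relative to \<open>Cn 1\<close>. The ambient
        open set \<open>T\<close> cuts it out, and its preimage under \<open>line_pt\<close> gives
        an open neighbourhood of \<open>z\<close>.\<close>
      obtain T where T: "open T" "W' = Cn 1 \<inter> T" using W'(1) by (auto simp: Cn_open_def openin_open)
      let ?N = "?V \<inter> line_pt -` T"
      have oN: "open ?N" using oV open_vimage[OF T(1) continuous_on_line_pt] by (rule open_Int)
      have sub: "line_pt ` ?N \<subseteq> W'" using T(2) line_pt_Cn by auto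
      have "(\<lambda>z. h (line_pt z)) holomorphic_on ?N" by (rule holomorphic_on_line_pt[OF W'(3) sub])
      moreover have "h (line_pt y) = f (Inl y)" if "y \<in> ?N" for y
        using that W'(4)[rule_format, of "Inl y"] subsetD[OF sub imageI[OF that]] by simp
      ultimately have "(\<lambda>z. f (Inl z)) holomorphic_on ?N" by (rule holomorphic_transform)
      moreover have "z \<in> ?N" using z W'(2) T(2) by auto
      ultimately show ?thesis using oN by blast
    qed
    then have "(\<lambda>z. f (Inl z)) field_differentiable at z" if "z \<in> ?V" for z
      using that by (meson holomorphic_on_imp_differentiable_at)
    then have "(\<lambda>z. f (Inl z)) holomorphic_on ?V"
      unfolding holomorphic_on_def by (blast intro: field_differentiable_at_within)
    then show "f \<in> funs cline V" using R by (simp add: funs_cline)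
  qed
qed

lemma complex_space_cline: "complex_space (cline :: 'q pts cspace)"
proof (rule complex_spaceI)
  show "Hausdorff_space (ctop (cline :: 'q pts cspace))"
    unfolding Hausdorff_space_def
  proof (intro allI impI; elim conjE)
    fix x y :: "'q pts" assume xy: "x \<in> points cline" "y \<in> points cline" "x \<noteq> y"
    then obtain a b where ab: "x = Inl a" "y = Inl b" "a \<noteq> b" by (auto simp: points_cline)
    then obtain A B where "open A" "open B" "a \<in> A" "b \<in> B" "A \<inter> B = {}" using hausdorff by metis
    then show "\<exists>A B. openin (ctop cline) A \<and> openin (ctop cline) B \<and> x \<in> A \<and> y \<in> B \<and> disjnt A B"
      unfolding ab
      by (intro exI[of _ "Inl ` A"] exI[of _ "Inl ` B"]) (auto simp: openin_cline inj_vimage_image_eq disjnt_def)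
  qed
next
  fix V :: "'q pts set" and f assume "f \<in> funs cline V"
  then show "f \<in> extensional V" by (simp add: funs_cline)
next
  fix V V' :: "'q pts set" and f assume V: "V' \<subseteq> V" and f: "f \<in> funs cline V"
  have "(\<lambda>z. f (Inl z)) holomorphic_on Inl -` V'"
    using f V by (auto simp: funs_cline intro: holomorphic_on_subset)
  then have "(\<lambda>z. restrict f V' (Inl z)) holomorphic_on Inl -` V'"
    by (rule holomorphic_transform) simp
  then show "restrict f V' \<in> funs cline V'" by (simp add: funs_cline)
next
  fix V :: "'q pts set" and f assume V: "openin (ctop cline) V" and f: "f \<in> extensional V"
    and loc: "\<forall>p\<in>V. \<exists>V'. openin (ctop cline) V' \<and> p \<in> V' \<and> V' \<subseteq> V \<and> restrict f V' \<in> funs cline V'"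
  have "(\<lambda>z. f (Inl z)) field_differentiable at z" if z: "z \<in> Inl -` V" for z
  proof -
    obtain V' where V': "openin (ctop cline) V'" "Inl z \<in> V'" "restrict f V' \<in> funs cline V'" using loc z by auto
    have "(\<lambda>z. restrict f V' (Inl z)) holomorphic_on Inl -` V'" using V'(3) by (simp add: funs_cline)
    then have "(\<lambda>z. f (Inl z)) holomorphic_on Inl -` V'" by (rule holomorphic_transform) simp
    moreover have "open (Inl -` V' :: complex set)" "z \<in> Inl -` V'" using V'(1,2) by (auto simp: openin_cline)
    ultimately show ?thesis by (rule holomorphic_on_imp_differentiable_at)
  qed
  then have "(\<lambda>z. f (Inl z)) holomorphic_on Inl -` V"
    unfolding holomorphic_on_def by (blast intro: field_differentiable_at_within)
  then show "f \<in> funs cline V" using f by (simp add: funs_cline)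
next
  fix p :: "'q pts" assume "p \<in> points cline"
  then show "\<exists>V n W G \<phi>. p \<in> V \<and> local_model cline V n W G \<phi>"
    unfolding points_cline using local_model_cline by blast
qed

text \<open>
  Evaluate \<open>k(s, c)\<close> at \<open>u\<close> by pulling back to \<open>\<complex>\<close> along the constant map with value \<open>u\<close>: the result is the
  value at \<open>c(u)\<close> of a map from \<open>\<complex>\<close> to \<open>X\<close> which only depends on \<open>s\<close> and \<open>u\<close>.
\<close>

lemma Brody_constant_along_line:
  fixes X :: "'q pts cspace" and Y :: "('q, 'b) ssh"
  assumes Br: "Brody_hyperbolic X" and Y: "is_ssheaf Y"
    and k: "natural (level (sprod Y (srep cline)) n) (rep X) k"
    and U: "complex_space U" and s: "s \<in> sections (level Y n) U"
    and c: "c \<in> hol_maps U cline" and c': "c' \<in> hol_maps U cline"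
  shows "k U (SPair s (SHol c)) = k U (SPair s (SHol c'))"
proof -
  let ?C = "cline :: 'q pts cspace"
  note C = complex_space_cline[where 'q = 'q]
  note pY = ssheaf_presheaf[OF Y, of n]
  define \<kappa> :: "'q pts \<Rightarrow> 'q pts \<Rightarrow> 'q pts" where "\<kappa> p = (\<lambda>z\<in>points ?C. p)" for p
  have \<kappa>: "\<kappa> u \<in> hol_maps ?C U" if "u \<in> points U" for u
    unfolding \<kappa>_def using that by (rule hol_maps_const[OF C])
  have \<kappa>C: "\<kappa> w \<in> hol_maps ?C ?C" if "w \<in> points ?C" for w
    unfolding \<kappa>_def using that by (rule hol_maps_const[OF C])
  \<comment> \<open>The value \<open>b\<close> is chosen before \<open>c\<close>, which is the whole
    point: the value at \<open>u\<close> is the same for all maps \<open>c\<close> to the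
    line.\<close>
  have "\<exists>b. \<forall>c f. c \<in> hol_maps U ?C \<longrightarrow> k U (SPair s (SHol c)) = SHol f \<longrightarrow> f u = b" if u: "u \<in> points U" for u
  proof -
    define t where "t = restr (level Y n) ?C U (\<kappa> u) s"
    have t: "t \<in> sections (level Y n) ?C" unfolding t_def by (rule restr_in[OF pY C U \<kappa>[OF u] s])
    have i: "incl (points ?C) \<in> hol_maps ?C ?C" by (rule hol_maps_incl_points[OF C])
    have ti: "SPair t (SHol (incl (points ?C))) \<in> sections (level (sprod Y (srep cline)) n) ?C"
      using t i by (auto simp: sprod_simps)
    \<comment> \<open>The universal case: \<open>G\<close> is the value of \<open>k\<close> at the
      identity of the line, and all pairs of \<open>t\<close> with a constant map are pulled back
      from it.\<close>
    obtain G where G: "k ?C (SPair t (SHol (incl (points ?C)))) = SHol G" "G \<in> hol_maps ?C X"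
      using natural_in[OF k C ti] by auto
    have "f u = G (Inl 0)" if c: "c \<in> hol_maps U ?C" and f: "k U (SPair s (SHol c)) = SHol f" for c f
    proof -
      have w: "c u \<in> points ?C" by (rule hol_mapsD(4)[OF c u])
      have sc: "SPair s (SHol c) \<in> sections (level (sprod Y (srep cline)) n) U"
        using s c by (auto simp: sprod_simps)
      \<comment> \<open>\<open>t\<close> is itself pulled back along a constant map, so pulling it
        back along another constant map leaves it unchanged.\<close>
      have "compose (points ?C) (\<kappa> u) (\<kappa> (c u)) = \<kappa> u" using w by (auto simp: \<kappa>_def compose_def)
      then have "restr (level Y n) ?C ?C (\<kappa> (c u)) t = t"
        unfolding t_def using restr_compose[OF pY C C U \<kappa>C[OF w] \<kappa>[OF u] s] by simp
      moreover have "compose (points ?C) (incl (points ?C)) (\<kappa> (c u)) = \<kappa> (c u)"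
        using w by (auto simp: \<kappa>_def compose_def incl_def)
      ultimately have "k ?C (SPair t (SHol (\<kappa> (c u)))) = SHol (compose (points ?C) G (\<kappa> (c u)))"
        using natural_restr[OF k C C \<kappa>C[OF w] ti] by (simp add: G(1) sprod_simps)
      \<comment> \<open>The same pair is also the pullback of \<open>(s, c)\<close> along the
        constant map \<open>\<kappa> u\<close>, so that its value under \<open>k\<close> reads off
        \<open>f u\<close>.\<close>
      moreover have "compose (points ?C) c (\<kappa> u) = \<kappa> (c u)" by (auto simp: \<kappa>_def compose_def)
      then have "k ?C (SPair t (SHol (\<kappa> (c u)))) = SHol (compose (points ?C) f (\<kappa> u))"
        using natural_restr[OF k C U \<kappa>[OF u] sc] by (simp add: f sprod_simps t_def)
      ultimately have "compose (points ?C) f (\<kappa> u) (c u) = compose (points ?C) G (\<kappa> (c u)) (c u)" by simp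
      then have "f u = G (c u)" using w by (simp add: compose_def \<kappa>_def)
      \<comment> \<open>Here Brody hyperbolicity enters: \<open>G\<close> is an entire curve in
        \<open>X\<close>, so its value at \<open>c u\<close> equals that at 0, which no longer
        involves \<open>c\<close>.\<close>
      also have "\<dots> = G (Inl 0)"
        using Br G(2) w unfolding Brody_hyperbolic_def by (blast intro: points_cline[THEN equalityD2, THEN subsetD])
      finally show ?thesis .
    qed
    then show ?thesis by blast
  qed
  then have val: "f u = f' u" if "u \<in> points U" "k U (SPair s (SHol c)) = SHol f" "k U (SPair s (SHol c')) = SHol f'" for u f f'
    using that c c' by metis
  have "\<exists>f. k U (SPair s (SHol d)) = SHol f \<and> f \<in> hol_maps U X" if "d \<in> hol_maps U ?C" for d
  proof -
    have "SPair s (SHol d) \<in> sections (level (sprod Y (srep cline)) n) U" using s that by (auto simp: sprod_simps)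
    from natural_in[OF k U this] show ?thesis by auto
  qed
  from this[OF c] this[OF c'] obtain f f' where f: "k U (SPair s (SHol c)) = SHol f" "f \<in> hol_maps U X"
      "k U (SPair s (SHol c')) = SHol f'" "f' \<in> hol_maps U X" by blast
  have "f = f'"
    using hol_mapsD(1)[OF f(2)] hol_mapsD(1)[OF f(4)] val[OF _ f(1,3)] by (rule extensionalityI)
  then show ?thesis using f by simp
qed

text \<open>The inverse of composition with the projection is restriction to the zero section. It is
  a one-sided inverse because the zero section splits the projection, and two-sided because maps to
  \<open>X\<close> are constant along the line.\<close>

lemma hyperbolic_if_Brody_hyperbolic:
  fixes X :: "'q pts cspace"
  assumes Br: "Brody_hyperbolic X"
  shows "hyperbolic (const_ss (rep X :: ('q pts, ('q pts, 'b) sect) presheaf))"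
  unfolding hyperbolic_const_iff[OF is_sheaf_rep]
proof (intro allI impI)
  fix Y :: "('q, 'b) ssh" assume Y: "is_ssheaf Y"
  let ?F = "rep X :: ('q pts, ('q pts, 'b) sect) presheaf"
  let ?L = "srep cline :: ('q, 'b) ssh"
  let ?P = "sprod Y ?L"
  let ?o = "\<lambda>U. const_sec U (Inl 0) :: ('q pts, 'b) sect"
  have P: "is_ssheaf ?P" using Y is_ssheaf_srep by (rule is_ssheaf_sprod)
  have pr: "sproj Y ?L \<in> ss_hom ?P Y" using Y is_ssheaf_srep by (rule sproj_in)
  have o: "?o U \<in> sections (level ?L n) U" if "complex_space U" for U n
    using const_sec_in[OF that, of "Inl 0" cline] by (simp add: points_cline del: rep_simps)
  have so: "SPair s (?o U) \<in> sections (level ?P n) U" if "complex_space U" "s \<in> sections (level Y n) U" for U s n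
    using that o[OF that(1), of n] by (auto simp: sprod_simps simp del: rep_simps)
  have "natural (level Y n) (level ?L n) (\<lambda>U _. ?o U)" for n
    by (rule naturalI) (simp_all add: const_sec_in points_cline restr_const_sec del: rep_simps)
  moreover have "natural (level Y n) (level Y n) (\<lambda>U s. s)" for n
    by (rule naturalI) (simp_all add: restr_in[OF ssheaf_presheaf[OF Y]])
  ultimately have sec: "natural (level Y n) (level ?P n) (\<lambda>U s. SPair s (?o U))" for n
    by (intro natural_SPair)
  show "bij_betw (\<lambda>g. ss_comp ?P g (sproj Y ?L)) (ss_hom Y (const_ss ?F)) (ss_hom ?P (const_ss ?F))"
    unfolding bij_betw_def
  proof (intro conjI equalityI subsetI inj_onI)
    fix g h assume g: "g \<in> ss_hom Y (const_ss ?F)" and h: "h \<in> ss_hom Y (const_ss ?F)"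
      and eq: "ss_comp ?P g (sproj Y ?L) = ss_comp ?P h (sproj Y ?L)"
    show "g = h"
    proof (rule ss_hom_eqI[OF g h])
      fix n U s assume U: "complex_space U" and s: "s \<in> sections (level Y n) U"
      have "ss_comp ?P g (sproj Y ?L) n U (SPair s (?o U)) = ss_comp ?P h (sproj Y ?L) n U (SPair s (?o U))" by (simp add: eq)
      then show "g n U s = h n U s"
        by (simp add: ss_comp_apply[OF U so[OF U s]] sproj_apply[OF U s o[OF U]])
    qed
  next
    fix k assume "k \<in> (\<lambda>g. ss_comp ?P g (sproj Y ?L)) ` ss_hom Y (const_ss ?F)"
    then show "k \<in> ss_hom ?P (const_ss ?F)" using ss_comp_in[OF P pr] by blast
  next
    fix k assume k: "k \<in> ss_hom ?P (const_ss ?F)"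
    define h where "h = norm_mor Y (\<lambda>n U s. k n U (SPair s (?o U)))"
    have h: "h \<in> ss_hom Y (const_ss ?F)"
      unfolding h_def
    proof (rule norm_mor_in_ss_hom[OF Y])
      show "natural (level Y n) (level (const_ss ?F) n) (\<lambda>U s. k n U (SPair s (?o U)))" for n
        using natural_comp[OF sec const_hom_natural[OF k]] by simp
      show "k m U (SPair (oper Y m n \<alpha> U s) (?o U)) = oper (const_ss ?F) m n \<alpha> U (k n U (SPair s (?o U)))"
        if "\<alpha> \<in> delta m n" "complex_space U" "s \<in> sections (level Y n) U" for m n \<alpha> U s
        using const_hom_oper[OF k that(1,2) so[OF that(2,3)]] by (simp add: sprod_simps srep_def)
    qed
    have "ss_comp ?P h (sproj Y ?L) = k"
    proof (rule ss_hom_eqI[OF ss_comp_in[OF P pr h] k])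
      fix n U x assume U: "complex_space U" and x: "x \<in> sections (level ?P n) U"
      then obtain s c where sc: "x = SPair s (SHol c)" "s \<in> sections (level Y n) U" "c \<in> hol_maps U cline"
        by (auto simp: sprod_simps)
      have "(\<lambda>u\<in>points U. Inl 0) \<in> hol_maps U cline" using U by (rule hol_maps_const) (simp add: points_cline)
      then have "k n U (SPair s (?o U)) = k n U x"
        unfolding sc(1) const_sec_def
        by (intro Brody_constant_along_line[OF Br Y const_hom_natural[OF k] U sc(2) _ sc(3)])
      moreover have "sproj Y ?L n U x = s"
        using sc unfolding sc(1) by (intro sproj_apply[OF U sc(2)]) auto
      ultimately show "ss_comp ?P h (sproj Y ?L) n U x = k n U x"
        by (simp add: ss_comp_apply[OF U x] h_def norm_mor_apply[OF U sc(2)])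
    qed
    then show "k \<in> (\<lambda>g. ss_comp ?P g (sproj Y ?L)) ` ss_hom Y (const_ss ?F)" using h by blast
  qed
qed

theorem corollary4p1:
  fixes Ip :: "('q, 'b) ssh \<Rightarrow> ('q, 'b) ssh"
    and Ipm :: "('q, 'b) ssh \<Rightarrow> ('q, 'b) ssh \<Rightarrow> ('q, 'b) ssh_mor \<Rightarrow> ('q, 'b) ssh_mor"
    and r :: "('q, 'b) ssh \<Rightarrow> ('q, 'b) ssh_mor"
    and z1 z2 :: complex
  assumes "z1 \<in> ball 0 1" and "z2 \<in> ball 0 1" and "z1 \<noteq> z2"
  shows "(\<forall>X x. hyperbolic_resolution Ip Ipm r \<and> is_ssheaf X \<and> x \<in> ss_hom spt X \<and>
            ((\<exists>i j. i > j \<and> pi_par_nonzero i j (X, x)) \<or>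
             (\<exists>n m. m > 0 \<and> pi_iper_nonzero z1 z2 n m (X, x))) \<longrightarrow>
            \<not> (\<exists>F. is_sheaf F \<and> hyperbolic (const_ss F) \<and> C_weakly_equivalent (Ip X) (const_ss F))) \<and>
         (\<forall>(X :: 'q pts cspace) x. complex_space X \<and> x \<in> points X \<and>
            ((\<exists>i j. i > j \<and> pi_par_nonzero i j (srep_pt X x :: ('q, 'b) pssh)) \<or>
             (\<exists>n m. m > 0 \<and> pi_iper_nonzero z1 z2 n m (srep_pt X x :: ('q, 'b) pssh))) \<longrightarrow>
            \<not> Brody_hyperbolic X)"
proof (intro conjI allI impI; elim conjE)
  fix X :: "('q, 'b) ssh" and x
  assume res: "hyperbolic_resolution Ip Ipm r" and X: "is_ssheaf X"
    and nz: "(\<exists>i j. i > j \<and> pi_par_nonzero i j (X, x)) \<or> (\<exists>n m. m > 0 \<and> pi_iper_nonzero z1 z2 n m (X, x))"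
  have Ip: "is_ssheaf (Ip X)" "r X \<in> C_weq X (Ip X)"
    using res X unfolding hyperbolic_resolution_def hyperbolic_def by blast+
  show "\<not> (\<exists>F. is_sheaf F \<and> hyperbolic (const_ss F) \<and> C_weakly_equivalent (Ip X) (const_ss F))"
  proof
    assume "\<exists>F. is_sheaf F \<and> hyperbolic (const_ss F) \<and> C_weakly_equivalent (Ip X) (const_ss F)"
    then obtain F where F: "is_sheaf F" "hyperbolic (const_ss F)" and iso: "loc_iso SSh C_weq (Ip X) (const_ss F)"
      unfolding C_weakly_equivalent_def by blast
    \<comment> \<open>The equivalence is carried back along \<open>r X\<close>, so that the homotopy
      sets of \<open>X\<close> at the given base point are concerned.\<close>
    obtain \<phi> where "\<phi> \<in> C_weq X (const_ss F)"
      by (rule C_weq_if_loc_iso_const[OF F X loc_iso_precomp_C_weq[OF X Ip iso]])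
    then show False using homotopy_trivial_if_C_weq_hyperbolic[OF F] nz by blast
  qed
next
  fix X :: "'q pts cspace" and x
  assume nz: "(\<exists>i j. i > j \<and> pi_par_nonzero i j (srep_pt X x :: ('q, 'b) pssh)) \<or>
      (\<exists>n m. m > 0 \<and> pi_iper_nonzero z1 z2 n m (srep_pt X x :: ('q, 'b) pssh))"
  show "\<not> Brody_hyperbolic X"
  proof
    assume "Brody_hyperbolic X"
    then have hyp: "hyperbolic (const_ss (rep X :: ('q pts, ('q pts, 'b) sect) presheaf))"
      by (rule hyperbolic_if_Brody_hyperbolic)
    \<comment> \<open>\<open>srep X\<close> is by definition the constant simplicial sheaf on
      \<open>rep X\<close>, so the identity serves as the equivalence with a hyperbolic
      sheaf.\<close>
    have "ss_id (srep X) \<in> C_weq (srep X) (const_ss (rep X :: ('q pts, ('q pts, 'b) sect) presheaf))"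
      using ss_id_C_weq[OF is_ssheaf_srep] by (simp add: srep_def)
    from homotopy_trivial_if_C_weq_hyperbolic[OF is_sheaf_rep hyp this]
    show False using nz unfolding srep_pt_def by blast
  qed
qed

end
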